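(* Let $A$ and $B$ be two positive invertible elements in $\mathcal{A}$, which is a $C^*$-algebra or a real $C^*$-algebra or a JC-algebra, with a unit. (i) If $\delta\geq 1$ and $\delta A\leq B$, then \begin{align*} A-AB^{-1}A &\leq 2[A-2A(A+B)^{-1}A]\\ &\leq (\ln\delta)A+2[A-2\delta A(\delta A+B)^{-1}A]\\ &\leq (\ln\delta+4)A-8\sqrt{\delta}A(A\#_{\frac{1}{2}}B+\sqrt{\delta}A)^{-1}A \\ &\leq S(A|B)\\ &\leq \left( \frac{1}{\sqrt{\delta}}A\#_{\frac{1}{2}}B-\sqrt{\delta} A\#_{-\frac{1}{2}}B \right)+(\ln\delta) A\\ &\leq \frac{1}{2} \left( \frac{1}{\delta}B-\delta AB^{-1}A \right)+(\ln\delta) A\\ &\leq \frac{1}{2}(B-AB^{-1}A)\\ &\leq B-A. \end{align*} (ii) If $0<\delta\leq 1$ and $\delta A\geq B$, then \begin{align*} A-AB^{-1}A &\leq \frac{1}{2}(B-AB^{-1}A)\\ &\leq \frac{1}{2} \left( \frac{1}{\delta}B-\delta AB^{-1}A \right)+(\ln\delta) A\\ &\leq \left( \frac{1}{\sqrt{\delta}}A\#_{\frac{1}{2}}B-\sqrt{\delta} A\#_{-\frac{1}{2}}B \right)+(\ln\delta) A\\ &\leq S(A|B)\\ &\leq (\ln\delta+4)A-8\sqrt{\delta}A(A\#_{\frac{1}{2}}B+\sqrt{\delta}A)^{-1}A \\ &\leq (\ln\delta)A+2[A-2\delta A(\delta A+B)^{-1}A]\\ &\leq 2[A-2A(A+B)^{-1}A]\\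 &\leq B-A. \end{align*}
   Context: A JC-algebra is a norm-closed Jordan subalgebra of $B(H)_{sa}$, the self-adjoint bounded operators on a complex Hilbert space $H$, with Jordan product $A\circ B=\frac12(AB+BA)$, ordered by the cone of positive operators. In the JC case, products are computed in the ambient $B(H)$ (with $ABA=2(A\circ B)\circ A-A^2\circ B$), and all expressions in the claim belong to $\mathcal{A}$. For self-adjoint elements, $X\leq Y$ means $Y-X$ is positive. Real powers, logarithms and inverses are taken by continuous functional calculus for self-adjoint elements, relative to the unit of $\mathcal{A}$. For positive invertible $A,B\in\mathcal{A}$ and $\alpha\in\mathbb{R}$: the relative operator entropy is $S(A|B)=A^{\frac12}\left[\log(A^{-\frac12}BA^{-\frac12})\right]A^{\frac12}$, and the $\alpha$-geometric mean is $A\#_{\alpha}B=A^{\frac12}(A^{-\frac12}BA^{-\frac12})^{\alpha}A^{\frac12}$. *)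

theory Defs
  imports "HOL-Analysis.Analysis"
begin

section \<open>C*-algebras and real C*-algebras\<close>

class complex_vector = real_vector +
  fixes scaleC :: "complex \<Rightarrow> 'a \<Rightarrow> 'a" (infixr "*\<^sub>C" 75)
  assumes scaleC_add_right: "c *\<^sub>C (x + y) = c *\<^sub>C x + c *\<^sub>C y"
    and scaleC_add_left: "(c + d) *\<^sub>C x = c *\<^sub>C x + d *\<^sub>C x"
    and scaleC_scaleC: "c *\<^sub>C d *\<^sub>C x = (c * d) *\<^sub>C x"
    and scaleC_of_real: "complex_of_real r *\<^sub>C x = r *\<^sub>R x"

text \<open>
  None of the algebra classes below contains a unit; the unit of the algebra is an explicit
  element, see \<open>unit_element\<close>.  In this way the zero algebra is not excluded, and the unit
  is treated as for JC-algebras, whose unit need not be the identity operator.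
\<close>

class banach_star_algebra = real_normed_algebra + banach +
  fixes star :: "'a \<Rightarrow> 'a"
  assumes star_star: "star (star x) = x"
    and star_add: "star (x + y) = star x + star y"
    and star_scaleR: "star (r *\<^sub>R x) = r *\<^sub>R star x"
    and star_mult: "star (x * y) = star y * star x"
    and cstar_identity: "norm (star x * x) = (norm x)\<^sup>2"

class cstar_algebra = banach_star_algebra + complex_vector +
  assumes mult_scaleC_left: "(c *\<^sub>C x) * y = c *\<^sub>C (x * y)"
    and mult_scaleC_right: "x * (c *\<^sub>C y) = c *\<^sub>C (x * y)"
    and norm_scaleC: "norm (c *\<^sub>C x) = cmod c * norm x"
    and star_scaleC: "star (c *\<^sub>C x) = cnj c *\<^sub>C star x"

text \<open>
  Over the reals the C*-identity has to be supplemented by the requirement that \<open>1 + x\<^sup>*x\<close> is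
  invertible for all \<open>x\<close> (it excludes, for instance, the complex numbers with the trivial
  involution).  The axiom says this in the unitization, where
  \<open>(1 + x\<^sup>*x)(1 + y) = 1 = (1 + y)(1 + x\<^sup>*x)\<close>; if the algebra has a unit, it is equivalent to
  invertibility with respect to that unit.
\<close>

class real_cstar_algebra = banach_star_algebra +
  assumes one_plus_star_mult_self_invertible:
    "\<exists>y. star x * x + y + (star x * x) * y = 0 \<and> star x * x + y + y * (star x * x) = 0"

definition unit_element :: "'a::real_normed_algebra \<Rightarrow> bool" where
  "unit_element e \<longleftrightarrow> (\<forall>x. e * x = x \<and> x * e = x)"

definition positive_element :: "'a::banach_star_algebra \<Rightarrow> bool" where
  "positive_element a \<longleftrightarrow> (\<exists>x. a = star x * x)"


section \<open>Bounded operators on a complex Hilbert space and JC-algebras\<close>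

class complex_hilbert = complex_vector + banach +
  fixes cinner :: "'a \<Rightarrow> 'a \<Rightarrow> complex"
  assumes cinner_commute: "cinner x y = cnj (cinner y x)"
    and cinner_add_left: "cinner (x + y) z = cinner x z + cinner y z"
    and cinner_scaleC_left: "cinner (c *\<^sub>C x) y = c * cinner x y"
    and cinner_norm: "cinner x x = complex_of_real ((norm x)\<^sup>2)"

text \<open>
  The algebra \<open>B(H)\<close>: library bounded linear maps are only real-linear, so complex homogeneity
  is imposed.  The norm is the operator norm inherited from \<^typ>\<open>'h \<Rightarrow>\<^sub>L 'h\<close>.
\<close>

typedef (overloaded) 'h operator =
  "{T :: 'h::complex_hilbert \<Rightarrow>\<^sub>L 'h. \<forall>c x. blinfun_apply T (c *\<^sub>C x) = c *\<^sub>C blinfun_apply T x}"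
  morphisms blinfun_of_operator operator_of_blinfun
proof
  have "(c::complex) *\<^sub>C (0::'h) = 0" for c
    using scaleC_add_right[of c 0 0] by simp
  then show "0 \<in> {T :: 'h \<Rightarrow>\<^sub>L 'h. \<forall>c x. blinfun_apply T (c *\<^sub>C x) = c *\<^sub>C blinfun_apply T x}"
    by simp
qed

setup_lifting type_definition_operator

lemma scaleC_zero_right [simp]: "c *\<^sub>C (0::'h::complex_vector) = 0"
  using scaleC_add_right[of c 0 0] by simp

lemma scaleC_minus_right: "c *\<^sub>C (- x) = - (c *\<^sub>C (x::'h::complex_vector))"
  using scaleC_add_right[of c x "- x"] by (simp add: eq_neg_iff_add_eq_0 add.commute)

lemma scaleC_diff_right: "c *\<^sub>C (x - y) = c *\<^sub>C x - c *\<^sub>C (y::'h::complex_vector)"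
  using scaleC_add_right[of c x "- y"] by (simp add: scaleC_minus_right)

lemma scaleC_scaleR_commute: "c *\<^sub>C (r *\<^sub>R x) = r *\<^sub>R (c *\<^sub>C (x::'h::complex_vector))"
  by (metis scaleC_of_real scaleC_scaleC mult.commute)

instantiation operator :: (complex_hilbert) real_normed_algebra
begin

lift_definition zero_operator :: "'a operator" is 0
  by simp

lift_definition plus_operator :: "'a operator \<Rightarrow> 'a operator \<Rightarrow> 'a operator" is "(+)"
  by (simp add: blinfun.add_left scaleC_add_right)

lift_definition minus_operator :: "'a operator \<Rightarrow> 'a operator \<Rightarrow> 'a operator" is "(-)"
  by (simp add: blinfun.diff_left scaleC_diff_right)

lift_definition uminus_operator :: "'a operator \<Rightarrow> 'a operator" is uminus
  by (simp add: blinfun.minus_left scaleC_minus_right)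

lift_definition scaleR_operator :: "real \<Rightarrow> 'a operator \<Rightarrow> 'a operator" is scaleR
  by (simp add: blinfun.scaleR_left scaleC_scaleR_commute)

lift_definition times_operator :: "'a operator \<Rightarrow> 'a operator \<Rightarrow> 'a operator" is blinfun_compose
  by simp

lift_definition norm_operator :: "'a operator \<Rightarrow> real" is norm .

definition sgn_operator :: "'a operator \<Rightarrow> 'a operator" where
  "sgn_operator T = scaleR (inverse (norm T)) T"

definition dist_operator :: "'a operator \<Rightarrow> 'a operator \<Rightarrow> real" where
  "dist_operator S T = norm (S - T)"

definition uniformity_operator :: "('a operator \<times> 'a operator) filter" where
  "uniformity_operator = (INF \<epsilon>\<in>{0<..}. principal {(S, T). dist S T < \<epsilon>})"

definition open_operator :: "'a operator set \<Rightarrow> bool" where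
  "open_operator U \<longleftrightarrow> (\<forall>T\<in>U. \<forall>\<^sub>F (T', S) in uniformity. T' = T \<longrightarrow> S \<in> U)"

instance
proof
  fix S T U :: "'a operator" and r s :: real
  show "S + T + U = S + (T + U)" by transfer simp
  show "S + T = T + S" by transfer simp
  show "0 + S = S" by transfer simp
  show "- S + S = 0" by transfer simp
  show "S - T = S + - T" by transfer simp
  show "r *\<^sub>R (S + T) = r *\<^sub>R S + r *\<^sub>R T" by transfer (simp add: scaleR_add_right)
  show "(r + s) *\<^sub>R S = r *\<^sub>R S + s *\<^sub>R S" by transfer (simp add: scaleR_add_left)
  show "r *\<^sub>R s *\<^sub>R S = (r * s) *\<^sub>R S" by transfer simp
  show "1 *\<^sub>R S = S" by transfer simp
  show "S * T * U = S * (T * U)" by transfer (auto intro: blinfun_eqI)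
  show "(S + T) * U = S * U + T * U"
    by transfer (auto intro!: blinfun_eqI simp: blinfun.bilinear_simps)
  show "S * (T + U) = S * T + S * U"
    by transfer (auto intro!: blinfun_eqI simp: blinfun.bilinear_simps)
  show "r *\<^sub>R S * T = r *\<^sub>R (S * T)" by transfer (auto intro!: blinfun_eqI simp: blinfun.bilinear_simps)
  show "S * r *\<^sub>R T = r *\<^sub>R (S * T)" by transfer (auto intro!: blinfun_eqI simp: blinfun.bilinear_simps)
  show "sgn S = scaleR (inverse (norm S)) S" by (rule sgn_operator_def)
  show "dist S T = norm (S - T)" by (rule dist_operator_def)
  show "uniformity = (INF \<epsilon>\<in>{0<..}. principal {(S::'a operator, T). dist S T < \<epsilon>})"
    by (rule uniformity_operator_def)
  show "open V \<longleftrightarrow> (\<forall>T\<in>V. \<forall>\<^sub>F (T', S) in uniformity. T' = T \<longrightarrow> S \<in> V)"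
    for V :: "'a operator set" by (rule open_operator_def)
  show "norm S = 0 \<longleftrightarrow> S = 0" by transfer simp
  show "norm (S + T) \<le> norm S + norm T" by transfer (rule norm_triangle_ineq)
  show "norm (r *\<^sub>R S) = \<bar>r\<bar> * norm S" by transfer simp
  show "norm (S * T) \<le> norm S * norm T" by transfer (rule norm_blinfun_compose)
qed

end

lift_definition operator_apply :: "'h::complex_hilbert operator \<Rightarrow> 'h \<Rightarrow> 'h" is blinfun_apply .

definition selfadjoint_operator :: "'h::complex_hilbert operator \<Rightarrow> bool" where
  "selfadjoint_operator T \<longleftrightarrow>
     (\<forall>x y. cinner (operator_apply T x) y = cinner x (operator_apply T y))"

text \<open>For self-adjoint \<open>T\<close> the numbers \<open>cinner (T x) x\<close> are real.\<close>

definition positive_operator :: "'h::complex_hilbert operator \<Rightarrow> bool" where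
  "positive_operator T \<longleftrightarrow>
     selfadjoint_operator T \<and> (\<forall>x. 0 \<le> Re (cinner (operator_apply T x) x))"

definition jordan_product :: "'a::real_normed_algebra \<Rightarrow> 'a \<Rightarrow> 'a" where
  "jordan_product a b = (1/2) *\<^sub>R (a * b + b * a)"

definition jc_algebra :: "'h::complex_hilbert operator set \<Rightarrow> bool" where
  "jc_algebra \<A> \<longleftrightarrow>
     (\<forall>T\<in>\<A>. selfadjoint_operator T) \<and> subspace \<A> \<and> closed \<A> \<and>
     (\<forall>S\<in>\<A>. \<forall>T\<in>\<A>. jordan_product S T \<in> \<A>)"

definition jc_unit :: "'h::complex_hilbert operator set \<Rightarrow> 'h operator \<Rightarrow> bool" where
  "jc_unit \<A> e \<longleftrightarrow> e \<in> \<A> \<and> (\<forall>T\<in>\<A>. jordan_product e T = T)"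


section \<open>Functional calculus, geometric means and relative operator entropy\<close>

text \<open>
  The locale only fixes names: \<open>\<A>\<close> is the set of elements of the algebra, sitting in an ambient
  associative algebra, \<open>e\<close> is its unit and \<open>pos\<close> its predicate of positivity.  It is used with
  \<open>\<A> = UNIV\<close> for C*-algebras and real C*-algebras, and with the JC-algebra
  \<open>\<A> \<subseteq> B(H)\<close> (then \<open>e\<close> is a projection acting as two-sided unit on \<open>\<A>\<close>).
\<close>

locale unital_operator_algebra =
  fixes \<A> :: "'a::real_normed_algebra set"
    and e :: 'a
    and pos :: "'a \<Rightarrow> bool"
begin

definition le :: "'a \<Rightarrow> 'a \<Rightarrow> bool" (infix "\<preceq>" 50) where
  "X \<preceq> Y \<longleftrightarrow> pos (Y - X)"

definition invertible_element :: "'a \<Rightarrow> bool" where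
  "invertible_element a \<longleftrightarrow> (\<exists>b\<in>\<A>. a * b = e \<and> b * a = e)"

text \<open>Only spectra of self-adjoint elements are used; these are real.\<close>

definition spectrum :: "'a \<Rightarrow> real set" where
  "spectrum a = {t. \<not> invertible_element (a - t *\<^sub>R e)}"

text \<open>
  \<open>\<Phi>\<close> is an isometric unital homomorphism from the real-valued continuous functions on the
  spectrum of \<open>a\<close> (with the supremum norm) into \<open>\<A>\<close>, sending the identity function to \<open>a\<close>.
  The last clause says \<open>norm (\<Phi> f) = sup {\<bar>f t\<bar> | t \<in> spectrum a}\<close> in a form which is also
  meaningful for the empty spectrum (zero algebra); in particular \<open>\<Phi> f\<close> depends only on the
  restriction of \<open>f\<close> to the spectrum.
\<close>

definition continuous_calculus :: "'a \<Rightarrow> ((real \<Rightarrow> real) \<Rightarrow> 'a) \<Rightarrow> bool" where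
  "continuous_calculus a \<Phi> \<longleftrightarrow>
     \<Phi> (\<lambda>t. 1) = e \<and> \<Phi> (\<lambda>t. t) = a \<and>
     (\<forall>f. continuous_on (spectrum a) f \<longrightarrow>
        \<Phi> f \<in> \<A> \<and>
        (\<forall>r. \<Phi> (\<lambda>t. r * f t) = r *\<^sub>R \<Phi> f) \<and>
        (\<forall>g. continuous_on (spectrum a) g \<longrightarrow>
           \<Phi> (\<lambda>t. f t + g t) = \<Phi> f + \<Phi> g \<and> \<Phi> (\<lambda>t. f t * g t) = \<Phi> f * \<Phi> g) \<and>
        (\<forall>M\<ge>0. norm (\<Phi> f) \<le> M \<longleftrightarrow> (\<forall>t\<in>spectrum a. \<bar>f t\<bar> \<le> M)))"

definition fun_calc :: "(real \<Rightarrow> real) \<Rightarrow> 'a \<Rightarrow> 'a" where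
  "fun_calc f a = (THE b. \<exists>\<Phi>. continuous_calculus a \<Phi> \<and> b = \<Phi> f)"

definition real_power :: "'a \<Rightarrow> real \<Rightarrow> 'a" (infixr "\<up>" 80) where
  "a \<up> r = fun_calc (\<lambda>t. t powr r) a"

definition inverse_of :: "'a \<Rightarrow> 'a" where
  "inverse_of a = fun_calc (\<lambda>t. 1 / t) a"

definition log_of :: "'a \<Rightarrow> 'a" where
  "log_of a = fun_calc ln a"

definition geometric_mean :: "'a \<Rightarrow> real \<Rightarrow> 'a \<Rightarrow> 'a" where
  "geometric_mean A \<alpha> B = A \<up> (1/2) * (A \<up> (-1/2) * B * A \<up> (-1/2)) \<up> \<alpha> * A \<up> (1/2)"

definition relative_entropy :: "'a \<Rightarrow> 'a \<Rightarrow> 'a" where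
  "relative_entropy A B = A \<up> (1/2) * log_of (A \<up> (-1/2) * B * A \<up> (-1/2)) * A \<up> (1/2)"

definition entropy_bounds_ge_1 :: "real \<Rightarrow> 'a \<Rightarrow> 'a \<Rightarrow> bool" where
  "entropy_bounds_ge_1 \<delta> A B \<longleftrightarrow>
     A - A * inverse_of B * A
       \<preceq> 2 *\<^sub>R (A - 2 *\<^sub>R (A * inverse_of (A + B) * A)) \<and>
     2 *\<^sub>R (A - 2 *\<^sub>R (A * inverse_of (A + B) * A))
       \<preceq> ln \<delta> *\<^sub>R A + 2 *\<^sub>R (A - (2 * \<delta>) *\<^sub>R (A * inverse_of (\<delta> *\<^sub>R A + B) * A)) \<and>
     ln \<delta> *\<^sub>R A + 2 *\<^sub>R (A - (2 * \<delta>) *\<^sub>R (A * inverse_of (\<delta> *\<^sub>R A + B) * A))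
       \<preceq> (ln \<delta> + 4) *\<^sub>R A
          - (8 * sqrt \<delta>) *\<^sub>R (A * inverse_of (geometric_mean A (1/2) B + sqrt \<delta> *\<^sub>R A) * A) \<and>
     (ln \<delta> + 4) *\<^sub>R A
          - (8 * sqrt \<delta>) *\<^sub>R (A * inverse_of (geometric_mean A (1/2) B + sqrt \<delta> *\<^sub>R A) * A)
       \<preceq> relative_entropy A B \<and>
     relative_entropy A B
       \<preceq> ((1 / sqrt \<delta>) *\<^sub>R geometric_mean A (1/2) B - sqrt \<delta> *\<^sub>R geometric_mean A (-1/2) B)
          + ln \<delta> *\<^sub>R A \<and>
     ((1 / sqrt \<delta>) *\<^sub>R geometric_mean A (1/2) B - sqrt \<delta> *\<^sub>R geometric_mean A (-1/2) B)
          + ln \<delta> *\<^sub>R A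
       \<preceq> (1/2) *\<^sub>R ((1 / \<delta>) *\<^sub>R B - \<delta> *\<^sub>R (A * inverse_of B * A)) + ln \<delta> *\<^sub>R A \<and>
     (1/2) *\<^sub>R ((1 / \<delta>) *\<^sub>R B - \<delta> *\<^sub>R (A * inverse_of B * A)) + ln \<delta> *\<^sub>R A
       \<preceq> (1/2) *\<^sub>R (B - A * inverse_of B * A) \<and>
     (1/2) *\<^sub>R (B - A * inverse_of B * A)
       \<preceq> B - A"

definition entropy_bounds_le_1 :: "real \<Rightarrow> 'a \<Rightarrow> 'a \<Rightarrow> bool" where
  "entropy_bounds_le_1 \<delta> A B \<longleftrightarrow>
     A - A * inverse_of B * A
       \<preceq> (1/2) *\<^sub>R (B - A * inverse_of B * A) \<and>
     (1/2) *\<^sub>R (B - A * inverse_of B * A)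
       \<preceq> (1/2) *\<^sub>R ((1 / \<delta>) *\<^sub>R B - \<delta> *\<^sub>R (A * inverse_of B * A)) + ln \<delta> *\<^sub>R A \<and>
     (1/2) *\<^sub>R ((1 / \<delta>) *\<^sub>R B - \<delta> *\<^sub>R (A * inverse_of B * A)) + ln \<delta> *\<^sub>R A
       \<preceq> ((1 / sqrt \<delta>) *\<^sub>R geometric_mean A (1/2) B - sqrt \<delta> *\<^sub>R geometric_mean A (-1/2) B)
          + ln \<delta> *\<^sub>R A \<and>
     ((1 / sqrt \<delta>) *\<^sub>R geometric_mean A (1/2) B - sqrt \<delta> *\<^sub>R geometric_mean A (-1/2) B)
          + ln \<delta> *\<^sub>R A
       \<preceq> relative_entropy A B \<and>
     relative_entropy A B
       \<preceq> (ln \<delta> + 4) *\<^sub>R A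
          - (8 * sqrt \<delta>) *\<^sub>R (A * inverse_of (geometric_mean A (1/2) B + sqrt \<delta> *\<^sub>R A) * A) \<and>
     (ln \<delta> + 4) *\<^sub>R A
          - (8 * sqrt \<delta>) *\<^sub>R (A * inverse_of (geometric_mean A (1/2) B + sqrt \<delta> *\<^sub>R A) * A)
       \<preceq> ln \<delta> *\<^sub>R A + 2 *\<^sub>R (A - (2 * \<delta>) *\<^sub>R (A * inverse_of (\<delta> *\<^sub>R A + B) * A)) \<and>
     ln \<delta> *\<^sub>R A + 2 *\<^sub>R (A - (2 * \<delta>) *\<^sub>R (A * inverse_of (\<delta> *\<^sub>R A + B) * A))
       \<preceq> 2 *\<^sub>R (A - 2 *\<^sub>R (A * inverse_of (A + B) * A)) \<and>
     2 *\<^sub>R (A - 2 *\<^sub>R (A * inverse_of (A + B) * A))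
       \<preceq> B - A"

end

end

theory Submission
  imports Defs "HOL-Computational_Algebra.Fundamental_Theorem_Algebra"
begin

text \<open>
  With \<open>T = A\<^sup>-\<^sup>1\<^sup>/\<^sup>2 B A\<^sup>-\<^sup>1\<^sup>/\<^sup>2\<close> every term of the two chains is \<open>A\<^sup>1\<^sup>/\<^sup>2 f(T) A\<^sup>1\<^sup>/\<^sup>2\<close> for a scalar
  function \<open>f\<close>, and \<open>f \<le> g\<close> on the spectrum of \<open>T\<close> gives the operator inequality because
  \<open>g(T) - f(T)\<close> is a square.  The hypothesis \<open>\<delta> A \<le> B\<close> (or \<open>\<delta> A \<ge> B\<close>) says that this spectrum lies
  above (below) \<open>\<delta>\<close>, and the scalar chain reduces to the monotonicity of \<open>u - 1/u - 2 ln u\<close> and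
  \<open>ln u + 4/(u + 1)\<close>.

  The continuous functional calculus is obtained for all three classes of algebras at once, from the
  identity \<open>\<parallel>x\<^sup>2\<parallel> = \<parallel>x\<parallel>\<^sup>2\<close> and the invertibility of \<open>1 + x\<^sup>2\<close> for self-adjoint \<open>x\<close>.
\<close>

section \<open>Inverses in a complete Jordan algebra\<close>

text \<open>Products of elements of a JC-algebra may leave it, and no complex scalars are at hand
  there, so the calculus is not imported from Gelfand theory. Everything is phrased in a real
  subspace \<open>H\<close> with the closure property \<open>x * y * x\<close>; it then contains the
  products of its commuting elements, and only such products are formed inside it. Non-real spectral
  points enter through real quadratics.

  The constants 4 and 8 and the exponents 1/2 and -1/2 come from
  \<open>ln t = ln \<delta> + 2 * ln u\<close> with \<open>u = sqrt (t / \<delta>)\<close>: the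
  bounds \<open>2 * (1 - 2 / (1 + u))\<close> and \<open>(u - 1/u) / 2\<close> of
  \<open>ln u\<close>, doubled, are \<open>4 - 8 / (u + 1)\<close> and \<open>u - 1/u\<close>. They
  are exact at \<open>u = 1\<close> and change sides there, which is why the order of the chain is
  reversed in the second case.\<close>

lemma continuous_on_locally_lipschitz:
  fixes f :: "'a::metric_space \<Rightarrow> 'b::metric_space"
  assumes "\<And>x. x \<in> S \<Longrightarrow> \<exists>L r. r > 0 \<and> (\<forall>y\<in>S. dist y x < r \<longrightarrow> dist (f y) (f x) \<le> L * dist y x)"
  shows "continuous_on S f"
proof (unfold continuous_on_iff, intro ballI allI impI)
  fix x and \<epsilon> :: real assume x: "x \<in> S" and "0 < \<epsilon>"
  obtain L r where r: "r > 0" and L: "\<And>y. y \<in> S \<Longrightarrow> dist y x < r \<Longrightarrow> dist (f y) (f x) \<le> L * dist y x"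
    using assms[OF x] by auto
  define d where "d = min r (\<epsilon> / (\<bar>L\<bar> + 1))"
  have "dist (f y) (f x) < \<epsilon>" if "y \<in> S" "dist y x < d" for y
  proof -
    have "dist (f y) (f x) \<le> L * dist y x" using L that by (simp add: d_def)
    also have "\<dots> \<le> (\<bar>L\<bar> + 1) * dist y x" by (intro mult_right_mono) auto
    also have "\<dots> < (\<bar>L\<bar> + 1) * (\<epsilon> / (\<bar>L\<bar> + 1))"
      using that by (intro mult_strict_left_mono) (auto simp: d_def)
    finally show ?thesis by simp
  qed
  moreover have "d > 0" using r \<open>0 < \<epsilon>\<close> by (simp add: d_def)
  ultimately show "\<exists>d>0. \<forall>y\<in>S. dist y x < d \<longrightarrow> dist (f y) (f x) < \<epsilon>" by blast
qed

text \<open>The Neumann series as a fixed point: if \<open>e\<close> is a unit,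
  \<open>z = e + x * z\<close> says that \<open>z\<close> is a right inverse of
  \<open>e - x\<close>. With an invariant complete set \<open>K\<close> the inverse is found inside
  \<open>K\<close>, and no partial sums are needed.\<close>

lemma geometric_fixpoint:
  fixes x e :: "'a::real_normed_algebra"
  assumes "complete K" "K \<noteq> {}" "norm x < 1" "\<And>z. z \<in> K \<Longrightarrow> e + x * z \<in> K"
  obtains z where "z \<in> K" "e + x * z = z"
proof -
  have "\<exists>!z\<in>K. e + x * z = z"
  proof (rule Banach_fix[where c = "norm x"])
    show "dist (e + x * y) (e + x * z) \<le> norm x * dist y z" for y z
      by (simp add: dist_norm right_diff_distrib[symmetric] norm_mult_ineq)
  qed (use assms in auto)
  then show thesis using that by blast
qed

text \<open>
  \<open>H\<close> plays the role of the self-adjoint part of \<open>\<A>\<close>: it is \<open>\<A>\<close> itself for a JC-algebra.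
\<close>

locale jordan_part = unital_operator_algebra \<A> e pos
  for \<A> :: "'a::real_normed_algebra set" and e pos +
  fixes H :: "'a set"
  assumes H_subset: "H \<subseteq> \<A>"
    and unit_left: "x \<in> \<A> \<Longrightarrow> e * x = x" and unit_right: "x \<in> \<A> \<Longrightarrow> x * e = x"
    and e_H: "e \<in> H"
    and subspace_H: "subspace H"
    and complete_H: "complete H"
    and quadratic_H: "x \<in> H \<Longrightarrow> y \<in> H \<Longrightarrow> x * y * x \<in> H"
    and norm_square: "x \<in> H \<Longrightarrow> norm (x * x) = (norm x)\<^sup>2"
    and inverse_H: "x \<in> H \<Longrightarrow> b \<in> \<A> \<Longrightarrow> x * b = e \<Longrightarrow> b * x = e \<Longrightarrow> b \<in> H"
begin

lemma add_H: "x \<in> H \<Longrightarrow> y \<in> H \<Longrightarrow> x + y \<in> H"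
  and diff_H: "x \<in> H \<Longrightarrow> y \<in> H \<Longrightarrow> x - y \<in> H"
  and scale_H: "x \<in> H \<Longrightarrow> r *\<^sub>R x \<in> H"
  and zero_H: "0 \<in> H"
  using subspace_H by (simp_all add: subspace_add subspace_diff subspace_scale subspace_0)

text \<open>The last two forms are stated separately because a product of elements of
  \<open>H\<close> may lie outside \<open>\<A>\<close>, where \<open>e\<close> is not assumed to be
  neutral.\<close>

lemma unit_H [simp]:
  assumes "x \<in> H"
  shows "e * x = x" "x * e = x" "e * (x * y) = x * y" "y * x * e = y * x"
proof -
  show 1: "e * x = x" "x * e = x"
    using assms H_subset unit_left unit_right by blast+
  show "e * (x * y) = x * y" using 1 by (metis mult.assoc)
  show "y * x * e = y * x" using 1 by (metis mult.assoc)
qed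

lemma unit_idem [simp]: "e * e = e"
  by (simp add: e_H)

lemma square_H: "x \<in> H \<Longrightarrow> x * x \<in> H"
  using quadratic_H[of x e] e_H by simp

text \<open>Polarization of the squares. Because of this, commutation is carried along with every
  inverse and every polynomial below.\<close>

lemma commuting_mult_H:
  assumes "x \<in> H" "y \<in> H" "x * y = y * x"
  shows "x * y \<in> H"
proof -
  have "(1/2) *\<^sub>R ((x + y) * (x + y) - x * x - y * y) \<in> H"
    by (intro scale_H diff_H square_H add_H assms)
  also have "(x + y) * (x + y) - x * x - y * y = 2 *\<^sub>R (x * y)"
    using assms(3) by (simp add: algebra_simps scaleR_2)
  finally show ?thesis by simp
qed

lemmas H_intros = e_H zero_H add_H diff_H scale_H square_H

text \<open>An idempotent with \<open>norm (e * e) = (norm e)^2\<close> has norm 0 or 1; the zero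
  algebra is allowed, so an upper bound is all that holds in general.\<close>

lemma norm_e_le: "norm e \<le> 1"
proof -
  have "norm e * 1 = norm e * norm e" using norm_square[OF e_H] by (simp add: power2_eq_square)
  then show ?thesis by (cases "norm e = 0") (auto simp del: norm_eq_zero)
qed

text \<open>Membership of the inverse in \<open>H\<close> is built in, since
  \<open>commuting_mult_H\<close> asks for it whenever inverses are multiplied.\<close>

definition inverse_pair :: "'a \<Rightarrow> 'a \<Rightarrow> bool" where
  "inverse_pair x b \<longleftrightarrow> b \<in> H \<and> x * b = e \<and> b * x = e"

lemma inverse_pairD:
  assumes "inverse_pair x b"
  shows "b \<in> H" "x * b = e" "b * x = e"
  using assms by (simp_all add: inverse_pair_def)

lemma invertible_iff: "x \<in> H \<Longrightarrow> invertible_element x \<longleftrightarrow> (\<exists>b. inverse_pair x b)"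
  using inverse_H H_subset by (auto simp: invertible_element_def inverse_pair_def)

lemma inverse_pair_unique:
  assumes "inverse_pair x b" "inverse_pair x c" shows "b = c"
  by (metis assms inverse_pairD mult.assoc unit_H(1,2))

lemma inverse_pair_commute:
  assumes b: "inverse_pair x b" and "y \<in> H" "x * y = y * x"
  shows "b * y = y * b"
proof -
  have "b * y = b * (y * (x * b))" using assms inverse_pairD[OF b] by simp
  also have "\<dots> = (b * x) * (y * b)" using assms(3) by (metis mult.assoc)
  also have "\<dots> = y * b" using assms inverse_pairD[OF b] by simp
  finally show ?thesis .
qed

lemma inverse_pair_mult:
  assumes b: "inverse_pair x b" and c: "inverse_pair y c"
    and xy: "x \<in> H" "y \<in> H" "x * y = y * x"
  shows "inverse_pair (x * y) (b * c)" "b * c = c * b"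
proof -
  have "b * y = y * b" by (rule inverse_pair_commute[OF b xy(2,3)])
  then show bc: "b * c = c * b"
    using inverse_pair_commute[OF c] inverse_pairD[OF b] by metis
  have "x * y * (b * c) = x * (y * c) * b" by (metis bc mult.assoc)
  then have 1: "x * y * (b * c) = e" using inverse_pairD[OF b] inverse_pairD[OF c] xy by simp
  have "b * c * (x * y) = b * (c * y) * x" by (metis xy(3) mult.assoc)
  then have 2: "b * c * (x * y) = e" using inverse_pairD[OF b] inverse_pairD[OF c] xy by simp
  show "inverse_pair (x * y) (b * c)"
    using 1 2 commuting_mult_H[OF _ _ bc] inverse_pairD[OF b] inverse_pairD[OF c]
    by (simp add: inverse_pair_def)
qed

text \<open>The inverse of \<open>x\<close> is \<open>y * d\<close>. The point is that
  \<open>d\<close> inherits from \<open>x * y\<close> the commutation with \<open>y\<close>, which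
  keeps \<open>y * d\<close> in \<open>H\<close>.\<close>

lemma invertible_factor:
  assumes d: "inverse_pair (x * y) d" and xy: "x \<in> H" "y \<in> H" "x * y = y * x"
  shows "\<exists>c. inverse_pair x c"
proof
  have "d * y = y * d"
    by (rule inverse_pair_commute[OF d xy(2)]) (metis xy(3) mult.assoc)
  moreover from this have "y * d \<in> H"
    using commuting_mult_H[of y d] xy inverse_pairD[OF d] by simp
  ultimately show "inverse_pair x (y * d)"
    using inverse_pairD[OF d] xy(3) unfolding inverse_pair_def by (metis mult.assoc)
qed

lemma neumann:
  assumes x: "x \<in> H" "norm x < 1"
  shows "\<exists>b. inverse_pair (e - x) b"
proof -
  \<comment> \<open>Inside the commutant of \<open>x\<close> the product \<open>x * z\<close> stays
    in \<open>H\<close>, and a right inverse is automatically a left inverse.\<close>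
  define K where "K = H \<inter> {z. x * z = z * x}"
  have "closed {z. x * z = z * x}"
    by (intro closed_Collect_eq continuous_intros)
  then have "complete K" unfolding K_def by (rule complete_Int_closed[OF complete_H])
  moreover have "e \<in> K" using x e_H by (simp add: K_def)
  moreover have "e + x * z \<in> K" if "z \<in> K" for z
    using that x unfolding K_def
    by (auto intro!: add_H e_H commuting_mult_H simp: ring_distribs) (metis mult.assoc)
  ultimately obtain z where "z \<in> K" and z: "e + x * z = z"
    using geometric_fixpoint[of K x e] x by blast
  then have "z \<in> H" "x * z = z * x" by (auto simp: K_def)
  then have "inverse_pair (e - x) z"
    unfolding inverse_pair_def using z x by (auto simp: ring_distribs) (metis add_diff_cancel_right')+
  then show ?thesis ..
qed

lemma inverse_pair_scale:
  assumes "inverse_pair x b" "r \<noteq> 0"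
  shows "inverse_pair (r *\<^sub>R x) ((1/r) *\<^sub>R b)"
  using assms by (simp add: inverse_pair_def scale_H)

lemma neumann_scale:
  assumes x: "x \<in> H" "norm x < \<bar>r\<bar>"
  shows "\<exists>b. inverse_pair (r *\<^sub>R e - x) b"
proof -
  have "r \<noteq> 0" using x by auto
  have "norm ((1/r) *\<^sub>R x) < 1" using x \<open>r \<noteq> 0\<close> by (simp add: divide_simps)
  then obtain b where "inverse_pair (e - (1/r) *\<^sub>R x) b" using neumann scale_H x by blast
  from inverse_pair_scale[OF this \<open>r \<noteq> 0\<close>] show ?thesis
    using \<open>r \<noteq> 0\<close> by (auto simp: scaleR_diff_right)
qed

text \<open>Write \<open>x' = x * (e - b * (x - x'))\<close> and apply the Neumann series to the
  second factor. The estimates come from the resolvent identity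
  \<open>b - b' = b * (x' - x) * b'\<close>; the threshold 1/2 allows half of \<open>norm b'\<close>
  to be absorbed on the left, whence the factor 2.\<close>

lemma inverse_pair_perturb:
  assumes b: "inverse_pair x b" and x: "x \<in> H" "x' \<in> H" "x * x' = x' * x"
    and small: "norm (x - x') * norm b \<le> 1/2"
  shows "\<exists>b'. inverse_pair x' b' \<and> norm b' \<le> 2 * norm b"
    "inverse_pair x' b' \<Longrightarrow> norm (b - b') \<le> 2 * (norm b)\<^sup>2 * norm (x - x')"
proof -
  note bD = inverse_pairD[OF b]
  have bx: "b * x' = x' * b" by (rule inverse_pair_commute[OF b x(2,3)])
  then have bxx: "b * (x - x') = (x - x') * b" by (simp add: ring_distribs bD)
  have bxH: "b * (x - x') \<in> H" by (intro commuting_mult_H bxx bD diff_H x)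
  have bound: "norm b' \<le> 2 * norm b \<and> norm (b - b') \<le> 2 * (norm b)\<^sup>2 * norm (x - x')"
    if b': "inverse_pair x' b'" for b'
  proof -
    note b'D = inverse_pairD[OF b']
    have "b * (x' - x) * b' = b * (x' * b') - (b * x) * b'" by (simp add: ring_distribs mult.assoc)
    also have "\<dots> = b - b'" using bD b'D by simp
    finally have eq: "b - b' = b * (x' - x) * b'" by simp
    have n: "norm (b - b') \<le> norm b * norm (x - x') * norm b'"
      unfolding eq norm_minus_commute[of x x']
      by (rule order_trans[OF norm_mult_ineq mult_right_mono[OF norm_mult_ineq norm_ge_zero]])
    also have "\<dots> \<le> 1/2 * norm b'"
      using small by (intro mult_right_mono) (auto simp: mult.commute)
    finally have "norm b' \<le> norm b + 1/2 * norm b'"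
      using norm_triangle_ineq2[of b' b] by (simp add: norm_minus_commute)
    then have nb: "norm b' \<le> 2 * norm b" by simp
    have "norm b * norm (x - x') * norm b' \<le> norm b * norm (x - x') * (2 * norm b)"
      using nb by (intro mult_left_mono) auto
    with n nb show ?thesis by (simp add: power2_eq_square mult_ac)
  qed
  show "norm (b - b') \<le> 2 * (norm b)\<^sup>2 * norm (x - x')" if "inverse_pair x' b'" for b'
    using bound[OF that] by blast
  have "norm (b * (x - x')) < 1"
    using norm_mult_ineq[of b "x - x'"] small by (simp add: mult.commute)
  then obtain c where c: "inverse_pair (e - b * (x - x')) c" using neumann[OF bxH] by blast
  have "x * (e - b * (x - x')) = x'"
    using bD x by (simp add: ring_distribs flip: mult.assoc)
  moreover have "(e - b * (x - x')) * x = x'"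
    unfolding bxx using bD x by (simp add: left_diff_distrib mult.assoc)
  ultimately have "inverse_pair x' (b * c)"
    using inverse_pair_mult(1)[OF b c x(1) diff_H[OF e_H bxH]] by simp
  then show "\<exists>b'. inverse_pair x' b' \<and> norm b' \<le> 2 * norm b" using bound by blast
qed

section \<open>Boundedness and compactness of the real spectrum\<close>

lemma not_in_spectrum_iff: "a \<in> H \<Longrightarrow> t \<notin> spectrum a \<longleftrightarrow> (\<exists>b. inverse_pair (a - t *\<^sub>R e) b)"
  by (simp add: spectrum_def invertible_iff diff_H scale_H e_H)

lemma shift_commute:
  assumes "a \<in> H"
  shows "(a - t *\<^sub>R e) * (a - s *\<^sub>R e) = (a - s *\<^sub>R e) * (a - t *\<^sub>R e)"
  using assms by (simp add: left_diff_distrib right_diff_distrib scaleR_diff_right mult.commute[of s t])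

lemma spectrum_bound:
  assumes a: "a \<in> H" and t: "t \<in> spectrum a"
  shows "\<bar>t\<bar> \<le> norm a"
proof (rule ccontr)
  assume "\<not> \<bar>t\<bar> \<le> norm a"
  then obtain b where "inverse_pair (t *\<^sub>R e - a) b" using neumann_scale a by force
  from inverse_pair_scale[OF this, of "-1"] have "t \<notin> spectrum a"
    using a by (auto simp: not_in_spectrum_iff)
  with t show False by simp
qed

lemma compact_spectrum:
  assumes a: "a \<in> H" shows "compact (spectrum a)"
proof -
  have "open (- spectrum a)"
  proof (unfold open_dist, intro ballI)
    fix t assume "t \<in> - spectrum a"
    then obtain b where b: "inverse_pair (a - t *\<^sub>R e) b" using a by (auto simp: not_in_spectrum_iff)
    \<comment> \<open>This radius brings the perturbation below the threshold 1/2; the summand 1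
      keeps it defined when \<open>norm b = 0\<close>, as in the zero algebra.\<close>
    have "s \<in> - spectrum a" if s: "dist s t < 1 / (2 * norm b + 1)" for s
    proof -
      have "norm (a - t *\<^sub>R e - (a - s *\<^sub>R e)) = \<bar>s - t\<bar> * norm e"
        by (simp flip: scaleR_diff_left)
      also have "\<dots> \<le> \<bar>s - t\<bar>" using norm_e_le by (simp add: mult_left_le)
      also have "\<dots> \<le> 1 / (2 * norm b + 1)" using s by (simp add: dist_real_def)
      finally have "norm (a - t *\<^sub>R e - (a - s *\<^sub>R e)) * norm b \<le> 1 / (2 * norm b + 1) * norm b"
        by (intro mult_right_mono) auto
      also have "\<dots> \<le> 1/2"
        by (simp add: pos_divide_le_eq add_nonneg_pos)
      finally have "\<exists>b'. inverse_pair (a - s *\<^sub>R e) b'"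
        using inverse_pair_perturb(1)[OF b _ _ shift_commute[OF a]] a by (auto simp: H_intros)
      then show ?thesis using a by (simp add: not_in_spectrum_iff)
    qed
    moreover have "1 / (2 * norm b + 1) > 0" by (simp add: add_nonneg_pos)
    ultimately show "\<exists>d>0. \<forall>s. dist s t < d \<longrightarrow> s \<in> - spectrum a" by blast
  qed
  then have "closed (spectrum a)" by (simp add: closed_def)
  moreover have "bounded (spectrum a)"
    using spectrum_bound[OF a] by (auto simp: bounded_iff)
  ultimately show ?thesis by (simp add: compact_eq_bounded_closed)
qed

end

text \<open>Reality of the spectrum without complex scalars: up to a shift and a scaling,
  \<open>e + x * x\<close> is the product of \<open>x - \<lambda>\<close> and its conjugate for a
  non-real \<lambda>.\<close>

locale selfadjoint_part = jordan_part +
  assumes invertible_one_plus_square: "x \<in> H \<Longrightarrow> invertible_element (e + x * x)"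
begin

lemma invertible_quadratic:
  assumes x: "x \<in> H" and r: "r > 0"
  shows "\<exists>b. inverse_pair (r *\<^sub>R e + x * x) b"
proof -
  define y where "y = (1 / sqrt r) *\<^sub>R x"
  have y: "y \<in> H" using x by (simp add: y_def scale_H)
  then obtain b where b: "inverse_pair (e + y * y) b"
    using invertible_one_plus_square[OF y] invertible_iff[of "e + y * y"] by (auto simp: H_intros)
  show ?thesis
    using inverse_pair_scale[OF b, of r] r by (auto simp: y_def scaleR_add_right)
qed

end

section \<open>Polynomials in a self-adjoint element\<close>

lemma poly_map_of_real_add:
  "poly (map_poly of_real (p + q)) (z::complex) = poly (map_poly of_real p) z + poly (map_poly of_real q) z"
  by (induction p q rule: poly_induct2) (simp_all add: map_poly_pCons algebra_simps)

lemma poly_map_of_real_smult: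
  "poly (map_poly of_real (smult c p)) (z::complex) = of_real c * poly (map_poly of_real p) z"
  by (induction p) (simp_all add: map_poly_pCons algebra_simps)

lemma poly_map_of_real_mult:
  "poly (map_poly of_real (p * q)) (z::complex) = poly (map_poly of_real p) z * poly (map_poly of_real q) z"
  by (induction p) (simp_all add: map_poly_pCons poly_map_of_real_add poly_map_of_real_smult algebra_simps)

lemma poly_map_of_real_Reals:
  "poly (map_poly of_real p) (of_real x :: complex) = of_real (poly p x)"
  by (induction p) (simp_all add: map_poly_pCons)

text \<open>A non-real root \<open>z\<close> contributes the quadratic with roots \<open>z\<close>
  and its conjugate, in the form \<open>(X - x)^2 + y^2\<close> that matches
  \<open>invertible_quadratic\<close>.\<close>

lemma real_poly_factor:
  fixes p :: "real poly"
  assumes "degree p > 0"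
  obtains (linear) x q where "p = [:-x, 1:] * q"
  | (quadratic) x y q where "y \<noteq> 0" "p = [:x\<^sup>2 + y\<^sup>2, -2 * x, 1:] * q"
proof -
  have "degree (map_poly complex_of_real p) = degree p"
    by (rule degree_map_poly) auto
  then have "\<not> constant (poly (map_poly complex_of_real p))"
    using assms by (simp add: constant_degree)
  then obtain z where z: "poly (map_poly complex_of_real p) z = 0"
    using fundamental_theorem_of_algebra by blast
  show thesis
  proof (cases "Im z = 0")
    case True
    then have "z = of_real (Re z)" by (simp add: complex_eq_iff)
    then have "poly p (Re z) = 0" using z by (metis poly_map_of_real_Reals of_real_eq_0_iff)
    then show thesis using linear by (auto simp: poly_eq_0_iff_dvd dvd_def)
  next
    case False
    define r where "r = [:(Re z)\<^sup>2 + (Im z)\<^sup>2, -2 * Re z, 1:]"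
    define t where "t = p mod r"
    have "degree t \<le> 1"
      using degree_mod_less[of r p] by (auto simp: t_def r_def)
    obtain u t' where t': "t = pCons u t'" by (cases t)
    have "degree t' = 0" using \<open>degree t \<le> 1\<close> by (cases "t' = 0") (auto simp: t')
    then obtain v where "t' = [:v:]" by (rule degree_eq_zeroE)
    then have t: "t = [:u, v:]" by (simp add: t')
    have "poly (map_poly of_real r) z = 0"
      by (simp add: r_def map_poly_pCons complex_eq_iff power2_eq_square algebra_simps)
    moreover have "p = r * (p div r) + t" by (simp add: t_def)
    ultimately have "poly (map_poly complex_of_real t) z = 0"
      using z by (metis add_0 mult_zero_left poly_map_of_real_add poly_map_of_real_mult)
    \<comment> \<open>The remainder \<open>u + v * X\<close> has real coefficients: its imaginary
      part at \<open>z\<close> is \<open>v * Im z\<close>, which forces \<open>v = 0\<close> and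
      then \<open>u = 0\<close>.\<close>
    then have "v = 0 \<and> u = 0" using False by (auto simp: t map_poly_pCons complex_eq_iff)
    then have "t = 0" by (simp add: t)
    then have "p = r * (p div r)" using \<open>p = r * (p div r) + t\<close> by simp
    then show thesis using quadratic[OF False] by (simp add: r_def)
  qed
qed

context selfadjoint_part
begin

text \<open>Horner's scheme with \<open>e\<close> in the role of 1, since the unit is an element and
  not a constant of the type.\<close>

definition poly_at :: "'a \<Rightarrow> real poly \<Rightarrow> 'a" where
  "poly_at a p = fold_coeffs (\<lambda>c r. c *\<^sub>R e + a * r) p 0"

lemma poly_at_0 [simp]: "poly_at a 0 = 0"
  by (simp add: poly_at_def)

lemma poly_at_pCons [simp]: "poly_at a (pCons c p) = c *\<^sub>R e + a * poly_at a p"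
  by (cases "p = 0 \<and> c = 0") (auto simp: poly_at_def)

text \<open>Both claims have to go through one induction: \<open>a * poly_at a p\<close> lies in
  \<open>H\<close> because its factors commute.\<close>

lemma poly_at_closed:
  assumes "a \<in> H" shows "poly_at a p \<in> H \<and> a * poly_at a p = poly_at a p * a"
proof (induction p)
  case (pCons c p)
  then have "a * poly_at a p \<in> H" "a * (a * poly_at a p) = a * poly_at a p * a"
    using assms commuting_mult_H by (blast, metis mult.assoc)
  then show ?case
    using assms by (simp add: ring_distribs H_intros)
qed (simp add: zero_H)

lemmas poly_at_H = poly_at_closed[THEN conjunct1]

lemma poly_at_add: "poly_at a (p + q) = poly_at a p + poly_at a q"
  by (induction p q rule: poly_induct2) (simp_all add: algebra_simps)

lemma poly_at_smult: "poly_at a (smult c p) = c *\<^sub>R poly_at a p"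
  by (induction p) (simp_all add: algebra_simps)

lemma poly_at_diff: "poly_at a (p - q) = poly_at a p - poly_at a q"
  using poly_at_add[of a "p - q" q] by simp

lemma poly_at_mult:
  assumes "a \<in> H" shows "poly_at a (p * q) = poly_at a p * poly_at a q"
proof (induction p)
  case (pCons c p)
  then show ?case
    using poly_at_H[OF assms] by (simp add: poly_at_add poly_at_smult ring_distribs mult.assoc)
qed simp

lemma poly_at_commute: "a \<in> H \<Longrightarrow> poly_at a p * poly_at a q = poly_at a q * poly_at a p"
  by (metis mult.commute poly_at_mult)

text \<open>Each irreducible real factor is invertible at \<open>a\<close>: a linear one because its
  root is outside the spectrum, a quadratic one by completing the square. The condition that
  \<open>p\<close> is nonzero has content when the spectrum is empty.\<close>

lemma poly_at_invertible:
  assumes a: "a \<in> H" and "\<And>t. t \<in> spectrum a \<Longrightarrow> poly p t \<noteq> 0" and "p \<noteq> 0"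
  shows "\<exists>b. inverse_pair (poly_at a p) b"
  using assms(2,3)
proof (induction "degree p" arbitrary: p rule: less_induct)
  case less
  have *: ?case if p: "p = r * q" and r: "degree r > 0" "\<exists>b. inverse_pair (poly_at a r) b" for r q
  proof -
    have "q \<noteq> 0" "r \<noteq> 0" using less.prems p by auto
    then have "degree q < degree p" using p r by (simp add: degree_mult_eq)
    moreover have "poly q t \<noteq> 0" if "t \<in> spectrum a" for t using less.prems(1)[OF that] p by auto
    ultimately obtain c where "inverse_pair (poly_at a q) c" using less.hyps[of q] \<open>q \<noteq> 0\<close> by blast
    with r(2) show ?thesis
      using inverse_pair_mult(1) poly_at_H[OF a] poly_at_commute[OF a] p
      by (metis a poly_at_mult)
  qed
  show ?case
  proof (cases "degree p = 0")
    case True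
    then obtain c where c: "p = [:c:]" by (rule degree_eq_zeroE)
    then have "c \<noteq> 0" using less.prems by auto
    have "inverse_pair e e" by (simp add: inverse_pair_def e_H)
    from inverse_pair_scale[OF this \<open>c \<noteq> 0\<close>] show ?thesis by (auto simp: c)
  next
    case False
    then have "degree p > 0" by simp
    then show ?thesis
    proof (cases rule: real_poly_factor)
      case (linear x q)
      have "poly p x = 0" by (simp add: linear)
      then have "x \<notin> spectrum a" using less.prems(1) by blast
      then have "\<exists>b. inverse_pair (poly_at a [:-x, 1:]) b"
        using a by (simp add: not_in_spectrum_iff)
      then show ?thesis using *[OF linear] by simp
    next
      case (quadratic x y q)
      have "\<exists>b. inverse_pair (y\<^sup>2 *\<^sub>R e + (a - x *\<^sub>R e) * (a - x *\<^sub>R e)) b"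
        using a quadratic(1) by (intro invertible_quadratic) (auto intro!: H_intros)
      also have "y\<^sup>2 *\<^sub>R e + (a - x *\<^sub>R e) * (a - x *\<^sub>R e) = poly_at a [:x\<^sup>2 + y\<^sup>2, -2 * x, 1:]"
        using a by (simp add: algebra_simps power2_eq_square)
          (simp flip: scaleR_2)
      finally show ?thesis using *[OF quadratic(2)] by simp
    qed
  qed
qed

text \<open>
  \<open>resolvent_re c u\<close> is the real part of \<open>1 / (1 - \<omega> u)\<close> for a complex number \<open>\<omega>\<close> of modulus
  \<open>1\<close> with real part \<open>c\<close>.  Averaging over the roots of unity, in the form of the doubling
  formula \<open>resolvent_re_double\<close>, replaces Cauchy's formula in the proof that the norm is the
  spectral radius.
\<close>

definition some_inverse :: "'a \<Rightarrow> 'a" where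
  "some_inverse x = (SOME b. inverse_pair x b)"

text \<open>For \<open>c = Re \<omega>\<close> with \<omega> of modulus 1 this is the product of
  \<open>1 - \<omega> u\<close> and \<open>1 - cnj \<omega> u\<close>, the common denominator of the
  two conjugate resolvents.\<close>

definition circle_quadratic :: "real \<Rightarrow> 'a \<Rightarrow> 'a" where
  "circle_quadratic c u = e - (2 * c) *\<^sub>R u + u * u"

text \<open>The unit circle misses the complex spectrum of \<open>u\<close>, said with real
  quadratics.\<close>

definition off_circle :: "'a \<Rightarrow> bool" where
  "off_circle u \<longleftrightarrow> u \<in> H \<and> (\<forall>c\<in>{-1..1}. \<exists>b. inverse_pair (circle_quadratic c u) b)"

definition resolvent_re :: "real \<Rightarrow> 'a \<Rightarrow> 'a" where
  "resolvent_re c u = (e - c *\<^sub>R u) * some_inverse (circle_quadratic c u)"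

lemma some_inverse: "\<exists>b. inverse_pair x b \<Longrightarrow> inverse_pair x (some_inverse x)"
  unfolding some_inverse_def by (rule someI_ex)

lemma some_inverse_eq: "inverse_pair x b \<Longrightarrow> some_inverse x = b"
  using inverse_pair_unique some_inverse by blast

lemma circle_quadratic_H: "u \<in> H \<Longrightarrow> circle_quadratic c u \<in> H"
  by (simp add: circle_quadratic_def H_intros)

text \<open>If \<open>d\<close> is the real part of \<omega>, then \<open>2 * d^2 - 1\<close> is
  that of its square; the identity is
  \<open>1 - \<omega>^2 u^2 = (1 - \<omega> u)(1 + \<omega> u)\<close> multiplied by its
  conjugate.\<close>

lemma circle_quadratic_factor:
  assumes "u \<in> H"
  shows "circle_quadratic (2 * d\<^sup>2 - 1) (u * u) = circle_quadratic d u * circle_quadratic (- d) u"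
    "circle_quadratic d u * circle_quadratic (- d) u = circle_quadratic (- d) u * circle_quadratic d u"
  using assms unfolding circle_quadratic_def power2_eq_square
  by (simp_all add: algebra_simps flip: scaleR_2)

text \<open>The real part of the partial fraction identity by which
  \<open>1 / (1 - \<omega>^2 u^2)\<close> is the mean of \<open>1 / (1 - \<omega> u)\<close> and
  \<open>1 / (1 + \<omega> u)\<close>.\<close>

lemma resolvent_re_double:
  assumes u: "off_circle u" and d: "d \<in> {-1..1}"
  shows "\<exists>b. inverse_pair (circle_quadratic (2 * d\<^sup>2 - 1) (u * u)) b"
    "resolvent_re (2 * d\<^sup>2 - 1) (u * u) = (1/2) *\<^sub>R (resolvent_re d u + resolvent_re (- d) u)"
proof -
  define p q where "p = circle_quadratic d u" and "q = circle_quadratic (- d) u"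
  define i j where "i = some_inverse p" and "j = some_inverse q"
  have uH: "u \<in> H" using u by (simp add: off_circle_def)
  have i: "inverse_pair p i" and j: "inverse_pair q j"
    using u d by (auto simp: off_circle_def p_def q_def i_def j_def intro!: some_inverse)
  have pq: "p \<in> H" "q \<in> H" "p * q = q * p"
    using circle_quadratic_factor(2)[OF uH] uH by (simp_all add: p_def q_def circle_quadratic_H)
  note ij = inverse_pair_mult[OF i j pq]
  have fac: "circle_quadratic (2 * d\<^sup>2 - 1) (u * u) = p * q"
    by (simp add: p_def q_def circle_quadratic_factor[OF uH])
  show "\<exists>b. inverse_pair (circle_quadratic (2 * d\<^sup>2 - 1) (u * u)) b"
    unfolding fac using ij(1) by blast
  have G: "resolvent_re (2 * d\<^sup>2 - 1) (u * u) = (e - (2 * d\<^sup>2 - 1) *\<^sub>R (u * u)) * (i * j)"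
    unfolding resolvent_re_def fac using some_inverse_eq[OF ij(1)] by simp
  \<comment> \<open>Both resolvents are brought over the common denominator \<open>p * q\<close>, so
    that only numerators remain to be compared.\<close>
  have "(e - d *\<^sub>R u) * i = (e - d *\<^sub>R u) * ((q * j) * i)"
    using inverse_pairD[OF i] inverse_pairD[OF j] by simp
  then have 1: "resolvent_re d u = ((e - d *\<^sub>R u) * q) * (i * j)"
    by (simp add: resolvent_re_def i_def p_def mult.assoc ij(2)[unfolded i_def p_def])
  have "(e + d *\<^sub>R u) * j = (e + d *\<^sub>R u) * ((p * i) * j)"
    using inverse_pairD[OF i] inverse_pairD[OF j] by simp
  then have 2: "resolvent_re (- d) u = ((e + d *\<^sub>R u) * p) * (i * j)"
    by (simp add: resolvent_re_def j_def q_def mult.assoc)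
  have "(e - d *\<^sub>R u) * q + (e + d *\<^sub>R u) * p = 2 *\<^sub>R (e - (2 * d\<^sup>2 - 1) *\<^sub>R (u * u))"
    using uH unfolding p_def q_def circle_quadratic_def power2_eq_square
    by (simp add: algebra_simps flip: scaleR_2)
  then show "resolvent_re (2 * d\<^sup>2 - 1) (u * u) = (1/2) *\<^sub>R (resolvent_re d u + resolvent_re (- d) u)"
    unfolding G 1 2 by (simp flip: ring_distribs)
qed

lemma off_circle_square:
  assumes "off_circle u" shows "off_circle (u * u)"
proof -
  have "\<exists>b. inverse_pair (circle_quadratic c (u * u)) b" if c: "c \<in> {-1..1}" for c
  proof -
    \<comment> \<open>The half-angle formula: \<open>d\<close> is the cosine of half the angle with
      cosine \<open>c\<close>.\<close>
    define d where "d = sqrt ((1 + c) / 2)"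
    have "c = 2 * d\<^sup>2 - 1" "d \<in> {-1..1}" using c by (auto simp: d_def field_simps intro: order_trans[of _ 0])
    then show ?thesis using resolvent_re_double(1)[OF assms] by simp
  qed
  then show ?thesis using assms by (simp add: off_circle_def square_H)
qed

text \<open>By doubling, the value at \<open>c\<close> is the mean of the values at \<open>d\<close>
  and \<open>-d\<close>, so a bound that is uniform on the circle survives squaring without
  growing.\<close>

lemma resolvent_re_diff_square:
  assumes u: "off_circle u" and v: "off_circle v"
    and "\<And>c. c \<in> {-1..1} \<Longrightarrow> norm (resolvent_re c u - resolvent_re c v) \<le> \<epsilon>"
    and c: "c \<in> {-1..1}"
  shows "norm (resolvent_re c (u * u) - resolvent_re c (v * v)) \<le> \<epsilon>"
proof -
  define d where "d = sqrt ((1 + c) / 2)"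
  have cd: "c = 2 * d\<^sup>2 - 1" and d: "d \<in> {-1..1}"
    using c by (auto simp: d_def field_simps intro: order_trans[of _ 0])
  have "resolvent_re c (u * u) - resolvent_re c (v * v)
      = (1/2) *\<^sub>R ((resolvent_re d u - resolvent_re d v) + (resolvent_re (-d) u - resolvent_re (-d) v))"
    unfolding cd resolvent_re_double(2)[OF u d] resolvent_re_double(2)[OF v d]
    by (simp add: scaleR_diff_right scaleR_add_right)
  also have "norm \<dots> \<le> (1/2) * (\<epsilon> + \<epsilon>)"
    using assms(3)[of d] assms(3)[of "-d"] d
    by (auto intro!: norm_triangle_le)
  finally show ?thesis by simp
qed

section \<open>The spectral radius\<close>

text \<open>The inverse depends continuously on \<open>c\<close> by the perturbation lemma, and the
  interval is compact.\<close>

lemma off_circle_bounded: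
  assumes u: "off_circle u"
  shows "\<exists>K>0. \<forall>c\<in>{-1..1}. norm (some_inverse (circle_quadratic c u)) \<le> K"
proof -
  let ?b = "\<lambda>c. some_inverse (circle_quadratic c u)"
  have uH: "u \<in> H" using u by (simp add: off_circle_def)
  have b: "inverse_pair (circle_quadratic c u) (?b c)" if "c \<in> {-1..1}" for c
    using u that by (auto simp: off_circle_def intro!: some_inverse)
  have dist: "norm (circle_quadratic c u - circle_quadratic d u) = 2 * \<bar>d - c\<bar> * norm u" for c d
  proof -
    have "circle_quadratic c u - circle_quadratic d u = (2 * (d - c)) *\<^sub>R u"
      by (simp add: circle_quadratic_def algebra_simps)
    then show ?thesis by (simp only: norm_scaleR abs_mult abs_numeral)
  qed
  have "continuous_on {-1..1} ?b"
  proof (rule continuous_on_locally_lipschitz)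
    fix c :: real assume c: "c \<in> {-1..1}"
    \<comment> \<open>Changing \<open>c\<close> to \<open>d\<close> moves the quadratic by
      \<open>2 * \<bar>d - c\<bar> * norm u\<close>; this radius keeps that number times
      \<open>norm (?b c)\<close> below 1/2.\<close>
    define r where "r = 1 / (4 * norm u * norm (?b c) + 1)"
    have den: "4 * norm u * norm (?b c) + 1 > 0" by (simp add: add_nonneg_pos)
    have "dist (?b d) (?b c) \<le> (4 * (norm (?b c))\<^sup>2 * norm u) * dist d c"
      if d: "d \<in> {-1..1}" and dc: "dist d c < r" for d
    proof -
      have "\<bar>d - c\<bar> * (4 * norm u * norm (?b c) + 1) \<le> 1"
        using dc den by (simp add: r_def dist_real_def pos_less_divide_eq)
      then have "\<bar>d - c\<bar> * (4 * norm u * norm (?b c)) \<le> 1"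
        by (simp add: distrib_left)
      then have "norm (circle_quadratic c u - circle_quadratic d u) * norm (?b c) \<le> 1/2"
        unfolding dist by (simp add: algebra_simps)
      from inverse_pair_perturb(2)[OF b[OF c] _ _ _ this b[OF d]]
      show ?thesis
        unfolding dist using uH
        by (simp add: circle_quadratic_H dist_norm norm_minus_commute mult_ac)
          (simp add: circle_quadratic_def algebra_simps)
    qed
    moreover have "r > 0" using den by (simp add: r_def)
    ultimately show "\<exists>L r. r > 0 \<and> (\<forall>d\<in>{-1..1}. dist d c < r \<longrightarrow> dist (?b d) (?b c) \<le> L * dist d c)"
      by blast
  qed
  then have "bounded (?b ` {-1..1})"
    by (intro compact_imp_bounded compact_continuous_image) auto
  then show ?thesis by (auto simp: bounded_pos)
qed

text \<open>A fixed factor \<open>s < 1\<close> disturbs the resolvent little, uniformly on the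
  circle, whereas repeated squaring will drive its powers to 0.\<close>

lemma off_circle_near:
  assumes u: "off_circle u" and n: "norm u = 1" and \<epsilon>: "\<epsilon> > 0"
  shows "\<exists>s. 0 < s \<and> s < 1 \<and> off_circle (s *\<^sub>R u) \<and>
    (\<forall>c\<in>{-1..1}. norm (resolvent_re c u - resolvent_re c (s *\<^sub>R u)) \<le> \<epsilon>)"
proof -
  obtain K where K: "K > 0" "\<And>c. c \<in> {-1..1} \<Longrightarrow> norm (some_inverse (circle_quadratic c u)) \<le> K"
    using off_circle_bounded[OF u] by blast
  \<comment> \<open>With \<open>s = 1 - h\<close> the quadratics differ by at most
    \<open>4 * h\<close>. The bound \<open>1 / (8 * K)\<close> makes \<open>4 * h * K\<close> at
    most 1/2, and the last bound controls \<open>2 * (8 * K^2 * h) + h * (2 * K)\<close>, the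
    estimate for the resolvents.\<close>
  define h where "h = min (1/2) (min (1 / (8 * K)) (\<epsilon> / (16 * K\<^sup>2 + 2 * K)))"
  have pos: "16 * K\<^sup>2 + 2 * K > 0" using K(1) by (simp add: add_pos_pos)
  have "h \<le> 1 / (8 * K)" "h \<le> \<epsilon> / (16 * K\<^sup>2 + 2 * K)" by (simp_all add: h_def)
  then have h: "h * (8 * K) \<le> 1" "h * (16 * K\<^sup>2 + 2 * K) \<le> \<epsilon>"
    using K(1) pos by (simp_all only: pos_le_divide_eq zero_less_mult_iff zero_less_numeral simp_thms)
  have "0 < h" using K(1) \<epsilon> pos by (simp add: h_def)
  have "h \<le> 1/2" unfolding h_def by (rule min.cobounded1)
  note h = \<open>0 < h\<close> this h
  define s where "s = 1 - h"
  have uH: "u \<in> H" using u by (simp add: off_circle_def)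
  have uu: "norm (u * u) = 1" using norm_square[OF uH] n by simp
  have main: "(\<exists>b'. inverse_pair (circle_quadratic c (s *\<^sub>R u)) b') \<and>
      norm (resolvent_re c u - resolvent_re c (s *\<^sub>R u)) \<le> \<epsilon>" if c: "c \<in> {-1..1}" for c
  proof -
    define b where "b = some_inverse (circle_quadratic c u)"
    have b: "inverse_pair (circle_quadratic c u) b"
      unfolding b_def using u c by (auto simp: off_circle_def intro!: some_inverse)
    have nb: "norm b \<le> K" using K(2)[OF c] by (simp add: b_def)
    have "circle_quadratic c u - circle_quadratic c (s *\<^sub>R u) = (h * (1 + s)) *\<^sub>R (u * u) - (2 * c * h) *\<^sub>R u"
      by (simp add: circle_quadratic_def s_def algebra_simps) (metis mult_2_right scaleR_left_distrib)
    also have "norm \<dots> \<le> h * (1 + s) + 2 * \<bar>c\<bar> * h"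
      using n uu h by (intro order_trans[OF norm_triangle_ineq4]) (simp add: abs_mult s_def)
    also have "\<dots> \<le> h * 2 + 2 * 1 * h"
      using h c by (intro add_mono mult_left_mono mult_right_mono) (auto simp: s_def)
    finally have D: "norm (circle_quadratic c u - circle_quadratic c (s *\<^sub>R u)) \<le> 4 * h" by simp
    have "norm (circle_quadratic c u - circle_quadratic c (s *\<^sub>R u)) * norm b \<le> 4 * h * K"
      using D nb h K(1) by (intro mult_mono) auto
    also have "\<dots> \<le> 1/2" using h(3) by simp
    finally have small: "norm (circle_quadratic c u - circle_quadratic c (s *\<^sub>R u)) * norm b \<le> 1/2" .
    have comm: "circle_quadratic c u * circle_quadratic c (s *\<^sub>R u)
        = circle_quadratic c (s *\<^sub>R u) * circle_quadratic c u"
      using uH by (simp add: circle_quadratic_def algebra_simps)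
    note perturb = inverse_pair_perturb[OF b circle_quadratic_H[OF uH]
        circle_quadratic_H[OF scale_H[OF uH]] comm small]
    obtain b' where b': "inverse_pair (circle_quadratic c (s *\<^sub>R u)) b'" and nb': "norm b' \<le> 2 * norm b"
      using perturb(1) by blast
    have "norm (b - b') \<le> 2 * (norm b)\<^sup>2 * norm (circle_quadratic c u - circle_quadratic c (s *\<^sub>R u))"
      by (rule perturb(2)[OF b'])
    also have "\<dots> \<le> 2 * K\<^sup>2 * (4 * h)"
      using nb D K(1) h by (intro mult_mono) (auto intro: power_mono)
    finally have bb: "norm (b - b') \<le> 8 * K\<^sup>2 * h" by simp
    have "norm (e - c *\<^sub>R u) \<le> norm e + norm (c *\<^sub>R u)" by (rule norm_triangle_ineq4)
    also have "\<dots> \<le> 2" using norm_e_le n c by auto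
    finally have eu: "norm (e - c *\<^sub>R u) \<le> 2" .
    have "resolvent_re c u - resolvent_re c (s *\<^sub>R u) = (e - c *\<^sub>R u) * (b - b') - (c * h) *\<^sub>R (u * b')"
      unfolding resolvent_re_def some_inverse_eq[OF b] some_inverse_eq[OF b']
      by (simp add: s_def algebra_simps)
    also have "norm \<dots> \<le> norm ((e - c *\<^sub>R u) * (b - b')) + norm ((c * h) *\<^sub>R (u * b'))"
      by (rule norm_triangle_ineq4)
    also have "\<dots> \<le> 2 * (8 * K\<^sup>2 * h) + h * (2 * K)"
    proof (intro add_mono)
      show "norm ((e - c *\<^sub>R u) * (b - b')) \<le> 2 * (8 * K\<^sup>2 * h)"
        using eu bb by (intro order_trans[OF norm_mult_ineq] mult_mono) auto
      have "norm (u * b') \<le> 2 * K" using norm_mult_ineq[of u b'] n nb nb' by simp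
      moreover have "\<bar>c * h\<bar> \<le> h" using c h by (auto simp: abs_mult abs_le_iff intro!: mult_left_le_one_le)
      ultimately show "norm ((c * h) *\<^sub>R (u * b')) \<le> h * (2 * K)"
        using h by (auto intro!: mult_mono)
    qed
    also have "\<dots> \<le> \<epsilon>" using h(4) by (simp add: algebra_simps)
    finally show ?thesis using b' by blast
  qed
  then have "off_circle (s *\<^sub>R u)" using uH by (simp add: off_circle_def scale_H)
  then show ?thesis using main h by (intro exI[of _ s]) (auto simp: s_def)
qed

text \<open>At \<open>c = 1\<close> the quadratic is a square and one factor cancels. This leads
  from real parts on the circle back to a genuine inverse.\<close>

lemma resolvent_re_one:
  assumes "off_circle u" shows "inverse_pair (e - u) (resolvent_re 1 u)"
proof -
  have uH: "u \<in> H" using assms by (simp add: off_circle_def)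
  have q: "circle_quadratic 1 u = (e - u) * (e - u)"
    using uH by (simp add: circle_quadratic_def algebra_simps scaleR_2)
  obtain d where "inverse_pair (circle_quadratic 1 u) d"
    using assms unfolding off_circle_def by (meson atLeastAtMost_iff neg_le_0_iff_le order_refl order_trans zero_le_one)
  then obtain c where c: "inverse_pair (e - u) c"
    unfolding q using invertible_factor[of "e - u" "e - u" d] uH by (auto simp: H_intros)
  then have "some_inverse (circle_quadratic 1 u) = c * c"
    unfolding q using inverse_pair_mult(1)[OF c c] uH by (auto intro!: some_inverse_eq simp: H_intros)
  then have "resolvent_re 1 u = c"
    using inverse_pairD[OF c] by (simp add: resolvent_re_def flip: mult.assoc)
  with c show ?thesis by simp
qed

text \<open>If both points were missing, the circle would be free of spectrum. Squaring
  \<open>u\<close> and \<open>s u\<close> repeatedly keeps the first at norm 1 and sends the second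
  to 0, while their resolvents at 1 stay close. So the resolvent of an element of norm 1 would be
  close to \<open>e\<close>, which is impossible.\<close>

lemma spectral_radius_one:
  assumes u: "u \<in> H" and n: "norm u = 1"
  shows "1 \<in> spectrum u \<or> -1 \<in> spectrum u"
proof (rule ccontr)
  assume "\<not> ?thesis"
  then obtain b1 b2 where b1: "inverse_pair (u - e) b1" and b2: "inverse_pair (u + e) b2"
    using u by (auto simp: not_in_spectrum_iff)
  have "\<exists>b. inverse_pair (circle_quadratic c u) b" if c: "c \<in> {-1..1}" for c
  proof (cases "\<bar>c\<bar> = 1")
    case True
    then consider "c = 1" | "c = -1" by linarith
    then show ?thesis
    proof cases
      case 1
      have "circle_quadratic c u = (u - e) * (u - e)"
        using u by (simp add: 1 circle_quadratic_def algebra_simps scaleR_2)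
      then show ?thesis using inverse_pair_mult(1)[OF b1 b1] u by (auto simp: H_intros)
    next
      case 2
      have "circle_quadratic c u = (u + e) * (u + e)"
        using u by (simp add: 2 circle_quadratic_def algebra_simps scaleR_2)
      then show ?thesis using inverse_pair_mult(1)[OF b2 b2] u by (auto simp: H_intros)
    qed
  next
    case False
    then have "\<bar>c\<bar> < 1" using c by auto
    then have "c\<^sup>2 < 1" by (simp add: abs_square_less_1)
    \<comment> \<open>For \<open>\<bar>c\<bar> < 1\<close> the square is completed with a positive
      constant, so only the endpoints use the assumption on the spectrum.\<close>
    have "circle_quadratic c u = (1 - c\<^sup>2) *\<^sub>R e + (u - c *\<^sub>R e) * (u - c *\<^sub>R e)"
      using u by (simp add: circle_quadratic_def algebra_simps power2_eq_square)
        (simp flip: scaleR_2)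
    then show ?thesis using invertible_quadratic[of "u - c *\<^sub>R e" "1 - c\<^sup>2"] \<open>c\<^sup>2 < 1\<close> u by (simp add: H_intros)
  qed
  then have "off_circle u" using u by (simp add: off_circle_def)
  \<comment> \<open>The bound 1/8 here and 1/16 for \<open>norm v\<close> below give
    \<open>norm (g - e) \<le> 1/4\<close>, and then \<open>norm x \<le> 1/2\<close>.\<close>
  then obtain s where s: "0 < s" "s < 1" "off_circle (s *\<^sub>R u)"
    "\<And>c. c \<in> {-1..1} \<Longrightarrow> norm (resolvent_re c u - resolvent_re c (s *\<^sub>R u)) \<le> 1/8"
    using off_circle_near[OF _ n, of "1/8"] by auto
  define f where "f k = ((\<lambda>x. x * x) ^^ k) u" for k
  have f: "off_circle (f k) \<and> norm (f k) = 1 \<and> off_circle (s ^ 2 ^ k *\<^sub>R f k) \<and>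
      (\<forall>c\<in>{-1..1}. norm (resolvent_re c (f k) - resolvent_re c (s ^ 2 ^ k *\<^sub>R f k)) \<le> 1/8)" for k
  proof (induction k)
    case 0
    then show ?case using \<open>off_circle u\<close> s n by (simp add: f_def)
  next
    case (Suc k)
    have eq: "s ^ 2 ^ Suc k *\<^sub>R f (Suc k) = (s ^ 2 ^ k *\<^sub>R f k) * (s ^ 2 ^ k *\<^sub>R f k)"
      by (simp add: f_def power_add mult_2)
    have fs: "f (Suc k) = f k * f k" by (simp add: f_def)
    have "norm (f k * f k) = 1" using Suc norm_square by (auto simp: off_circle_def)
    then show ?case
      unfolding eq unfolding fs
      using Suc off_circle_square resolvent_re_diff_square[of "f k" "s ^ 2 ^ k *\<^sub>R f k" "1/8"]
      by blast
  qed
  have "(\<lambda>k. s ^ k) \<longlonglongrightarrow> 0" using s by (intro LIMSEQ_realpow_zero) auto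
  then have "\<forall>\<^sub>F k in sequentially. s ^ k < 1/16" by (rule order_tendstoD) simp
  then obtain N where N: "\<And>k. k \<ge> N \<Longrightarrow> s ^ k < 1/16" by (auto simp: eventually_sequentially)
  define x where "x = f N"
  define v where "v = s ^ 2 ^ N *\<^sub>R x"
  have x: "off_circle x" "norm x = 1" "off_circle v"
    and gh: "norm (resolvent_re 1 x - resolvent_re 1 v) \<le> 1/8"
    using f[of N] by (simp_all add: x_def v_def)
  have "N \<le> 2 ^ N" using less_exp[of N] by linarith
  then have nv: "norm v \<le> 1/16" using N[of "2 ^ N"] s x by (simp add: v_def)
  define g h where "g = resolvent_re 1 x" and "h = resolvent_re 1 v"
  have g: "inverse_pair (e - x) g" and h: "inverse_pair (e - v) h"
    using resolvent_re_one x by (simp_all add: g_def h_def)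
  have xH: "x \<in> H" using x by (simp add: off_circle_def)
  have "h - e = v * h" using inverse_pairD[OF h] by (simp add: ring_distribs algebra_simps)
  then have he: "norm (h - e) \<le> norm v * norm h" by (simp add: norm_mult_ineq)
  also have "\<dots> \<le> 1/16 * norm h" using nv by (intro mult_right_mono) auto
  finally have "norm (h - e) \<le> 1/16 * norm h" .
  moreover have "norm h \<le> norm (h - e) + norm e" by (metis diff_add_cancel norm_triangle_ineq)
  ultimately have "norm (h - e) \<le> 1/8" using norm_e_le by linarith
  moreover have "norm (g - e) \<le> norm (g - h) + norm (h - e)"
    using norm_triangle_ineq[of "g - h" "h - e"] by simp
  ultimately have ge: "norm (g - e) \<le> 1/4" using gh by (simp add: g_def h_def)
  have "x = (g - e) * (e - x)"
    using inverse_pairD[OF g] xH by (simp add: left_diff_distrib e_H right_diff_distrib[of e])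
  then have "norm x \<le> norm (g - e) * norm (e - x)" by (metis norm_mult_ineq)
  also have "\<dots> \<le> 1/4 * (norm e + norm x)"
    using ge norm_triangle_ineq4[of e x] by (intro mult_mono) auto
  also have "\<dots> < 1" using norm_e_le x by simp
  finally show False using x by simp
qed

lemma spectral_radius:
  assumes b: "b \<in> H" "b \<noteq> 0"
  shows "norm b \<in> spectrum b \<or> - norm b \<in> spectrum b"
proof -
  have scale: "t \<notin> spectrum ((1 / norm b) *\<^sub>R b)"
    if t: "norm b * t \<notin> spectrum b" for t
  proof -
    obtain c where c: "inverse_pair (b - (norm b * t) *\<^sub>R e) c" using t b not_in_spectrum_iff by blast
    have "(1 / norm b) *\<^sub>R (b - (norm b * t) *\<^sub>R e) = (1 / norm b) *\<^sub>R b - t *\<^sub>R e"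
      using b by (simp add: scaleR_diff_right)
    then show ?thesis
      using inverse_pair_scale[OF c, of "1 / norm b"] b by (auto simp: not_in_spectrum_iff scale_H)
  qed
  have "norm ((1 / norm b) *\<^sub>R b) = 1" using b by simp
  from spectral_radius_one[OF scale_H[OF b(1)] this] scale[of 1] scale[of "-1"]
  show ?thesis by auto
qed

text \<open>The spectrum of \<open>poly_at a p\<close> is the image of that of \<open>a\<close>
  under \<open>p\<close>: division by a linear factor gives one inclusion,
  \<open>poly_at_invertible\<close> the other. The spectral radius then turns this into an
  isometry.\<close>

lemma norm_poly_at_le_iff:
  assumes a: "a \<in> H" and "M \<ge> 0"
  shows "norm (poly_at a p) \<le> M \<longleftrightarrow> (\<forall>t\<in>spectrum a. \<bar>poly p t\<bar> \<le> M)"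
proof
  assume le: "norm (poly_at a p) \<le> M"
  show "\<forall>t\<in>spectrum a. \<bar>poly p t\<bar> \<le> M"
  proof
    fix t assume t: "t \<in> spectrum a"
    have "poly (p - [:poly p t:]) t = 0" by simp
    then obtain q where q: "p - [:poly p t:] = [:-t, 1:] * q" by (auto simp only: poly_eq_0_iff_dvd dvd_def)
    have "poly p t \<in> spectrum (poly_at a p)"
    proof (rule ccontr)
      assume "\<not> ?thesis"
      then obtain b where "inverse_pair (poly_at a (p - [:poly p t:])) b"
        using a by (auto simp: not_in_spectrum_iff poly_at_H poly_at_diff)
      then have "\<exists>c. inverse_pair (poly_at a [:-t, 1:]) c"
        using invertible_factor[of _ "poly_at a q"] poly_at_commute[OF a] poly_at_H[OF a]
        unfolding q poly_at_mult[OF a] by blast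
      then have "t \<notin> spectrum a" using a by (simp add: not_in_spectrum_iff)
      with t show False by simp
    qed
    then show "\<bar>poly p t\<bar> \<le> M" using spectrum_bound[OF poly_at_H[OF a]] le by force
  qed
next
  assume le: "\<forall>t\<in>spectrum a. \<bar>poly p t\<bar> \<le> M"
  show "norm (poly_at a p) \<le> M"
  proof (rule ccontr)
    assume gt: "\<not> norm (poly_at a p) \<le> M"
    then have "poly_at a p \<noteq> 0" using \<open>M \<ge> 0\<close> by auto
    then obtain s where s: "s \<in> spectrum (poly_at a p)" "\<bar>s\<bar> = norm (poly_at a p)"
      using spectral_radius[OF poly_at_H[OF a], of p] by force
    have nz: "poly (p - [:s:]) t \<noteq> 0" if "t \<in> spectrum a" for t
      using le that gt s(2) by auto
    \<comment> \<open>Nonemptiness of the spectrum is needed to exclude \<open>p = [:s:]\<close>,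
      the case not covered by \<open>poly_at_invertible\<close>.\<close>
    have "e \<noteq> 0" using \<open>poly_at a p \<noteq> 0\<close> unit_H(1)[OF poly_at_H[OF a], of p] by auto
    then have "spectrum a \<noteq> {}"
      using spectral_radius[OF a] not_in_spectrum_iff[OF a, of 0]
      by (cases "a = 0") (auto simp: inverse_pair_def)
    then have "p - [:s:] \<noteq> 0" using nz by (metis all_not_in_conv poly_0)
    with nz obtain b where "inverse_pair (poly_at a (p - [:s:])) b" using poly_at_invertible[OF a] by blast
    then have "s \<notin> spectrum (poly_at a p)"
      using a by (auto simp: not_in_spectrum_iff poly_at_H poly_at_diff)
    with s show False by simp
  qed
qed

end

section \<open>Continuous functional calculus\<close>

lemma weierstrass_poly:
  fixes f :: "real \<Rightarrow> real"
  assumes "compact S" "continuous_on S f" "\<epsilon> > 0"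
  obtains p where "\<And>t. t \<in> S \<Longrightarrow> \<bar>f t - poly p t\<bar> \<le> \<epsilon>"
proof -
  obtain g where g: "real_polynomial_function g" "\<And>t. t \<in> S \<Longrightarrow> \<bar>f t - g t\<bar> < \<epsilon>"
    using Stone_Weierstrass_real_polynomial_function[OF assms] by blast
  obtain c n where "g = (\<lambda>x. \<Sum>i\<le>n. c i * x ^ i)"
    using g(1) by (auto simp: real_polynomial_function_iff_sum)
  then have "poly (\<Sum>i\<le>n. monom (c i) i) t = g t" for t by (simp add: poly_sum poly_monom)
  then show thesis using that[of "\<Sum>i\<le>n. monom (c i) i"] g(2) by (simp add: less_imp_le)
qed

context selfadjoint_part
begin

text \<open>The graph of the calculus: one polynomial has to approximate \<open>f\<close> on the
  spectrum and \<open>z\<close> in norm at the same time. As a relation it obeys the algebraic rules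
  before existence is known and without a choice of sequences.\<close>

definition calculus_value :: "'a \<Rightarrow> (real \<Rightarrow> real) \<Rightarrow> 'a \<Rightarrow> bool" where
  "calculus_value a f z \<longleftrightarrow>
     (\<forall>\<epsilon>>0. \<exists>p. (\<forall>t\<in>spectrum a. \<bar>f t - poly p t\<bar> \<le> \<epsilon>) \<and> norm (z - poly_at a p) \<le> \<epsilon>)"

lemma calculus_valueD:
  assumes "calculus_value a f z" "\<epsilon> > 0"
  obtains p where "\<And>t. t \<in> spectrum a \<Longrightarrow> \<bar>f t - poly p t\<bar> \<le> \<epsilon>" "norm (z - poly_at a p) \<le> \<epsilon>"
  using assms unfolding calculus_value_def by blast

lemma calculus_value_poly: "calculus_value a (poly p) (poly_at a p)"
  unfolding calculus_value_def by (intro allI impI exI[of _ p]) simp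

lemma calculus_value_const: "calculus_value a (\<lambda>t. c) (c *\<^sub>R e)"
proof -
  have "poly [:c:] = (\<lambda>t. c)" by (rule ext) simp
  then show ?thesis using calculus_value_poly[of a "[:c:]"] by simp
qed

lemma calculus_value_id: "a \<in> H \<Longrightarrow> calculus_value a (\<lambda>t. t) a"
proof -
  assume "a \<in> H"
  moreover have "poly [:0, 1:] = (\<lambda>t::real. t)" by (rule ext) simp
  ultimately show ?thesis using calculus_value_poly[of a "[:0, 1:]"] by simp
qed

text \<open>The isometry for polynomials passes to the limit. Applied with bound 0 to a difference
  it yields uniqueness of the value.\<close>

lemma calculus_value_norm_le_iff:
  assumes a: "a \<in> H" and z: "calculus_value a f z" and M: "M \<ge> 0"
  shows "norm z \<le> M \<longleftrightarrow> (\<forall>t\<in>spectrum a. \<bar>f t\<bar> \<le> M)"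
proof
  assume le: "norm z \<le> M"
  show "\<forall>t\<in>spectrum a. \<bar>f t\<bar> \<le> M"
  proof (rule ballI, rule field_le_epsilon)
    fix t and \<epsilon> :: real assume t: "t \<in> spectrum a" and "0 < \<epsilon>"
    then obtain p where p: "\<And>t. t \<in> spectrum a \<Longrightarrow> \<bar>f t - poly p t\<bar> \<le> \<epsilon>/2" "norm (z - poly_at a p) \<le> \<epsilon>/2"
      using calculus_valueD[OF z, of "\<epsilon>/2"] by auto
    have "norm (poly_at a p) \<le> M + \<epsilon>/2"
      using p(2) le norm_triangle_ineq2[of "poly_at a p" z] by (simp add: norm_minus_commute)
    then have "\<bar>poly p t\<bar> \<le> M + \<epsilon>/2"
      using norm_poly_at_le_iff[OF a, of "M + \<epsilon>/2" p] M t \<open>0 < \<epsilon>\<close> by simp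
    then show "\<bar>f t\<bar> \<le> M + \<epsilon>" using p(1)[OF t] by linarith
  qed
next
  assume le: "\<forall>t\<in>spectrum a. \<bar>f t\<bar> \<le> M"
  show "norm z \<le> M"
  proof (rule field_le_epsilon)
    fix \<epsilon> :: real assume "0 < \<epsilon>"
    then obtain p where p: "\<And>t. t \<in> spectrum a \<Longrightarrow> \<bar>f t - poly p t\<bar> \<le> \<epsilon>/2" "norm (z - poly_at a p) \<le> \<epsilon>/2"
      using calculus_valueD[OF z, of "\<epsilon>/2"] by auto
    have "\<bar>poly p t\<bar> \<le> M + \<epsilon>/2" if "t \<in> spectrum a" for t
      using p(1)[OF that] bspec[OF le that] by linarith
    then have "norm (poly_at a p) \<le> M + \<epsilon>/2"
      using norm_poly_at_le_iff[OF a, of "M + \<epsilon>/2" p] M \<open>0 < \<epsilon>\<close> by simp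
    then show "norm z \<le> M + \<epsilon>"
      using p(2) norm_triangle_ineq2[of z "poly_at a p"] by simp
  qed
qed

lemma calculus_value_scale:
  assumes z: "calculus_value a f z"
  shows "calculus_value a (\<lambda>t. r * f t) (r *\<^sub>R z)"
  unfolding calculus_value_def
proof (intro allI impI)
  fix \<epsilon> :: real assume "\<epsilon> > 0"
  then have "\<epsilon> / (\<bar>r\<bar> + 1) > 0" by simp
  from calculus_valueD[OF z this] obtain p where p:
    "\<And>t. t \<in> spectrum a \<Longrightarrow> \<bar>f t - poly p t\<bar> \<le> \<epsilon> / (\<bar>r\<bar> + 1)" "norm (z - poly_at a p) \<le> \<epsilon> / (\<bar>r\<bar> + 1)"
    by blast
  have bound: "\<bar>r\<bar> * x \<le> \<epsilon>" if "x \<le> \<epsilon> / (\<bar>r\<bar> + 1)" for x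
  proof -
    have "\<bar>r\<bar> * x \<le> \<bar>r\<bar> * (\<epsilon> / (\<bar>r\<bar> + 1))" using that by (intro mult_left_mono) auto
    also have "\<dots> \<le> \<epsilon>" using \<open>\<epsilon> > 0\<close> by (simp add: field_simps)
    finally show ?thesis .
  qed
  show "\<exists>p. (\<forall>t\<in>spectrum a. \<bar>r * f t - poly p t\<bar> \<le> \<epsilon>) \<and> norm (r *\<^sub>R z - poly_at a p) \<le> \<epsilon>"
  proof (intro exI[of _ "smult r p"] conjI ballI)
    show "\<bar>r * f t - poly (smult r p) t\<bar> \<le> \<epsilon>" if "t \<in> spectrum a" for t
      using bound[OF p(1)[OF that]] by (simp flip: right_diff_distrib abs_mult)
    show "norm (r *\<^sub>R z - poly_at a (smult r p)) \<le> \<epsilon>"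
      using bound[OF p(2)] by (simp add: poly_at_smult flip: scaleR_diff_right)
  qed
qed

lemma calculus_value_add:
  assumes z: "calculus_value a f z" and w: "calculus_value a g w"
  shows "calculus_value a (\<lambda>t. f t + g t) (z + w)"
  unfolding calculus_value_def
proof (intro allI impI)
  fix \<epsilon> :: real assume "\<epsilon> > 0"
  then have "\<epsilon>/2 > 0" by simp
  from calculus_valueD[OF z this] obtain p where p:
    "\<And>t. t \<in> spectrum a \<Longrightarrow> \<bar>f t - poly p t\<bar> \<le> \<epsilon>/2" "norm (z - poly_at a p) \<le> \<epsilon>/2" by blast
  from calculus_valueD[OF w \<open>\<epsilon>/2 > 0\<close>] obtain q where q:
    "\<And>t. t \<in> spectrum a \<Longrightarrow> \<bar>g t - poly q t\<bar> \<le> \<epsilon>/2" "norm (w - poly_at a q) \<le> \<epsilon>/2" by blast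
  show "\<exists>p. (\<forall>t\<in>spectrum a. \<bar>f t + g t - poly p t\<bar> \<le> \<epsilon>) \<and> norm (z + w - poly_at a p) \<le> \<epsilon>"
  proof (intro exI[of _ "p + q"] conjI ballI)
    show "\<bar>f t + g t - poly (p + q) t\<bar> \<le> \<epsilon>" if "t \<in> spectrum a" for t
      using p(1)[OF that] q(1)[OF that] unfolding poly_add by linarith
    show "norm (z + w - poly_at a (p + q)) \<le> \<epsilon>"
      using p(2) q(2) norm_triangle_ineq[of "z - poly_at a p" "w - poly_at a q"]
      by (simp add: poly_at_add algebra_simps)
  qed
qed

text \<open>Used twice for products, once for the real function values and once for the elements
  themselves, hence the general type.\<close>

lemma norm_mult_diff_bound:
  fixes z w x y :: "'b::real_normed_algebra"
  assumes "norm (z - x) \<le> \<eta>" "norm (w - y) \<le> \<eta>" "norm z \<le> C" "norm w \<le> C"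
  shows "norm (z * w - x * y) \<le> (2 * C + \<eta>) * \<eta>"
proof -
  have "norm x \<le> C + \<eta>"
    using assms(1,3) norm_triangle_ineq2[of x z] by (simp add: norm_minus_commute)
  have "z * w - x * y = (z - x) * w + x * (w - y)" by (simp add: algebra_simps)
  also have "norm \<dots> \<le> norm (z - x) * norm w + norm x * norm (w - y)"
    by (meson add_mono norm_mult_ineq norm_triangle_le)
  also have "\<dots> \<le> \<eta> * C + (C + \<eta>) * \<eta>"
    using assms \<open>norm x \<le> C + \<eta>\<close> by (intro add_mono mult_mono) (auto intro: order_trans[OF norm_ge_zero])
  finally show ?thesis by (simp add: algebra_simps)
qed

lemma calculus_value_mult:
  assumes a: "a \<in> H" and z: "calculus_value a f z" and w: "calculus_value a g w"
  shows "calculus_value a (\<lambda>t. f t * g t) (z * w)"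
  unfolding calculus_value_def
proof (intro allI impI)
  fix \<epsilon> :: real assume \<epsilon>: "\<epsilon> > 0"
  define C where "C = norm z + norm w"
  have C: "C \<ge> 0" "norm z \<le> C" "norm w \<le> C" by (simp_all add: C_def)
  then have fg: "\<bar>f t\<bar> \<le> C" "\<bar>g t\<bar> \<le> C" if "t \<in> spectrum a" for t
    using calculus_value_norm_le_iff[OF a z C(1)] calculus_value_norm_le_iff[OF a w C(1)] that by auto
  \<comment> \<open>The minimum with 1 replaces \<open>2 * C + \<eta>\<close> by the constant
    \<open>2 * C + 1\<close>.\<close>
  define \<eta> where "\<eta> = min 1 (\<epsilon> / (2 * C + 1))"
  have \<eta>: "\<eta> > 0" using \<epsilon> C by (simp add: \<eta>_def)
  have "(2 * C + \<eta>) * \<eta> \<le> (2 * C + 1) * (\<epsilon> / (2 * C + 1))"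
    using C \<eta> by (intro mult_mono) (auto simp: \<eta>_def)
  then have le: "(2 * C + \<eta>) * \<eta> \<le> \<epsilon>" using C by simp
  from calculus_valueD[OF z \<eta>] obtain p where p:
    "\<And>t. t \<in> spectrum a \<Longrightarrow> \<bar>f t - poly p t\<bar> \<le> \<eta>" "norm (z - poly_at a p) \<le> \<eta>" by blast
  from calculus_valueD[OF w \<eta>] obtain q where q:
    "\<And>t. t \<in> spectrum a \<Longrightarrow> \<bar>g t - poly q t\<bar> \<le> \<eta>" "norm (w - poly_at a q) \<le> \<eta>" by blast
  show "\<exists>p. (\<forall>t\<in>spectrum a. \<bar>f t * g t - poly p t\<bar> \<le> \<epsilon>) \<and> norm (z * w - poly_at a p) \<le> \<epsilon>"
  proof (intro exI[of _ "p * q"] conjI ballI)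
    show "\<bar>f t * g t - poly (p * q) t\<bar> \<le> \<epsilon>" if "t \<in> spectrum a" for t
      using norm_mult_diff_bound[of "f t" "poly p t" \<eta> "g t" "poly q t" C] p(1) q(1) fg that le by simp
    show "norm (z * w - poly_at a (p * q)) \<le> \<epsilon>"
      using norm_mult_diff_bound[OF p(2) q(2) C(2,3)] le by (simp add: poly_at_mult[OF a])
  qed
qed

lemma calculus_value_unique:
  assumes a: "a \<in> H" and z: "calculus_value a f z" and w: "calculus_value a f w"
  shows "z = w"
proof -
  have "calculus_value a (\<lambda>t. f t + (-1) * f t) (z + (-1) *\<^sub>R w)"
    by (intro calculus_value_add calculus_value_scale z w)
  from iffD2[OF calculus_value_norm_le_iff[OF a this order_refl]]
  have "norm (z + (-1) *\<^sub>R w) \<le> 0" by simp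
  then show ?thesis by simp
qed

text \<open>Weierstrass polynomials for \<open>f\<close> give a Cauchy sequence by the isometry;
  completeness of \<open>H\<close>, rather than of the ambient algebra, puts the limit into
  \<open>H\<close>.\<close>

lemma calculus_value_exists:
  assumes a: "a \<in> H" and f: "continuous_on (spectrum a) f"
  shows "\<exists>z\<in>H. calculus_value a f z"
proof -
  have "\<exists>p. \<forall>t\<in>spectrum a. \<bar>f t - poly p t\<bar> \<le> inverse (real (Suc n))" for n
    by (rule weierstrass_poly[OF compact_spectrum[OF a] f, of "inverse (real (Suc n))"]) (simp, blast)
  then obtain p where p: "\<And>n t. t \<in> spectrum a \<Longrightarrow> \<bar>f t - poly (p n) t\<bar> \<le> inverse (real (Suc n))" by metis
  have diff: "norm (poly_at a (p m) - poly_at a (p n)) \<le> 2 * inverse (real (Suc N))"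
    if "m \<ge> N" "n \<ge> N" for m n N
  proof -
    have "\<bar>poly (p m - p n) t\<bar> \<le> 2 * inverse (real (Suc N))" if t: "t \<in> spectrum a" for t
    proof -
      have "inverse (real (Suc m)) \<le> inverse (real (Suc N))" "inverse (real (Suc n)) \<le> inverse (real (Suc N))"
        using \<open>m \<ge> N\<close> \<open>n \<ge> N\<close> by simp_all
      then show ?thesis using p[OF t, of m] p[OF t, of n] unfolding poly_diff by linarith
    qed
    then show ?thesis
      using norm_poly_at_le_iff[OF a, of "2 * inverse (real (Suc N))" "p m - p n"]
      by (simp add: poly_at_diff)
  qed
  have small: "\<exists>N. 2 * inverse (real (Suc N)) < \<epsilon>" if "\<epsilon> > 0" for \<epsilon>
    using reals_Archimedean[of "\<epsilon>/2"] that by (auto simp: mult.commute)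
  have "Cauchy (\<lambda>n. poly_at a (p n))"
  proof (rule metric_CauchyI)
    fix \<epsilon> :: real assume "0 < \<epsilon>"
    then obtain N where "2 * inverse (real (Suc N)) < \<epsilon>" using small by blast
    then show "\<exists>M. \<forall>m\<ge>M. \<forall>n\<ge>M. dist (poly_at a (p m)) (poly_at a (p n)) < \<epsilon>"
      using diff by (intro exI[of _ N]) (force simp: dist_norm)
  qed
  then obtain z where "z \<in> H" and lim: "(\<lambda>n. poly_at a (p n)) \<longlonglongrightarrow> z"
    using poly_at_H[OF a] by (elim completeE[OF complete_H, rotated]) auto
  have "calculus_value a f z"
    unfolding calculus_value_def
  proof (intro allI impI)
    fix \<epsilon> :: real assume "\<epsilon> > 0"
    then obtain N where N: "2 * inverse (real (Suc N)) < \<epsilon>" using small by blast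
    have "\<forall>\<^sub>F n in sequentially. dist (poly_at a (p n)) z < \<epsilon>" using lim \<open>\<epsilon> > 0\<close> by (rule tendstoD)
    then have "\<forall>\<^sub>F n in sequentially. dist (poly_at a (p n)) z < \<epsilon> \<and> n \<ge> N"
      by (intro eventually_conj eventually_ge_at_top)
    then obtain n where n: "dist (poly_at a (p n)) z < \<epsilon>" "n \<ge> N"
      using eventually_happens'[OF sequentially_bot] by blast
    then have "inverse (real (Suc n)) \<le> inverse (real (Suc N))" by simp
    moreover have "inverse (real (Suc N)) > 0" by simp
    ultimately have "inverse (real (Suc n)) \<le> \<epsilon>" using N by linarith
    then have "\<forall>t\<in>spectrum a. \<bar>f t - poly (p n) t\<bar> \<le> \<epsilon>" using p[of _ n] by (blast intro: order_trans)
    moreover have "norm (z - poly_at a (p n)) \<le> \<epsilon>" using n(1) by (simp add: dist_norm norm_minus_commute)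
    ultimately show "\<exists>p. (\<forall>t\<in>spectrum a. \<bar>f t - poly p t\<bar> \<le> \<epsilon>) \<and> norm (z - poly_at a p) \<le> \<epsilon>"
      by blast
  qed
  with \<open>z \<in> H\<close> show ?thesis by blast
qed

text \<open>The clauses of the definition fix \<Phi> on polynomials, and its isometry clause carries
  this over to continuous functions.\<close>

lemma continuous_calculus_unique:
  assumes a: "a \<in> H" and \<Phi>: "continuous_calculus a \<Phi>" and f: "continuous_on (spectrum a) f"
  shows "calculus_value a f (\<Phi> f)"
proof -
  note \<Phi>D = \<Phi>[unfolded continuous_calculus_def]
  have scale: "\<Phi> (\<lambda>t. r * g t) = r *\<^sub>R \<Phi> g" if "continuous_on (spectrum a) g" for r g
    using \<Phi>D that by blast
  have add: "\<Phi> (\<lambda>t. g t + h t) = \<Phi> g + \<Phi> h" and mult: "\<Phi> (\<lambda>t. g t * h t) = \<Phi> g * \<Phi> h"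
    if "continuous_on (spectrum a) g" "continuous_on (spectrum a) h" for g h
    using \<Phi>D that by blast+
  have norm: "norm (\<Phi> g) \<le> M \<longleftrightarrow> (\<forall>t\<in>spectrum a. \<bar>g t\<bar> \<le> M)"
    if "continuous_on (spectrum a) g" "M \<ge> 0" for g M
    using \<Phi>D that by blast
  have poly: "\<Phi> (poly p) = poly_at a p" for p
  proof (induction p)
    case 0
    have "\<Phi> (\<lambda>t. 0 * t) = 0 *\<^sub>R \<Phi> (\<lambda>t. t)" by (rule scale) simp
    then show ?case by simp
  next
    case (pCons c p)
    have "\<Phi> (poly (pCons c p)) = \<Phi> (\<lambda>t. c * 1 + t * poly p t)" by (rule arg_cong[where f = \<Phi>]) auto
    also have "\<dots> = \<Phi> (\<lambda>t. c * 1) + \<Phi> (\<lambda>t. t * poly p t)"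
      by (rule add) (intro continuous_intros)+
    also have "\<Phi> (\<lambda>t. t * poly p t) = \<Phi> (\<lambda>t. t) * \<Phi> (poly p)"
      by (rule mult) (intro continuous_intros)+
    also have "\<Phi> (\<lambda>t. c * 1) = c *\<^sub>R \<Phi> (\<lambda>t. 1)" by (rule scale) simp
    finally show ?case using pCons \<Phi>D by simp
  qed
  show ?thesis
    unfolding calculus_value_def
  proof (intro allI impI)
    fix \<epsilon> :: real assume \<epsilon>: "\<epsilon> > 0"
    obtain p where p: "\<And>t. t \<in> spectrum a \<Longrightarrow> \<bar>f t - poly p t\<bar> \<le> \<epsilon>"
      using weierstrass_poly[OF compact_spectrum[OF a] f \<epsilon>] by blast
    have cp: "continuous_on (spectrum a) (poly p)" by (intro continuous_intros)
    then have cp': "continuous_on (spectrum a) (\<lambda>t. (-1) * poly p t)" by (intro continuous_intros)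
    have eq: "\<Phi> (\<lambda>t. f t + (-1) * poly p t) = \<Phi> f - poly_at a p"
      unfolding add[OF f cp'] scale[OF cp] poly by simp
    have "norm (\<Phi> f - poly_at a p) \<le> \<epsilon>"
      unfolding eq[symmetric] using norm[OF continuous_on_add[OF f cp'], of \<epsilon>] p \<epsilon> by simp
    then show "\<exists>p. (\<forall>t\<in>spectrum a. \<bar>f t - poly p t\<bar> \<le> \<epsilon>) \<and> norm (\<Phi> f - poly_at a p) \<le> \<epsilon>"
      using p by (intro exI[of _ p]) auto
  qed
qed

lemma continuous_calculus_exists:
  assumes a: "a \<in> H"
  obtains \<Phi> where "continuous_calculus a \<Phi>"
    "\<And>f. continuous_on (spectrum a) f \<Longrightarrow> \<Phi> f \<in> H \<and> calculus_value a f (\<Phi> f)"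
proof -
  define \<Phi> where "\<Phi> f = (SOME z. z \<in> H \<and> calculus_value a f z)" for f
  have \<Phi>: "\<Phi> f \<in> H \<and> calculus_value a f (\<Phi> f)" if "continuous_on (spectrum a) f" for f
    unfolding \<Phi>_def
    using calculus_value_exists[OF a that] someI_ex[of "\<lambda>z. z \<in> H \<and> calculus_value a f z"] by blast
  have eq: "\<Phi> f = z" if "calculus_value a f z" "continuous_on (spectrum a) f" for f z
    using calculus_value_unique[OF a _ that(1)] \<Phi>[OF that(2)] by blast
  have "continuous_calculus a \<Phi>"
    unfolding continuous_calculus_def
  proof (intro conjI allI impI)
    show "\<Phi> (\<lambda>t. 1) = e" using eq[OF calculus_value_const[of a 1] continuous_on_const] by simp
    show "\<Phi> (\<lambda>t. t) = a" using eq[OF calculus_value_id[OF a] continuous_on_id] .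
    fix f :: "real \<Rightarrow> real" assume f: "continuous_on (spectrum a) f"
    show "\<Phi> f \<in> \<A>" using \<Phi>[OF f] H_subset by blast
    show "\<Phi> (\<lambda>t. r * f t) = r *\<^sub>R \<Phi> f" for r
      using \<Phi>[OF f] f by (intro eq calculus_value_scale continuous_intros) auto
    show "norm (\<Phi> f) \<le> M \<longleftrightarrow> (\<forall>t\<in>spectrum a. \<bar>f t\<bar> \<le> M)" if "0 \<le> M" for M
      using calculus_value_norm_le_iff[OF a _ that] \<Phi>[OF f] by blast
    fix g :: "real \<Rightarrow> real" assume g: "continuous_on (spectrum a) g"
    show "\<Phi> (\<lambda>t. f t + g t) = \<Phi> f + \<Phi> g"
      using \<Phi>[OF f] \<Phi>[OF g] f g by (intro eq calculus_value_add continuous_intros) auto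
    show "\<Phi> (\<lambda>t. f t * g t) = \<Phi> f * \<Phi> g"
      using \<Phi>[OF f] \<Phi>[OF g] f g by (intro eq calculus_value_mult[OF a] continuous_intros) auto
  qed
  then show thesis using that \<Phi> by blast
qed

text \<open>The description in \<open>fun_calc\<close> selects a value and not \<Phi>, which is
  arbitrary on functions that are discontinuous on the spectrum; for continuous \<open>f\<close> the
  value is determined.\<close>

lemma fun_calc_value:
  assumes a: "a \<in> H" and f: "continuous_on (spectrum a) f"
  shows "fun_calc f a \<in> H" "calculus_value a f (fun_calc f a)"
proof -
  obtain \<Phi> where \<Phi>: "continuous_calculus a \<Phi>"
    "\<And>f. continuous_on (spectrum a) f \<Longrightarrow> \<Phi> f \<in> H \<and> calculus_value a f (\<Phi> f)"
    using continuous_calculus_exists[OF a] by blast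
  have "fun_calc f a = \<Phi> f"
    unfolding fun_calc_def
    using \<Phi> continuous_calculus_unique[OF a _ f] calculus_value_unique[OF a] by (intro the_equality) blast+
  then show "fun_calc f a \<in> H" "calculus_value a f (fun_calc f a)" using \<Phi>(2)[OF f] by simp_all
qed

section \<open>Rules for functions of one element\<close>

lemma fun_calc_eqI:
  assumes "a \<in> H" "continuous_on (spectrum a) f" "calculus_value a f z"
  shows "fun_calc f a = z"
  using calculus_value_unique fun_calc_value(2) assms by blast

lemma calculus_value_cong:
  assumes "\<And>t. t \<in> spectrum a \<Longrightarrow> f t = g t"
  shows "calculus_value a f z = calculus_value a g z"
  unfolding calculus_value_def using assms by simp

lemma fun_calc_cong:
  assumes a: "a \<in> H" and f: "continuous_on (spectrum a) f" and "\<And>t. t \<in> spectrum a \<Longrightarrow> f t = g t"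
  shows "fun_calc f a = fun_calc g a"
proof (rule fun_calc_eqI[OF a f])
  have "continuous_on (spectrum a) g" using f continuous_on_cong[of "spectrum a" _ f g] assms(3) by simp
  then show "calculus_value a f (fun_calc g a)"
    using fun_calc_value(2)[OF a] calculus_value_cong[of a f g] assms(3) by simp
qed

lemma fun_calc_const: "a \<in> H \<Longrightarrow> fun_calc (\<lambda>t. c) a = c *\<^sub>R e"
  by (rule fun_calc_eqI[OF _ continuous_on_const calculus_value_const])

lemma fun_calc_id: "a \<in> H \<Longrightarrow> fun_calc (\<lambda>t. t) a = a"
  by (rule fun_calc_eqI[OF _ continuous_on_id calculus_value_id])

lemma fun_calc_scale:
  assumes a: "a \<in> H" and f: "continuous_on (spectrum a) f"
  shows "fun_calc (\<lambda>t. r * f t) a = r *\<^sub>R fun_calc f a"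
  by (rule fun_calc_eqI[OF a]) (intro continuous_intros f, intro calculus_value_scale fun_calc_value a f)

lemma fun_calc_add:
  assumes a: "a \<in> H" and f: "continuous_on (spectrum a) f" and g: "continuous_on (spectrum a) g"
  shows "fun_calc (\<lambda>t. f t + g t) a = fun_calc f a + fun_calc g a"
  by (rule fun_calc_eqI[OF a]) (intro continuous_intros f g, intro calculus_value_add fun_calc_value a f g)

lemma fun_calc_mult:
  assumes a: "a \<in> H" and f: "continuous_on (spectrum a) f" and g: "continuous_on (spectrum a) g"
  shows "fun_calc (\<lambda>t. f t * g t) a = fun_calc f a * fun_calc g a"
  by (rule fun_calc_eqI[OF a]) (intro continuous_intros f g, intro calculus_value_mult fun_calc_value a f g)

lemma norm_fun_calc_le_iff:
  assumes a: "a \<in> H" and f: "continuous_on (spectrum a) f" and "M \<ge> 0"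
  shows "norm (fun_calc f a) \<le> M \<longleftrightarrow> (\<forall>t\<in>spectrum a. \<bar>f t\<bar> \<le> M)"
  using assms by (intro calculus_value_norm_le_iff fun_calc_value)

lemma fun_calc_diff:
  assumes "a \<in> H" "continuous_on (spectrum a) f" "continuous_on (spectrum a) g"
  shows "fun_calc (\<lambda>t. f t - g t) a = fun_calc f a - fun_calc g a"
proof -
  have "continuous_on (spectrum a) (\<lambda>t. f t - g t)" using assms by (intro continuous_intros)
  from fun_calc_add[OF assms(1) this assms(3)] show ?thesis by simp
qed

lemma fun_calc_inverse_pair:
  assumes a: "a \<in> H" and f: "continuous_on (spectrum a) f" and "\<And>t. t \<in> spectrum a \<Longrightarrow> f t \<noteq> 0"
  shows "inverse_pair (fun_calc f a) (fun_calc (\<lambda>t. 1 / f t) a)"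
proof -
  have g: "continuous_on (spectrum a) (\<lambda>t. 1 / f t)" using f assms(3) by (auto intro!: continuous_intros)
  have "fun_calc (\<lambda>t. f t * (1 / f t)) a = fun_calc (\<lambda>t. 1) a"
    by (rule fun_calc_cong[OF a continuous_on_mult[OF f g]]) (simp add: assms(3))
  moreover have "fun_calc (\<lambda>t. 1 / f t * f t) a = fun_calc (\<lambda>t. 1) a"
    by (rule fun_calc_cong[OF a continuous_on_mult[OF g f]]) (simp add: assms(3))
  moreover have "fun_calc (\<lambda>t. 1) a = e" using fun_calc_const[OF a, of 1] by simp
  ultimately show ?thesis
    using fun_calc_value(1)[OF a g] fun_calc_mult[OF a f g] fun_calc_mult[OF a g f]
    by (simp add: inverse_pair_def)
qed

text \<open>It allows the inverses of sums and means to be found by algebra, without computing with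
  functions of those elements.\<close>

lemma inverse_of_eqI:
  assumes a: "a \<in> H" and b: "inverse_pair a b"
  shows "inverse_of a = b"
proof -
  have "0 \<notin> spectrum a" using b by (auto simp: not_in_spectrum_iff[OF a])
  then have "inverse_pair (fun_calc (\<lambda>t. t) a) (inverse_of a)"
    unfolding inverse_of_def by (intro fun_calc_inverse_pair[OF a] continuous_intros) auto
  then show ?thesis using b inverse_pair_unique by (simp add: fun_calc_id[OF a])
qed

end

section \<open>Scalar inequalities and means\<close>

lemma sub_inverse_sub_ln_mono:
  fixes x y :: real assumes "0 < x" "x \<le> y"
  shows "x - 1/x - 2 * ln x \<le> y - 1/y - 2 * ln y"
proof (rule DERIV_nonneg_imp_nondecreasing[OF assms(2)])
  fix z assume "x \<le> z" "z \<le> y"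
  then have z: "z > 0" using assms by simp
  have "((\<lambda>z. z - 1/z - 2 * ln z) has_real_derivative (1 + 1 / z\<^sup>2 - 2 / z)) (at z)"
    using z by (auto intro!: derivative_eq_intros simp: power2_eq_square)
  moreover have "1 + 1 / z\<^sup>2 - 2 / z = (1 - 1/z)\<^sup>2" by (simp add: power2_diff power_divide)
  ultimately show "\<exists>d. ((\<lambda>z. z - 1/z - 2 * ln z) has_real_derivative d) (at z) \<and> 0 \<le> d" by force
qed

lemma ln_add_four_over_mono:
  fixes x y :: real assumes "0 < x" "x \<le> y"
  shows "ln x + 4 / (x + 1) \<le> ln y + 4 / (y + 1)"
proof (rule DERIV_nonneg_imp_nondecreasing[OF assms(2)])
  fix z assume "x \<le> z" "z \<le> y"
  then have z: "z > 0" using assms by simp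
  have "((\<lambda>z. ln z + 4 / (z + 1)) has_real_derivative (1 / z - 4 / (z + 1)\<^sup>2)) (at z)"
    using z by (auto intro!: derivative_eq_intros simp: power2_eq_square)
  moreover have "1 / z - 4 / (z + 1)\<^sup>2 = (z - 1)\<^sup>2 / (z * (z + 1)\<^sup>2)"
    using z by (simp add: divide_simps add_pos_pos) (simp add: power2_eq_square algebra_simps)
  ultimately show "\<exists>d. ((\<lambda>z. ln z + 4 / (z + 1)) has_real_derivative d) (at z) \<and> 0 \<le> d" using z by force
qed

lemma scalar_harmonic_le:
  fixes t :: real assumes "t > 0"
  shows "1 - 1/t \<le> 2 * (1 - 2 * (1 / (1 + t)))" "2 * (1 - 2 * (1 / (1 + t))) \<le> t - 1"
proof -
  have eq: "2 * (1 - 2 * (1 / (1 + t))) - (1 - 1/t) = (t - 1)\<^sup>2 / (t * (1 + t))"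
    "t - 1 - 2 * (1 - 2 * (1 / (1 + t))) = (t - 1)\<^sup>2 / (1 + t)"
    using assms by (simp_all add: divide_simps add_pos_pos) (simp_all add: power2_eq_square algebra_simps)
  show "1 - 1/t \<le> 2 * (1 - 2 * (1 / (1 + t)))" "2 * (1 - 2 * (1 / (1 + t))) \<le> t - 1"
    using assms by (subst diff_ge_0_iff_ge[symmetric], subst eq, simp)+
qed

lemma scalar_arithmetic_le:
  fixes t :: real assumes "t > 0"
  shows "1 - 1/t \<le> 1/2 * (t - 1/t)" "1/2 * (t - 1/t) \<le> t - 1"
proof -
  have eq: "1/2 * (t - 1/t) - (1 - 1/t) = (t - 1)\<^sup>2 / (2 * t)"
    "t - 1 - 1/2 * (t - 1/t) = (t - 1)\<^sup>2 / (2 * t)"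
    using assms by (simp_all add: divide_simps) (simp_all add: power2_eq_square algebra_simps)
  show "1 - 1/t \<le> 1/2 * (t - 1/t)" "1/2 * (t - 1/t) \<le> t - 1"
    using assms by (subst diff_ge_0_iff_ge[symmetric], subst eq, simp)+
qed

text \<open>
  Both families are \<open>ln t\<close> plus a monotone function of \<open>x/t\<close>.
\<close>

lemma scalar_mono_delta:
  fixes t x y :: real assumes "0 < t" "0 < x" "x \<le> y"
  shows "ln x + 2 * (1 - (2 * x) * (1 / (x + t))) \<le> ln y + 2 * (1 - (2 * y) * (1 / (y + t)))"
    "1/2 * (1 / y * t - y * (1/t)) + ln y \<le> 1/2 * (1 / x * t - x * (1/t)) + ln x"
proof -
  have y: "y > 0" using assms by simp
  have 1: "ln z + 2 * (1 - (2 * z) * (1 / (z + t))) = (ln (z/t) + 4 / (z/t + 1)) + ln t - 2"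
    if "z > 0" for z
  proof -
    have "4 / (z/t + 1) = 4 - 4 * z / (z + t)" using that assms by (simp add: field_simps add_pos_pos)
    then show ?thesis using that assms by (simp add: ln_div)
  qed
  show "ln x + 2 * (1 - (2 * x) * (1 / (x + t))) \<le> ln y + 2 * (1 - (2 * y) * (1 / (y + t)))"
    using ln_add_four_over_mono[of "x/t" "y/t"] assms unfolding 1[OF assms(2)] 1[OF y]
    by (simp add: divide_right_mono)
  have 2: "1/2 * (1 / z * t - z * (1/t)) + ln z = 1/2 * (t/z - 1/(t/z) - 2 * ln (t/z)) + ln t"
    if "z > 0" for z
    using that assms by (simp add: ln_div algebra_simps)
  have "t/y \<le> t/x" using assms by (intro divide_left_mono) auto
  then show "1/2 * (1 / y * t - y * (1/t)) + ln y \<le> 1/2 * (1 / x * t - x * (1/t)) + ln x"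
    unfolding 2[OF assms(2)] 2[OF y] using assms y
    by (intro add_right_mono mult_left_mono sub_inverse_sub_ln_mono) simp_all
qed

text \<open>In the variable \<open>u\<close> the first and last differences have the sign of
  \<open>u - 1\<close>. The two middle ones compare a monotone function at \<open>u\<close> and at
  1, and their values at 1 are left unevaluated to show this. Both chains are read off from these
  identities.\<close>

lemma scalar_differences:
  fixes t \<delta> :: real assumes "0 < t" "0 < \<delta>"
  defines "u \<equiv> sqrt (t / \<delta>)"
  shows "((ln \<delta> + 4) - (8 * sqrt \<delta>) * (1 / (t powr (1/2) + sqrt \<delta>)))
      - (ln \<delta> + 2 * (1 - (2 * \<delta>) * (1 / (\<delta> + t)))) = 2 * (u - 1) ^ 3 / ((u + 1) * (u\<^sup>2 + 1))"
    and "ln t - ((ln \<delta> + 4) - (8 * sqrt \<delta>) * (1 / (t powr (1/2) + sqrt \<delta>)))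
      = 2 * ((ln u + 4 / (u + 1)) - (ln 1 + 4 / (1 + 1)))"
    and "(((1 / sqrt \<delta>) * t powr (1/2) - sqrt \<delta> * t powr (-1/2)) + ln \<delta>) - ln t
      = (u - 1/u - 2 * ln u) - (1 - 1/1 - 2 * ln 1)"
    and "(1/2 * ((1 / \<delta>) * t - \<delta> * (1 / t)) + ln \<delta>)
      - (((1 / sqrt \<delta>) * t powr (1/2) - sqrt \<delta> * t powr (-1/2)) + ln \<delta>)
      = (u - 1) * ((u + 1) * (u - 1)\<^sup>2 / (2 * u\<^sup>2))"
proof -
  \<comment> \<open>With \<open>t = s^2 * u^2\<close> the roots disappear, and what remains besides
    \<open>ln\<close> is rational in \<open>u\<close>.\<close>
  define s where "s = sqrt \<delta>"
  have s: "s > 0" "\<delta> = s\<^sup>2" using assms by (simp_all add: s_def)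
  have u: "u > 0" using assms by (simp add: u_def)
  have t: "t = s\<^sup>2 * u\<^sup>2" using assms s by (simp add: u_def)
  have p: "t powr (1/2) = s * u" "t powr (-1/2) = 1 / (s * u)"
    using s u assms(1) by (simp_all add: t powr_half_sqrt real_sqrt_mult powr_minus_divide)
  have ln: "ln t = ln \<delta> + 2 * ln u" using s u by (simp add: t ln_mult ln_realpow)
  have "\<delta> + t = s\<^sup>2 * (u\<^sup>2 + 1)" "s * u + s = s * (u + 1)" by (simp_all add: s(2) t algebra_simps)
  then have d: "\<delta> / (\<delta> + t) = 1 / (u\<^sup>2 + 1)" and g: "s / (s * u + s) = 1 / (u + 1)"
    using s by simp_all
  have g8: "(8 * sqrt \<delta>) * (1 / (t powr (1/2) + sqrt \<delta>)) = 8 / (u + 1)"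
    using g by (simp add: p flip: s_def)
  have d4: "(2 * \<delta>) * (1 / (\<delta> + t)) = 2 / (u\<^sup>2 + 1)" using d by simp
  have nz: "u\<^sup>2 + 1 \<noteq> 0" "u + 1 \<noteq> 0" using u by (simp_all add: add_pos_pos add_nonneg_eq_0_iff)
  have "4 - 8 / (u + 1) - (2 - 4 / (u\<^sup>2 + 1)) = 2 * (u - 1) ^ 3 / ((u + 1) * (u\<^sup>2 + 1))"
    using nz by (simp add: divide_simps) (simp add: power2_eq_square power3_eq_cube algebra_simps)
  then show "((ln \<delta> + 4) - (8 * sqrt \<delta>) * (1 / (t powr (1/2) + sqrt \<delta>)))
      - (ln \<delta> + 2 * (1 - (2 * \<delta>) * (1 / (\<delta> + t)))) = 2 * (u - 1) ^ 3 / ((u + 1) * (u\<^sup>2 + 1))"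
    unfolding g8 d4 by simp
  show "ln t - ((ln \<delta> + 4) - (8 * sqrt \<delta>) * (1 / (t powr (1/2) + sqrt \<delta>)))
      = 2 * ((ln u + 4 / (u + 1)) - (ln 1 + 4 / (1 + 1)))"
    unfolding g8 ln by simp
  have 6: "(1 / sqrt \<delta>) * t powr (1/2) - sqrt \<delta> * t powr (-1/2) = u - 1/u"
    unfolding p s_def[symmetric] using s(1) by simp
  show "(((1 / sqrt \<delta>) * t powr (1/2) - sqrt \<delta> * t powr (-1/2)) + ln \<delta>) - ln t
      = (u - 1/u - 2 * ln u) - (1 - 1/1 - 2 * ln 1)"
    unfolding 6 ln by simp
  have "1/2 * (u\<^sup>2 - 1/u\<^sup>2) - (u - 1/u) = (u - 1) * ((u + 1) * (u - 1)\<^sup>2 / (2 * u\<^sup>2))"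
    using u by (simp add: divide_simps) (simp add: power2_eq_square power4_eq_xxxx algebra_simps)
  moreover have "1 / \<delta> * t = u\<^sup>2" "\<delta> * (1 / t) = 1 / u\<^sup>2" using s by (simp_all add: t)
  ultimately show "(1/2 * ((1 / \<delta>) * t - \<delta> * (1 / t)) + ln \<delta>)
      - (((1 / sqrt \<delta>) * t powr (1/2) - sqrt \<delta> * t powr (-1/2)) + ln \<delta>)
      = (u - 1) * ((u + 1) * (u - 1)\<^sup>2 / (2 * u\<^sup>2))"
    unfolding 6 by simp
qed

lemma scalar_chain_ge:
  fixes t \<delta> :: real assumes "0 < \<delta>" "\<delta> \<le> t"
  shows "ln \<delta> + 2 * (1 - (2 * \<delta>) * (1 / (\<delta> + t)))
      \<le> (ln \<delta> + 4) - (8 * sqrt \<delta>) * (1 / (t powr (1/2) + sqrt \<delta>))"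
    and "(ln \<delta> + 4) - (8 * sqrt \<delta>) * (1 / (t powr (1/2) + sqrt \<delta>)) \<le> ln t"
    and "ln t \<le> ((1 / sqrt \<delta>) * t powr (1/2) - sqrt \<delta> * t powr (-1/2)) + ln \<delta>"
    and "((1 / sqrt \<delta>) * t powr (1/2) - sqrt \<delta> * t powr (-1/2)) + ln \<delta>
      \<le> 1/2 * ((1 / \<delta>) * t - \<delta> * (1 / t)) + ln \<delta>"
proof -
  have t: "t > 0" using assms by simp
  note diff = scalar_differences[OF t assms(1)]
  define u where "u = sqrt (t / \<delta>)"
  have u: "u \<ge> 1" using assms by (simp add: u_def)
  have "2 * (u - 1) ^ 3 / ((u + 1) * (u\<^sup>2 + 1)) \<ge> 0" "(u - 1) * ((u + 1) * (u - 1)\<^sup>2 / (2 * u\<^sup>2)) \<ge> 0"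
    using u by (simp_all add: zero_le_mult_iff zero_le_divide_iff)
  then show "ln \<delta> + 2 * (1 - (2 * \<delta>) * (1 / (\<delta> + t)))
      \<le> (ln \<delta> + 4) - (8 * sqrt \<delta>) * (1 / (t powr (1/2) + sqrt \<delta>))"
    and "((1 / sqrt \<delta>) * t powr (1/2) - sqrt \<delta> * t powr (-1/2)) + ln \<delta>
      \<le> 1/2 * ((1 / \<delta>) * t - \<delta> * (1 / t)) + ln \<delta>"
    using diff(1,4) unfolding u_def by linarith+
  show "(ln \<delta> + 4) - (8 * sqrt \<delta>) * (1 / (t powr (1/2) + sqrt \<delta>)) \<le> ln t"
    by (rule diff_ge_0_iff_ge[THEN iffD1], subst diff(2))
      (use ln_add_four_over_mono[OF zero_less_one u] in \<open>simp add: u_def\<close>)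
  show "ln t \<le> ((1 / sqrt \<delta>) * t powr (1/2) - sqrt \<delta> * t powr (-1/2)) + ln \<delta>"
    by (rule diff_ge_0_iff_ge[THEN iffD1], subst diff(3))
      (use sub_inverse_sub_ln_mono[OF zero_less_one u] in \<open>simp add: u_def\<close>)
qed

text \<open>Here \<open>u \<le> 1\<close>: the odd powers of \<open>u - 1\<close> change sign and
  the monotone functions are compared in the other direction.\<close>

lemma scalar_chain_le:
  fixes t \<delta> :: real assumes "0 < t" "t \<le> \<delta>"
  shows "(ln \<delta> + 4) - (8 * sqrt \<delta>) * (1 / (t powr (1/2) + sqrt \<delta>))
      \<le> ln \<delta> + 2 * (1 - (2 * \<delta>) * (1 / (\<delta> + t)))"
    and "ln t \<le> (ln \<delta> + 4) - (8 * sqrt \<delta>) * (1 / (t powr (1/2) + sqrt \<delta>))"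
    and "((1 / sqrt \<delta>) * t powr (1/2) - sqrt \<delta> * t powr (-1/2)) + ln \<delta> \<le> ln t"
    and "1/2 * ((1 / \<delta>) * t - \<delta> * (1 / t)) + ln \<delta>
      \<le> ((1 / sqrt \<delta>) * t powr (1/2) - sqrt \<delta> * t powr (-1/2)) + ln \<delta>"
proof -
  have \<delta>: "\<delta> > 0" using assms by simp
  note diff = scalar_differences[OF assms(1) \<delta>]
  define u where "u = sqrt (t / \<delta>)"
  have u: "u > 0" "u \<le> 1" using assms \<delta> by (simp_all add: u_def)
  have "(u - 1) ^ 3 \<le> 0" using u by (simp add: power_le_zero_eq)
  then have "2 * (u - 1) ^ 3 / ((u + 1) * (u\<^sup>2 + 1)) \<le> 0" "(u - 1) * ((u + 1) * (u - 1)\<^sup>2 / (2 * u\<^sup>2)) \<le> 0"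
    using u by (simp_all add: mult_le_0_iff divide_le_0_iff)
  then show "(ln \<delta> + 4) - (8 * sqrt \<delta>) * (1 / (t powr (1/2) + sqrt \<delta>))
      \<le> ln \<delta> + 2 * (1 - (2 * \<delta>) * (1 / (\<delta> + t)))"
    and "1/2 * ((1 / \<delta>) * t - \<delta> * (1 / t)) + ln \<delta>
      \<le> ((1 / sqrt \<delta>) * t powr (1/2) - sqrt \<delta> * t powr (-1/2)) + ln \<delta>"
    using diff(1,4) unfolding u_def by linarith+
  show "ln t \<le> (ln \<delta> + 4) - (8 * sqrt \<delta>) * (1 / (t powr (1/2) + sqrt \<delta>))"
    by (rule diff_le_0_iff_le[THEN iffD1], subst diff(2))
      (use ln_add_four_over_mono[OF u] in \<open>simp add: u_def\<close>)
  show "((1 / sqrt \<delta>) * t powr (1/2) - sqrt \<delta> * t powr (-1/2)) + ln \<delta> \<le> ln t"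
    by (rule diff_le_0_iff_le[THEN iffD1], subst diff(3))
      (use sub_inverse_sub_ln_mono[OF u] in \<open>simp add: u_def\<close>)
qed

text \<open>The order is used in two ways: differences are exhibited as conjugated squares, and
  \<open>pos_shift_invertible\<close> makes the spectra of positive elements nonnegative.\<close>

locale positive_cone = selfadjoint_part +
  assumes pos_H: "pos z \<Longrightarrow> z \<in> H"
    and pos_conjugate: "pos z \<Longrightarrow> y \<in> H \<Longrightarrow> pos (y * z * y)"
    and pos_square: "x \<in> H \<Longrightarrow> pos (x * x)"
    and pos_shift_invertible: "pos z \<Longrightarrow> t > 0 \<Longrightarrow> invertible_element (z + t *\<^sub>R e)"
begin

lemma spectrum_pos: "pos z \<Longrightarrow> t \<in> spectrum z \<Longrightarrow> t \<ge> 0"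
  using pos_shift_invertible[of z "- t"] by (force simp: spectrum_def)

lemma spectrum_shift: "spectrum (a - s *\<^sub>R e) = {t. t + s \<in> spectrum a}"
  by (simp add: spectrum_def algebra_simps)

end

section \<open>Conjugation by the square root of \<open>A\<close>\<close>

locale positive_pair = positive_cone +
  fixes A B :: 'a
  assumes pos_A: "pos A" and inv_A: "invertible_element A"
    and pos_B: "pos B" and inv_B: "invertible_element B"
begin

definition root_A :: 'a ("R") where "R = A \<up> (1/2)"
definition inv_root_A :: 'a ("Q") where "Q = A \<up> (-1/2)"
definition quotient :: 'a ("T") where "T = Q * B * Q"

text \<open>The operator perspective of \<open>f\<close> at the pair \<open>B\<close>,
  \<open>A\<close>.\<close>

definition conj_calc :: "(real \<Rightarrow> real) \<Rightarrow> 'a" where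
  "conj_calc f = R * fun_calc f T * R"

lemma A_H: "A \<in> H" and B_H: "B \<in> H"
  using pos_A pos_B pos_H by blast+

lemma spectrum_A: "t \<in> spectrum A \<Longrightarrow> t > 0"
  using spectrum_pos[OF pos_A, of t] inv_A by (cases "t = 0") (auto simp: spectrum_def)

lemma continuous_powr_A: "continuous_on (spectrum A) (\<lambda>t. t powr r)"
  using spectrum_A by (intro continuous_intros) auto

lemma root_H: "R \<in> H" "Q \<in> H"
  unfolding root_A_def inv_root_A_def real_power_def
  by (rule fun_calc_value(1)[OF A_H continuous_powr_A])+

lemma powers_mult: "A \<up> r * A \<up> s = fun_calc (\<lambda>t. t powr (r + s)) A"
  unfolding real_power_def fun_calc_mult[OF A_H continuous_powr_A continuous_powr_A, symmetric]
  by (simp add: powr_add)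

lemma power_zero: "fun_calc (\<lambda>t. t powr 0) A = e"
proof -
  have "fun_calc (\<lambda>t. t powr 0) A = fun_calc (\<lambda>t. 1) A"
    using spectrum_A by (intro fun_calc_cong[OF A_H continuous_powr_A]) force
  then show ?thesis using fun_calc_const[OF A_H, of 1] by simp
qed

lemma power_one: "fun_calc (\<lambda>t. t powr 1) A = A"
proof -
  have "fun_calc (\<lambda>t. t powr 1) A = fun_calc (\<lambda>t. t) A"
    using spectrum_A by (intro fun_calc_cong[OF A_H continuous_powr_A]) force
  then show ?thesis using fun_calc_id[OF A_H] by simp
qed

lemma root_mult: "R * R = A" "R * Q = e" "Q * R = e"
  unfolding root_A_def inv_root_A_def powers_mult using power_zero power_one by simp_all

lemma T_H: "T \<in> H"
  unfolding quotient_def by (intro quadratic_H root_H B_H)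

lemma root_conj: "x \<in> H \<Longrightarrow> R * (Q * x * Q) * R = x"
proof -
  assume x: "x \<in> H"
  have "R * (Q * x * Q) * R = (R * Q) * x * (Q * R)" by (simp only: mult.assoc)
  then show ?thesis using x by (simp add: root_mult)
qed

lemma inv_root_conj: "x \<in> H \<Longrightarrow> Q * (R * x * R) * Q = x"
proof -
  assume x: "x \<in> H"
  have "Q * (R * x * R) * Q = (Q * R) * x * (R * Q)" by (simp only: mult.assoc)
  then show ?thesis using x by (simp add: root_mult)
qed

lemma conj_inverse_pair:
  assumes "inverse_pair x y" "x \<in> H"
  shows "inverse_pair (R * x * R) (Q * y * Q)"
proof -
  note y = inverse_pairD[OF assms(1)]
  have "R * x * R * (Q * y * Q) = R * (x * (R * Q) * y) * Q"
    "Q * y * Q * (R * x * R) = Q * (y * (Q * R) * x) * R" by (simp_all only: mult.assoc)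
  then show ?thesis
    using y assms(2) root_H by (simp add: inverse_pair_def quadratic_H root_mult)
qed

lemma spectrum_T: "t \<in> spectrum T \<Longrightarrow> t > 0"
proof -
  assume t: "t \<in> spectrum T"
  have "pos T" unfolding quotient_def by (rule pos_conjugate[OF pos_B root_H(2)])
  then have "t \<ge> 0" using spectrum_pos t by blast
  obtain b where "inverse_pair B b" using inv_B invertible_iff[OF B_H] by blast
  note b = inverse_pairD[OF this]
  have "Q * B * Q * (R * b * R) = Q * (B * (Q * R) * b) * R"
    "R * b * R * (Q * B * Q) = R * (b * (R * Q) * B) * Q" by (simp_all only: mult.assoc)
  then have "inverse_pair T (R * b * R)"
    using b B_H root_H by (simp add: inverse_pair_def quotient_def quadratic_H root_mult)
  then have "0 \<notin> spectrum T" by (auto simp: not_in_spectrum_iff[OF T_H])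
  then show "t > 0" using t \<open>t \<ge> 0\<close> by (cases "t = 0") auto
qed

lemma conj_calc_const: "conj_calc (\<lambda>t. c) = c *\<^sub>R A"
  using root_H by (simp add: conj_calc_def fun_calc_const[OF T_H] root_mult)

lemma conj_calc_id: "conj_calc (\<lambda>t. t) = B"
  unfolding conj_calc_def fun_calc_id[OF T_H] using root_conj[OF B_H] by (simp add: quotient_def)

lemma conj_calc_scale:
  "continuous_on (spectrum T) f \<Longrightarrow> conj_calc (\<lambda>t. r * f t) = r *\<^sub>R conj_calc f"
  by (simp add: conj_calc_def fun_calc_scale[OF T_H])

lemma conj_calc_add:
  "continuous_on (spectrum T) f \<Longrightarrow> continuous_on (spectrum T) g \<Longrightarrow>
    conj_calc (\<lambda>t. f t + g t) = conj_calc f + conj_calc g"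
  by (simp add: conj_calc_def fun_calc_add[OF T_H] ring_distribs)

lemma conj_calc_diff:
  "continuous_on (spectrum T) f \<Longrightarrow> continuous_on (spectrum T) g \<Longrightarrow>
    conj_calc (\<lambda>t. f t - g t) = conj_calc f - conj_calc g"
  by (simp add: conj_calc_def fun_calc_diff[OF T_H] ring_distribs)

lemma conj_calc_mono:
  assumes f: "continuous_on (spectrum T) f" and g: "continuous_on (spectrum T) g"
    and le: "\<And>t. t \<in> spectrum T \<Longrightarrow> f t \<le> g t"
  shows "conj_calc f \<preceq> conj_calc g"
proof -
  have h: "continuous_on (spectrum T) (\<lambda>t. sqrt (g t - f t))"
    using f g by (intro continuous_intros)
  have "fun_calc (\<lambda>t. g t - f t) T = fun_calc (\<lambda>t. sqrt (g t - f t) * sqrt (g t - f t)) T"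
    using f g le by (intro fun_calc_cong[OF T_H] continuous_intros) auto
  also have "\<dots> = fun_calc (\<lambda>t. sqrt (g t - f t)) T * fun_calc (\<lambda>t. sqrt (g t - f t)) T"
    by (rule fun_calc_mult[OF T_H h h])
  finally have "conj_calc (\<lambda>t. g t - f t) = R * (fun_calc (\<lambda>t. sqrt (g t - f t)) T * fun_calc (\<lambda>t. sqrt (g t - f t)) T) * R"
    by (simp add: conj_calc_def)
  then have "pos (conj_calc (\<lambda>t. g t - f t))"
    using pos_conjugate[OF pos_square root_H(1)] fun_calc_value(1)[OF T_H h] by simp
  then show ?thesis by (simp add: le_def conj_calc_diff[OF g f])
qed

text \<open>The inverse of \<open>R * x * R\<close> is \<open>Q * y * Q\<close>, and the outer
  factors \<open>A = R * R\<close> cancel both \<open>Q\<close> with one \<open>R\<close> left on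
  each side. Thus the terms containing inverses are again of the form
  \<open>conj_calc\<close>.\<close>

lemma mult_inverse_conj_calc:
  assumes f: "continuous_on (spectrum T) f" and nz: "\<And>t. t \<in> spectrum T \<Longrightarrow> f t > 0"
  shows "A * inverse_of (conj_calc f) * A = conj_calc (\<lambda>t. 1 / f t)"
proof -
  define x y where "x = fun_calc f T" and "y = fun_calc (\<lambda>t. 1 / f t) T"
  have xH: "x \<in> H" unfolding x_def by (rule fun_calc_value(1)[OF T_H f])
  have pair: "inverse_pair x y"
    unfolding x_def y_def using nz by (intro fun_calc_inverse_pair[OF T_H f]) fastforce
  then have "inverse_of (conj_calc f) = Q * y * Q"
    unfolding conj_calc_def x_def[symmetric] using xH root_H
    by (intro inverse_of_eqI conj_inverse_pair quadratic_H)
  moreover have "(R * R) * (Q * y * Q) * (R * R) = R * (R * (Q * y * Q) * R) * R"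
    by (simp only: mult.assoc)
  ultimately have "A * inverse_of (conj_calc f) * A = R * (R * (Q * y * Q) * R) * R"
    by (simp only: root_mult(1))
  also have "\<dots> = R * y * R" using inverse_pairD(1)[OF pair] by (simp add: root_conj)
  finally show ?thesis by (simp add: conj_calc_def y_def)
qed

lemma conj_calc_powr: "conj_calc (\<lambda>t. t powr r) = geometric_mean A r B"
  and conj_calc_ln: "conj_calc ln = relative_entropy A B"
  by (simp_all add: conj_calc_def geometric_mean_def relative_entropy_def root_A_def inv_root_A_def
      quotient_def real_power_def log_of_def)

lemma continuous_T:
  "continuous_on (spectrum T) (\<lambda>t. t powr r)" "continuous_on (spectrum T) ln"
  "continuous_on (spectrum T) (\<lambda>t. 1 / t)"
  "c \<ge> 0 \<Longrightarrow> continuous_on (spectrum T) (\<lambda>t. 1 / (c + t))"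
  "c \<ge> 0 \<Longrightarrow> continuous_on (spectrum T) (\<lambda>t. 1 / (t powr r + c))"
  using spectrum_T by (force intro!: continuous_intros simp: add_pos_nonneg add_nonneg_eq_0_iff)+

lemma mult_inverse_means:
  "A * inverse_of B * A = conj_calc (\<lambda>t. 1 / t)"
  "A * inverse_of (A + B) * A = conj_calc (\<lambda>t. 1 / (1 + t))"
  "\<delta> > 0 \<Longrightarrow> A * inverse_of (\<delta> *\<^sub>R A + B) * A = conj_calc (\<lambda>t. 1 / (\<delta> + t))"
  "\<delta> > 0 \<Longrightarrow> A * inverse_of (geometric_mean A r B + \<delta> *\<^sub>R A) * A = conj_calc (\<lambda>t. 1 / (t powr r + \<delta>))"
proof -
  show "A * inverse_of B * A = conj_calc (\<lambda>t. 1 / t)"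
    using mult_inverse_conj_calc[of "\<lambda>t. t"] spectrum_T by (simp add: conj_calc_id)
  show shift: "A * inverse_of (\<delta> *\<^sub>R A + B) * A = conj_calc (\<lambda>t. 1 / (\<delta> + t))" if "\<delta> > 0" for \<delta>
    using mult_inverse_conj_calc[of "\<lambda>t. \<delta> + t"] spectrum_T that
    by (simp add: conj_calc_add conj_calc_id conj_calc_const add_pos_pos continuous_on_add)
  show "A * inverse_of (A + B) * A = conj_calc (\<lambda>t. 1 / (1 + t))" using shift[of 1] by simp
  show "A * inverse_of (geometric_mean A r B + \<delta> *\<^sub>R A) * A = conj_calc (\<lambda>t. 1 / (t powr r + \<delta>))"
    if "\<delta> > 0"
    using mult_inverse_conj_calc[of "\<lambda>t. t powr r + \<delta>"] spectrum_T that continuous_T(1)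
    by (simp add: conj_calc_add conj_calc_powr conj_calc_const add_nonneg_pos continuous_on_add)
qed

section \<open>From the scalar chains to the operator chains\<close>

context
  fixes \<delta> :: real assumes \<delta>: "\<delta> > 0"
begin

text \<open>The functions copy the bracketing of the operator terms, so linearity of
  \<open>conj_calc\<close> is enough, and they coincide literally with the terms of the scalar
  lemmas.\<close>

lemma bounds_conj_calc:
  "A - A * inverse_of B * A = conj_calc (\<lambda>t. 1 - 1 / t)"
  "2 *\<^sub>R (A - 2 *\<^sub>R (A * inverse_of (A + B) * A)) = conj_calc (\<lambda>t. 2 * (1 - 2 * (1 / (1 + t))))"
  "ln \<delta> *\<^sub>R A + 2 *\<^sub>R (A - (2 * \<delta>) *\<^sub>R (A * inverse_of (\<delta> *\<^sub>R A + B) * A))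
    = conj_calc (\<lambda>t. ln \<delta> + 2 * (1 - (2 * \<delta>) * (1 / (\<delta> + t))))"
  "(ln \<delta> + 4) *\<^sub>R A
      - (8 * sqrt \<delta>) *\<^sub>R (A * inverse_of (geometric_mean A (1/2) B + sqrt \<delta> *\<^sub>R A) * A)
    = conj_calc (\<lambda>t. (ln \<delta> + 4) - (8 * sqrt \<delta>) * (1 / (t powr (1/2) + sqrt \<delta>)))"
  "relative_entropy A B = conj_calc ln"
  "((1 / sqrt \<delta>) *\<^sub>R geometric_mean A (1/2) B - sqrt \<delta> *\<^sub>R geometric_mean A (-1/2) B) + ln \<delta> *\<^sub>R A
    = conj_calc (\<lambda>t. ((1 / sqrt \<delta>) * t powr (1/2) - sqrt \<delta> * t powr (-1/2)) + ln \<delta>)"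
  "(1/2) *\<^sub>R ((1 / \<delta>) *\<^sub>R B - \<delta> *\<^sub>R (A * inverse_of B * A)) + ln \<delta> *\<^sub>R A
    = conj_calc (\<lambda>t. 1/2 * ((1 / \<delta>) * t - \<delta> * (1 / t)) + ln \<delta>)"
  "(1/2) *\<^sub>R (B - A * inverse_of B * A) = conj_calc (\<lambda>t. 1/2 * (t - 1 / t))"
  "B - A = conj_calc (\<lambda>t. t - 1)"
  using \<delta>
  by (simp_all only: mult_inverse_means conj_calc_add conj_calc_diff conj_calc_scale conj_calc_const
      conj_calc_id conj_calc_powr conj_calc_ln continuous_T continuous_on_add continuous_on_diff
      continuous_on_mult continuous_on_const continuous_on_id real_sqrt_gt_zero less_imp_le zero_le_one
      real_sqrt_ge_zero scaleR_one)

lemma bounds_continuous: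
  "continuous_on (spectrum T) (\<lambda>t. 1 - 1 / t)"
  "continuous_on (spectrum T) (\<lambda>t. 2 * (1 - 2 * (1 / (1 + t))))"
  "continuous_on (spectrum T) (\<lambda>t. ln \<delta> + 2 * (1 - (2 * \<delta>) * (1 / (\<delta> + t))))"
  "continuous_on (spectrum T) (\<lambda>t. (ln \<delta> + 4) - (8 * sqrt \<delta>) * (1 / (t powr (1/2) + sqrt \<delta>)))"
  "continuous_on (spectrum T) (\<lambda>t. ((1 / sqrt \<delta>) * t powr (1/2) - sqrt \<delta> * t powr (-1/2)) + ln \<delta>)"
  "continuous_on (spectrum T) (\<lambda>t. 1/2 * ((1 / \<delta>) * t - \<delta> * (1 / t)) + ln \<delta>)"
  "continuous_on (spectrum T) (\<lambda>t. 1/2 * (t - 1 / t))"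
  "continuous_on (spectrum T) (\<lambda>t. t - 1)"
  using \<delta> by (intro continuous_on_add continuous_on_diff continuous_on_const continuous_on_id
      continuous_on_mult continuous_T; simp)+

end

text \<open>Conjugation by \<open>Q\<close> sends \<open>A\<close> to \<open>e\<close> and
  \<open>B\<close> to \<open>T\<close>, so the hypothesis becomes positivity of \<open>T\<close>
  minus a multiple of \<open>e\<close>.\<close>

lemma spectrum_T_ge:
  assumes "\<delta> *\<^sub>R A \<preceq> B" "t \<in> spectrum T" shows "\<delta> \<le> t"
proof -
  have "pos (Q * (B - \<delta> *\<^sub>R A) * Q)" using assms pos_conjugate root_H unfolding le_def by blast
  also have "Q * A * Q = e"
    using inv_root_conj[OF e_H] root_H by (simp add: root_mult)
  then have "Q * (B - \<delta> *\<^sub>R A) * Q = T - \<delta> *\<^sub>R e" by (simp add: quotient_def ring_distribs)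
  finally have "pos (T - \<delta> *\<^sub>R e)" .
  then show ?thesis using spectrum_pos[of "T - \<delta> *\<^sub>R e" "t - \<delta>"] assms(2) by (simp add: spectrum_shift)
qed

lemma spectrum_T_le:
  assumes "B \<preceq> \<delta> *\<^sub>R A" "t \<in> spectrum T" shows "t \<le> \<delta>"
proof (rule ccontr)
  assume "\<not> t \<le> \<delta>"
  have "pos (Q * (\<delta> *\<^sub>R A - B) * Q)" using assms pos_conjugate root_H unfolding le_def by blast
  also have "Q * A * Q = e"
    using inv_root_conj[OF e_H] root_H by (simp add: root_mult)
  then have "Q * (\<delta> *\<^sub>R A - B) * Q = \<delta> *\<^sub>R e - T" by (simp add: quotient_def ring_distribs)
  finally have "pos (\<delta> *\<^sub>R e - T)" .
  \<comment> \<open>For \<open>t > \<delta>\<close> the element \<open>T - t e\<close> is, up to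
    sign, a positive element plus a positive multiple of \<open>e\<close>.\<close>
  then have "invertible_element (\<delta> *\<^sub>R e - T + (t - \<delta>) *\<^sub>R e)"
    using pos_shift_invertible \<open>\<not> t \<le> \<delta>\<close> by simp
  also have "\<delta> *\<^sub>R e - T + (t - \<delta>) *\<^sub>R e = (-1) *\<^sub>R (T - t *\<^sub>R e)" by (simp add: algebra_simps)
  finally obtain b where "inverse_pair ((-1) *\<^sub>R (T - t *\<^sub>R e)) b"
    using invertible_iff[of "(-1) *\<^sub>R (T - t *\<^sub>R e)"] T_H by (auto simp: H_intros simp del: scaleR_minus1_left)
  from inverse_pair_scale[OF this, of "-1"] have "t \<notin> spectrum T"
    by (auto simp: not_in_spectrum_iff[OF T_H])
  with assms(2) show False by simp
qed

lemma entropy_bounds_ge: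
  assumes \<delta>: "1 \<le> \<delta>" and le: "\<delta> *\<^sub>R A \<preceq> B"
  shows "entropy_bounds_ge_1 \<delta> A B"
proof -
  have pos: "\<delta> > 0" using \<delta> by simp
  have t: "t > 0" "\<delta> \<le> t" if "t \<in> spectrum T" for t
    using that spectrum_T spectrum_T_ge[OF le] by auto
  \<comment> \<open>The bounds free of \<delta> are the members with parameter 1 of the two families
    in \<open>scalar_mono_delta\<close>, which is therefore used between 1 and \<delta>.\<close>
  show ?thesis
    unfolding entropy_bounds_ge_1_def bounds_conj_calc[OF pos]
    using t pos \<delta> scalar_mono_delta[of _ 1 \<delta>]
    by (intro conjI conj_calc_mono bounds_continuous[OF pos] continuous_T scalar_harmonic_le scalar_arithmetic_le
        scalar_chain_ge) auto
qed

lemma entropy_bounds_le: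
  assumes \<delta>: "0 < \<delta>" "\<delta> \<le> 1" and le: "B \<preceq> \<delta> *\<^sub>R A"
  shows "entropy_bounds_le_1 \<delta> A B"
proof -
  have t: "t > 0" "t \<le> \<delta>" if "t \<in> spectrum T" for t
    using that spectrum_T spectrum_T_le[OF le] by auto
  show ?thesis
    unfolding entropy_bounds_le_1_def bounds_conj_calc[OF \<delta>(1)]
    using t \<delta> scalar_mono_delta[of _ \<delta> 1]
    by (intro conjI conj_calc_mono bounds_continuous[OF \<delta>(1)] continuous_T scalar_harmonic_le scalar_arithmetic_le
        scalar_chain_le) auto
qed

end

section \<open>C*-algebras and real C*-algebras\<close>

context selfadjoint_part
begin

lemma spectrum_square_nonneg:
  assumes "x \<in> H" "t \<in> spectrum (x * x)" shows "t \<ge> 0"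
proof (rule ccontr)
  assume "\<not> t \<ge> 0"
  then obtain b where "inverse_pair ((- t) *\<^sub>R e + x * x) b"
    using invertible_quadratic[of x "- t"] assms by auto
  then have "t \<notin> spectrum (x * x)" using not_in_spectrum_iff[of "x * x" t] assms(1) by (auto simp: square_H)
  with assms show False by simp
qed

lemma norm_shift_le:
  assumes a: "a \<in> H" and "\<And>t. t \<in> spectrum a \<Longrightarrow> t \<ge> 0"
  shows "norm (norm a *\<^sub>R e - a) \<le> norm a"
proof -
  have "fun_calc (\<lambda>t. norm a - t) a = norm a *\<^sub>R e - a"
    by (simp add: fun_calc_diff fun_calc_const fun_calc_id a)
  moreover have "continuous_on (spectrum a) (\<lambda>t. norm a - t)" by (intro continuous_intros)
  moreover have "\<bar>norm a - t\<bar> \<le> norm a" if "t \<in> spectrum a" for t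
    using spectrum_bound[OF a that] assms(2)[OF that] by simp
  ultimately show ?thesis using norm_fun_calc_le_iff[OF a _ norm_ge_zero, of "\<lambda>t. norm a - t" a] by simp
qed

text \<open>Spectra of noncommuting elements do not add, but norms do: nonnegativity becomes
  \<open>norm (norm a *\<^sub>R e - a) \<le> norm a\<close>, the triangle inequality adds two such
  bounds, and the Neumann series returns to the spectrum.\<close>

lemma spectrum_add_nonneg:
  assumes a: "a \<in> H" "\<And>t. t \<in> spectrum a \<Longrightarrow> t \<ge> 0" and b: "b \<in> H" "\<And>t. t \<in> spectrum b \<Longrightarrow> t \<ge> 0"
    and t: "t \<in> spectrum (a + b)"
  shows "t \<ge> 0"
proof (rule ccontr)
  assume neg: "\<not> t \<ge> 0"
  define M where "M = norm a + norm b"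
  have eq: "M *\<^sub>R e - (a + b) = (norm a *\<^sub>R e - a) + (norm b *\<^sub>R e - b)"
    by (simp add: M_def scaleR_left_distrib)
  have "norm (M *\<^sub>R e - (a + b)) \<le> M"
    unfolding eq unfolding M_def
    by (intro norm_triangle_mono norm_shift_le a b)
  moreover have "M \<ge> 0" by (simp add: M_def)
  ultimately have "norm (M *\<^sub>R e - (a + b)) < \<bar>M - t\<bar>" using neg by linarith
  then obtain c where "inverse_pair ((M - t) *\<^sub>R e - (M *\<^sub>R e - (a + b))) c"
    using neumann_scale[of "M *\<^sub>R e - (a + b)" "M - t"] a b by (auto simp: H_intros)
  also have "(M - t) *\<^sub>R e - (M *\<^sub>R e - (a + b)) = a + b - t *\<^sub>R e" by (simp add: algebra_simps)
  finally have "t \<notin> spectrum (a + b)" using not_in_spectrum_iff[of "a + b" t] a b by (auto simp: add_H)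
  with t show False by simp
qed

end

section \<open>The self-adjoint part of an algebra with involution\<close>

lemma star_zero [simp]: "star (0::'a::banach_star_algebra) = 0"
  using star_add[of 0 "0::'a"] by simp

lemma star_minus: "star (- x) = - star (x::'a::banach_star_algebra)"
  using star_scaleR[of "-1" x] by simp

lemma star_diff: "star (x - y) = star x - star (y::'a::banach_star_algebra)"
  using star_add[of x "- y"] by (simp add: star_minus)

lemma norm_star: "norm (star x) = norm (x::'a::banach_star_algebra)"
proof -
  have "norm y \<le> norm (star y)" for y :: 'a
  proof (cases "y = 0")
    case False
    have "norm y * norm y \<le> norm (star y) * norm y"
      using cstar_identity[of y] norm_mult_ineq[of "star y" y] by (simp add: power2_eq_square)
    then show ?thesis using False by simp
  qed simp
  from this[of x] this[of "star x"] show ?thesis by (simp add: star_star)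
qed

lemma star_unit:
  assumes "unit_element (e::'a::banach_star_algebra)" shows "star e = e"
proof -
  have "star (star e * e) = star e * e" by (simp add: star_mult star_star)
  then show ?thesis using assms by (simp add: unit_element_def star_star)
qed

lemmas star_simps = star_star star_add star_diff star_minus star_scaleR star_mult

lemma jordan_part_star:
  fixes e :: "'a::banach_star_algebra"
  assumes e: "unit_element e"
  shows "jordan_part UNIV e {x. star x = x}"
proof
  show "subspace {x::'a. star x = x}"
    by (simp add: subspace_def star_add star_scaleR)
  have "bounded_linear (star :: 'a \<Rightarrow> 'a)"
    by (rule bounded_linear_intro[of _ 1]) (simp_all add: star_add star_scaleR norm_star)
  then have "closed {x::'a. star x = x}"
    by (intro closed_Collect_eq continuous_on_id) (simp add: linear_continuous_on)
  then show "complete {x::'a. star x = x}" by (simp add: complete_eq_closed)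
  show "norm (x * x) = (norm x)\<^sup>2" if "x \<in> {x. star x = x}" for x :: 'a
    using that cstar_identity[of x] by simp
  show "b \<in> {x. star x = x}" if x: "x \<in> {x. star x = x}" and b: "x * b = e" "b * x = e" for x b
  proof -
    have "star b * x = e" using arg_cong[OF b(1), of star] x by (simp add: star_mult star_unit[OF e])
    then have "star b * x * b = b" using e by (simp add: unit_element_def)
    moreover have "star b * (x * b) = star b" using b e by (simp add: unit_element_def)
    ultimately show ?thesis by (simp add: mult.assoc)
  qed
qed (use e star_unit in \<open>auto simp: unit_element_def star_mult mult.assoc\<close>)

text \<open>Real and complex C*-algebras share this; the premise on \<open>star x * x\<close> is
  immediate from the axiom in the real case and the main difficulty in the complex case.\<close>

lemma positive_cone_star:
  fixes e :: "'a::banach_star_algebra"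
  assumes e: "unit_element e"
    and inv: "\<And>(x::'a) t. t > 0 \<Longrightarrow> unital_operator_algebra.invertible_element UNIV e (star x * x + t *\<^sub>R e)"
  shows "positive_cone UNIV e positive_element {x. star x = x}"
proof -
  interpret jordan_part UNIV e positive_element "{x. star x = x}" by (rule jordan_part_star[OF e])
  show ?thesis
  proof
    show "invertible_element (e + x * x)" if "x \<in> {x. star x = x}" for x
      using inv[of 1 x] that by (simp add: add.commute)
    show "z \<in> {x. star x = x}" if "positive_element z" for z
      using that by (auto simp: positive_element_def star_mult star_star)
    show "positive_element (y * z * y)" if z: "positive_element z" and y: "y \<in> {x. star x = x}" for y z
    proof -
      obtain w where "z = star w * w" using z by (auto simp: positive_element_def)
      then have "y * z * y = star (w * y) * (w * y)" using y by (simp add: star_mult mult.assoc)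
      then show ?thesis by (auto simp: positive_element_def)
    qed
    show "positive_element (x * x)" if "x \<in> {x. star x = x}" for x
      using that by (auto simp: positive_element_def intro: exI[of _ x])
    show "invertible_element (z + t *\<^sub>R e)" if "positive_element z" "t > 0" for z t
      using that inv by (auto simp: positive_element_def)
  qed
qed

text \<open>The axiom supplies a quasi-inverse \<open>y\<close>: with a unit present,
  \<open>e + y\<close> inverts \<open>c + e\<close>. Scaling \<open>x\<close> by
  \<open>1 / sqrt t\<close> reduces a general \<open>t\<close> to this.\<close>

lemma positive_cone_real_cstar:
  fixes e :: "'a::real_cstar_algebra"
  assumes e: "unit_element e"
  shows "positive_cone UNIV e positive_element {x. star x = x}"
proof (rule positive_cone_star[OF e])
  fix x :: 'a and t :: real assume t: "t > 0"
  define x' where "x' = (1 / sqrt t) *\<^sub>R x"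
  define c where "c = star x' * x'"
  obtain y where y: "c + y + c * y = 0" "c + y + y * c = 0"
    using one_plus_star_mult_self_invertible[of x'] by (auto simp: c_def)
  have "star x * x = t *\<^sub>R c" using t by (simp add: c_def x'_def star_scaleR)
  then have "star x * x + t *\<^sub>R e = t *\<^sub>R (c + e)" by (simp add: scaleR_add_right)
  moreover have "(c + e) * (e + y) = (c + y + c * y) + e" "(e + y) * (c + e) = (c + y + y * c) + e"
    using e by (simp_all add: unit_element_def algebra_simps)
  ultimately have "(star x * x + t *\<^sub>R e) * ((1/t) *\<^sub>R (e + y)) = e"
    "((1/t) *\<^sub>R (e + y)) * (star x * x + t *\<^sub>R e) = e"
    using t y by simp_all
  then show "unital_operator_algebra.invertible_element UNIV e (star x * x + t *\<^sub>R e)"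
    unfolding unital_operator_algebra.invertible_element_def by blast
qed

text \<open>
  Arens' trick: the C*-identity bounds \<open>x - i s\<close> by the square root of \<open>\<parallel>x\<parallel>\<^sup>2 + s\<^sup>2\<close>, which is less
  than \<open>1 + s\<close> for large \<open>s\<close>, so that \<open>x + i = (x - i s) + i (1 + s)\<close> is invertible.
\<close>

lemma selfadjoint_invertible_one_minus_i:
  fixes e x :: "'a::cstar_algebra"
  assumes e: "unit_element e" and x: "star x = x"
  shows "\<exists>z. (e - \<i> *\<^sub>C x) * z = e \<and> z * (e - \<i> *\<^sub>C x) = e"
proof -
  have eu: "e * y = y" "y * e = y" for y using e by (simp_all add: unit_element_def)
  \<comment> \<open>For this \<open>s\<close> the square of \<open>norm u\<close> is at most
    \<open>s + s^2\<close>, which is less than \<open>(1 + s)^2\<close>.\<close>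
  define s where "s = (norm x)\<^sup>2"
  have s: "s \<ge> 0" by (simp add: s_def)
  define u where "u = x - (\<i> * complex_of_real s) *\<^sub>C e"
  have one: "1 *\<^sub>C y = y" for y :: 'a using scaleC_of_real[of 1 y] by simp
  have minus: "(- c) *\<^sub>C y = - (c *\<^sub>C y)" for c and y :: 'a
    using scaleC_add_left[of c "- c" y] scaleC_of_real[of 0 y] by (simp add: eq_neg_iff_add_eq_0 add.commute)
  have "star u * u = (x + (\<i> * complex_of_real s) *\<^sub>C e) * (x - (\<i> * complex_of_real s) *\<^sub>C e)"
    by (simp add: u_def star_diff x star_scaleC star_unit[OF e] minus)
  also have "\<dots> = x * x - ((\<i> * complex_of_real s) * (\<i> * complex_of_real s)) *\<^sub>C e"
    by (simp add: ring_distribs mult_scaleC_left mult_scaleC_right scaleC_diff_right scaleC_add_right eu scaleC_scaleC)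
  also have "(\<i> * complex_of_real s) * (\<i> * complex_of_real s) = complex_of_real (- (s\<^sup>2))"
    by (simp add: power2_eq_square complex_eq_iff)
  finally have "star u * u = x * x + s\<^sup>2 *\<^sub>R e" unfolding scaleC_of_real by simp
  then have "(norm u)\<^sup>2 = norm (x * x + s\<^sup>2 *\<^sub>R e)" using cstar_identity[of u] by simp
  also have "\<dots> \<le> norm (x * x) + s\<^sup>2 * norm e" by (rule norm_triangle_le) simp
  also have "\<dots> \<le> s + s\<^sup>2 * 1"
    using cstar_identity[of x] jordan_part.norm_e_le[OF jordan_part_star[OF e]]
    by (intro add_mono mult_left_mono) (simp_all add: x s_def)
  also have "\<dots> < (1 + s)\<^sup>2" using s by (simp add: power2_eq_square algebra_simps)
  finally have nu: "norm u < 1 + s" using s by (simp add: power_less_imp_less_base)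
  \<comment> \<open>Chosen so that \<open>e - w\<close> is \<open>e - \<i> x\<close> divided by
    \<open>1 + s\<close>, while \<open>norm w < 1\<close>.\<close>
  define w where "w = (\<i> / complex_of_real (1 + s)) *\<^sub>C u"
  have "cmod (\<i> / complex_of_real (1 + s)) = 1 / (1 + s)"
    using s by (simp only: norm_divide norm_ii norm_of_real abs_of_nonneg add_nonneg_nonneg zero_le_one)
  then have "norm w = norm u / (1 + s)" by (simp add: w_def norm_scaleC)
  then have "norm w < 1" using nu s by simp
  define K where "K = {z. w * z = z * w}"
  have "closed K" unfolding K_def by (intro closed_Collect_eq continuous_intros)
  then have "complete K" by (simp add: complete_eq_closed)
  moreover have "e \<in> K" by (simp add: K_def eu)
  moreover have "e + w * z \<in> K" if "z \<in> K" for z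
    using that by (auto simp: K_def ring_distribs eu) (metis mult.assoc)
  ultimately obtain z where z: "z \<in> K" "e + w * z = z"
    using geometric_fixpoint[of K w e] \<open>norm w < 1\<close> by blast
  have "w = (\<i> / complex_of_real (1 + s)) *\<^sub>C x + (s / (1 + s)) *\<^sub>R e"
  proof -
    have "(\<i> / complex_of_real (1 + s)) * (\<i> * complex_of_real s) = complex_of_real (- (s / (1 + s)))"
      by (simp add: complex_eq_iff)
    then show ?thesis unfolding w_def u_def scaleC_diff_right scaleC_scaleC by (simp only: scaleC_of_real) simp
  qed
  moreover have "\<i> / complex_of_real (1 + s) = complex_of_real (1 / (1 + s)) * \<i>" by simp
  ultimately have "w = (1 / (1 + s)) *\<^sub>R (\<i> *\<^sub>C x) + (s / (1 + s)) *\<^sub>R e"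
    by (simp only: scaleC_of_real flip: scaleC_scaleC)
  moreover have "e = (1 / (1 + s)) *\<^sub>R e + (s / (1 + s)) *\<^sub>R e"
    using s by (simp flip: scaleR_add_left add_divide_distrib)
  ultimately have "e - w = (1 / (1 + s)) *\<^sub>R (e - \<i> *\<^sub>C x)"
    by (metis (no_types, lifting) add_diff_cancel_right scaleR_diff_right)
  then have E: "e - \<i> *\<^sub>C x = (1 + s) *\<^sub>R (e - w)" using s by simp
  have "(e - w) * z = e" "z * (e - w) = e"
    using z by (simp_all add: K_def ring_distribs eu) (metis add_diff_cancel_right')+
  then have "(e - \<i> *\<^sub>C x) * ((1 / (1 + s)) *\<^sub>R z) = e" "((1 / (1 + s)) *\<^sub>R z) * (e - \<i> *\<^sub>C x) = e"
    unfolding E using s by simp_all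
  then show ?thesis by blast
qed

text \<open>\<open>e + x * x\<close> factors into \<open>e - \<i> x\<close> and
  \<open>e + \<i> x\<close>; the second factor is the first one for \<open>- x\<close>.\<close>

lemma selfadjoint_part_cstar:
  fixes e :: "'a::cstar_algebra"
  assumes e: "unit_element e"
  shows "selfadjoint_part UNIV e {x. star x = x}"
proof -
  interpret jordan_part UNIV e positive_element "{x. star x = x}" by (rule jordan_part_star[OF e])
  show ?thesis
  proof
    fix x :: 'a assume "x \<in> {x. star x = x}"
    then have x: "star x = x" by simp
    have eu: "e * y = y" "y * e = y" for y using e by (simp_all add: unit_element_def)
    have neg: "\<i> *\<^sub>C (- x) = - (\<i> *\<^sub>C x)"
      using scaleC_add_right[of \<i> x "- x"] scaleC_add_right[of \<i> 0 "0::'a"]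
      by (simp add: eq_neg_iff_add_eq_0 add.commute)
    obtain z where z: "(e - \<i> *\<^sub>C x) * z = e" "z * (e - \<i> *\<^sub>C x) = e"
      using selfadjoint_invertible_one_minus_i[OF e x] by blast
    obtain z' where z': "(e + \<i> *\<^sub>C x) * z' = e" "z' * (e + \<i> *\<^sub>C x) = e"
      using selfadjoint_invertible_one_minus_i[OF e, of "- x"] x by (auto simp: star_minus neg)
    have "\<i> *\<^sub>C \<i> *\<^sub>C (x * x) = - (x * x)"
      using scaleC_scaleC[of \<i> \<i> "x * x"] scaleC_of_real[of "-1" "x * x"] by simp
    then have fac: "e + x * x = (e - \<i> *\<^sub>C x) * (e + \<i> *\<^sub>C x)"
      by (simp add: ring_distribs eu mult_scaleC_left mult_scaleC_right scaleC_diff_right)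
    have "(e + x * x) * (z' * z) = (e - \<i> *\<^sub>C x) * ((e + \<i> *\<^sub>C x) * z') * z"
      "z' * z * (e + x * x) = z' * (z * (e - \<i> *\<^sub>C x)) * (e + \<i> *\<^sub>C x)"
      unfolding fac by (simp_all only: mult.assoc)
    then have "(e + x * x) * (z' * z) = e" "z' * z * (e + x * x) = e" using z z' by (simp_all add: eu)
    then show "invertible_element (e + x * x)" unfolding invertible_element_def by blast
  qed
qed

text \<open>Here \<open>y = p - \<i> q\<close>. The mixed terms have opposite signs in
  \<open>y * star y\<close> and \<open>star y * y\<close>, so the sum is a sum of squares even
  before either summand is known to be positive.\<close>

lemma cartesian_decomposition:
  fixes y :: "'a::cstar_algebra"
  obtains p q where "star p = p" "star q = q" "y * star y + star y * y = 2 *\<^sub>R (p * p + q * q)"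
proof -
  define p where "p = (1/2) *\<^sub>R (y + star y)"
  define q where "q = (1/2) *\<^sub>R (\<i> *\<^sub>C (y - star y))"
  have minus: "(- c) *\<^sub>C x = - (c *\<^sub>C x)" "c *\<^sub>C (- x) = - (c *\<^sub>C x)" for c and x :: 'a
    using scaleC_add_left[of c "- c" x] scaleC_of_real[of 0 x] scaleC_add_right[of c x "- x"]
    by (simp_all add: eq_neg_iff_add_eq_0 add.commute)
  have ii: "\<i> *\<^sub>C \<i> *\<^sub>C x = - x" for x :: 'a
    using scaleC_scaleC[of \<i> \<i> x] scaleC_of_real[of "-1" x] by simp
  have p: "star p = p" by (simp add: p_def star_simps add.commute)
  have q: "star q = q"
    using minus(2)[of \<i> "y - star y"] by (simp add: q_def star_simps star_scaleC minus(1))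
  have "q * q = (1/4) *\<^sub>R (- ((y - star y) * (y - star y)))"
    by (simp add: q_def mult_scaleC_left mult_scaleC_right scaleC_scaleR_commute ii)
  moreover have "p * p = (1/4) *\<^sub>R ((y + star y) * (y + star y))" by (simp add: p_def)
  moreover have "(y + star y) * (y + star y) - (y - star y) * (y - star y) = 2 *\<^sub>R (y * star y + star y * y)"
    by (simp add: ring_distribs scaleR_2)
  ultimately have "p * p + q * q = (1/2) *\<^sub>R (y * star y + star y * y)"
    by (simp flip: scaleR_diff_right)
  then show thesis using that[OF p q] by simp
qed

text \<open>The classical formula: if \<open>b\<close> inverts \<open>x * y - t e\<close>, then
  \<open>(y * b * x - e) / t\<close> inverts \<open>y * x - t e\<close>.\<close>

lemma invertible_mult_swap:
  fixes x y e b :: "'a::real_normed_algebra"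
  assumes e: "unit_element e" and "t \<noteq> 0"
    and b: "(x * y - t *\<^sub>R e) * b = e" "b * (x * y - t *\<^sub>R e) = e"
  shows "\<exists>c. (y * x - t *\<^sub>R e) * c = e \<and> c * (y * x - t *\<^sub>R e) = e"
proof -
  have eu: "e * z = z" "z * e = z" for z using e by (simp_all add: unit_element_def)
  have b': "x * (y * b) = e + t *\<^sub>R b" "b * (x * y) = e + t *\<^sub>R b"
    using b by (simp_all add: ring_distribs eu algebra_simps)
  then have b'': "x * (y * (b * z)) = z + t *\<^sub>R (b * z)" "b * (x * (y * z)) = z + t *\<^sub>R (b * z)" for z
    by (metis (no_types, lifting) distrib_right eu(1) mult.assoc mult_scaleR_left)+
  define c where "c = (1/t) *\<^sub>R (y * b * x - e)"
  have "(y * x - t *\<^sub>R e) * (y * b * x - e) = t *\<^sub>R e" "(y * b * x - e) * (y * x - t *\<^sub>R e) = t *\<^sub>R e"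
    by (simp_all add: ring_distribs scaleR_diff_right eu mult.assoc b'')
  then have "(y * x - t *\<^sub>R e) * c = e \<and> c * (y * x - t *\<^sub>R e) = e"
    using \<open>t \<noteq> 0\<close> by (simp add: c_def)
  then show ?thesis ..
qed

text \<open>
  With \<open>n\<close> the negative part of \<open>z = w\<^sup>*w\<close> and \<open>y = w n\<close> we have \<open>y\<^sup>*y = - n\<^sup>3 = - k\<^sup>2\<close>, so that
  \<open>y y\<^sup>*\<close> is a sum of squares.  Since \<open>y y\<^sup>*\<close> and \<open>y\<^sup>*y\<close> have the same spectrum up to \<open>0\<close>, the spectra
  of both \<open>k\<^sup>2\<close> and \<open>- k\<^sup>2\<close> are nonnegative, hence \<open>k = 0\<close>.
\<close>

lemma spectrum_star_mult_self_nonneg: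
  fixes e w :: "'a::cstar_algebra"
  assumes e: "unit_element e" and t: "t \<in> unital_operator_algebra.spectrum UNIV e (star w * w)"
  shows "t \<ge> 0"
proof -
  interpret selfadjoint_part UNIV e positive_element "{x. star x = x}"
    by (rule selfadjoint_part_cstar[OF e])
  define z where "z = star w * w"
  have z: "z \<in> {x. star x = x}" by (simp add: z_def star_mult star_star)
  define f where "f t = max (- t) 0" for t :: real
  \<comment> \<open>The power 3/2 of the negative part, so that \<open>f t * t * f t\<close> is
    minus the square of \<open>g t\<close>.\<close>
  define g where "g t = f t * sqrt (f t)" for t
  have f: "continuous_on (spectrum z) f" and g: "continuous_on (spectrum z) g"
    unfolding f_def g_def by (intro continuous_intros)+
  define n k where "n = fun_calc f z" and "k = fun_calc g z"
  have n: "star n = n" and k: "k \<in> {x. star x = x}"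
    using fun_calc_value(1)[OF z f] fun_calc_value(1)[OF z g] by (simp_all add: n_def k_def)
  define y where "y = w * n"
  have id: "continuous_on (spectrum z) (\<lambda>t. t)" by (rule continuous_on_id)
  have gg: "f t * t * f t = (-1) * (g t * g t)" for t
  proof -
    have "f t * t = - (f t * f t)" "sqrt (f t) * sqrt (f t) = f t" by (simp_all add: f_def max_def)
    then show ?thesis by (simp add: g_def)
  qed
  have "star y * y = n * z * n" by (simp add: y_def star_mult n z_def mult.assoc)
  also have "\<dots> = fun_calc (\<lambda>t. f t * t * f t) z"
    unfolding n_def fun_calc_mult[OF z continuous_on_mult[OF f id] f] fun_calc_mult[OF z f id]
    by (simp only: fun_calc_id[OF z])
  also have "\<dots> = - (k * k)"
    unfolding gg k_def fun_calc_scale[OF z continuous_on_mult[OF g g]] fun_calc_mult[OF z g g] by simp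
  finally have yy: "star y * y = - (k * k)" .
  obtain p q where pq: "star p = p" "star q = q" "y * star y + star y * y = 2 *\<^sub>R (p * p + q * q)"
    by (rule cartesian_decomposition)
  define p' q' where "p' = sqrt 2 *\<^sub>R p" and "q' = sqrt 2 *\<^sub>R q"
  have eq: "y * star y = (p' * p' + q' * q') + k * k"
    using pq(3) by (simp add: yy p'_def q'_def scaleR_add_right algebra_simps)
  have pq': "p' \<in> {x. star x = x}" "q' \<in> {x. star x = x}"
    using pq by (simp_all add: p'_def q'_def star_scaleR)
  have pq'_nonneg: "s \<ge> 0" if "s \<in> spectrum (p' * p' + q' * q')" for s
    by (rule spectrum_add_nonneg[OF square_H[OF pq'(1)] spectrum_square_nonneg[OF pq'(1)]
          square_H[OF pq'(2)] spectrum_square_nonneg[OF pq'(2)] that])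
  have ys: "s \<ge> 0" if "s \<in> spectrum (y * star y)" for s
    by (rule spectrum_add_nonneg[OF add_H[OF square_H[OF pq'(1)] square_H[OF pq'(2)]] pq'_nonneg
          square_H[OF k] spectrum_square_nonneg[OF k] that[unfolded eq]])
  have sy: "s \<ge> 0" if s: "s \<in> spectrum (- (k * k))" for s
  proof (rule ccontr)
    assume "\<not> s \<ge> 0"
    then have "s \<notin> spectrum (y * star y)" "s \<noteq> 0" using ys by auto
    then obtain b where "(y * star y - s *\<^sub>R e) * b = e" "b * (y * star y - s *\<^sub>R e) = e"
      by (auto simp: spectrum_def invertible_element_def)
    from invertible_mult_swap[OF e \<open>s \<noteq> 0\<close> this] have "s \<notin> spectrum (star y * y)"
      by (auto simp: spectrum_def invertible_element_def)
    then show False using s by (simp add: yy)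
  qed
  have "k * k = 0"
  proof (rule ccontr)
    assume kk: "k * k \<noteq> 0"
    \<comment> \<open>The spectral radius puts \<open>norm (k * k)\<close> into the spectrum of
      \<open>k * k\<close>, its negative being excluded; then \<open>- (k * k)\<close> would have a
      negative spectral point.\<close>
    then have "norm (k * k) \<in> spectrum (k * k)"
      using spectral_radius[OF square_H[OF k]] spectrum_square_nonneg[OF k, of "- norm (k * k)"] by auto
    moreover have "- norm (k * k) \<notin> spectrum (- (k * k))" using sy[of "- norm (k * k)"] kk by auto
    then obtain b where b: "inverse_pair (- (k * k) - (- norm (k * k)) *\<^sub>R e) b"
      using not_in_spectrum_iff[of "- (k * k)" "- norm (k * k)"] k by (auto simp: star_minus star_mult)
    from inverse_pair_scale[OF b, of "-1"] have "norm (k * k) \<notin> spectrum (k * k)"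
      using not_in_spectrum_iff[OF square_H[OF k], of "norm (k * k)"] by auto
    ultimately show False by simp
  qed
  then have "norm k \<le> 0" using norm_square[OF k] by simp
  then have "g t = 0"
    using norm_fun_calc_le_iff[OF z g, of 0] t unfolding k_def z_def by auto
  then show ?thesis by (auto simp: g_def f_def max_def split: if_splits)
qed

lemma positive_cone_cstar:
  fixes e :: "'a::cstar_algebra"
  assumes e: "unit_element e"
  shows "positive_cone UNIV e positive_element {x. star x = x}"
proof (rule positive_cone_star[OF e])
  fix x :: 'a and t :: real assume "t > 0"
  then have "- t \<notin> unital_operator_algebra.spectrum UNIV e (star x * x)"
    using spectrum_star_mult_self_nonneg[OF e, of "- t" x] by auto
  then show "unital_operator_algebra.invertible_element UNIV e (star x * x + t *\<^sub>R e)"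
    by (simp add: unital_operator_algebra.spectrum_def)
qed

section \<open>JC-algebras\<close>

lemma operator_apply_simps [simp]:
  "operator_apply (S * T) x = operator_apply S (operator_apply T x)"
  "operator_apply (S + T) x = operator_apply S x + operator_apply T x"
  "operator_apply (S - T) x = operator_apply S x - operator_apply T x"
  "operator_apply (r *\<^sub>R T) x = r *\<^sub>R operator_apply T x"
  by (transfer; simp add: blinfun.bilinear_simps)+

lemma operator_apply_linear:
  "operator_apply T (x - y) = operator_apply T x - operator_apply T y"
  "operator_apply T (r *\<^sub>R x) = r *\<^sub>R operator_apply T x"
  by (transfer; simp add: blinfun.bilinear_simps)+

lemma norm_operator_apply_le: "norm (operator_apply T x) \<le> norm T * norm x"
  by transfer (rule norm_blinfun)

lemma norm_operator_leI:
  assumes "\<And>x. norm (operator_apply T x) \<le> M * norm x" "0 \<le> M"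
  shows "norm T \<le> M"
  using assms by transfer (rule norm_blinfun_bound)

text \<open>The operators form a copy of the complex-linear maps among the bounded real-linear ones;
  what has to be checked is that a norm limit is still complex-linear.\<close>

lemma complete_operator_set:
  fixes S :: "'h::complex_hilbert operator set"
  assumes "closed S" shows "complete S"
proof (rule completeI)
  fix f :: "nat \<Rightarrow> 'h operator" assume fS: "\<forall>n. f n \<in> S" and "Cauchy f"
  define g where "g n = blinfun_of_operator (f n)" for n
  have norm_g: "norm (blinfun_of_operator U) = norm U" for U :: "'h operator"
    by (simp add: norm_operator.rep_eq)
  have "dist (g m) (g n) = dist (f m) (f n)" for m n
    by (simp add: g_def dist_norm norm_operator.rep_eq minus_operator.rep_eq)
  then have "Cauchy g" using \<open>Cauchy f\<close> by (simp add: Cauchy_def)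
  then obtain L where L: "g \<longlonglongrightarrow> L" by (auto simp: Cauchy_convergent_iff convergent_def)
  have apply_lim: "(\<lambda>n. blinfun_apply (g n) x) \<longlonglongrightarrow> blinfun_apply L x" for x
    using L by (intro tendsto_intros)
  \<comment> \<open>Continuity of complex scalar multiplication rests on this identity, obtained
    from the inner product because the norm is introduced over the reals.\<close>
  have nC: "norm (c *\<^sub>C x) = cmod c * norm x" for c and x :: 'h
  proof -
    have "complex_of_real ((norm (c *\<^sub>C x))\<^sup>2) = c * cinner x (c *\<^sub>C x)"
      by (metis cinner_norm cinner_scaleC_left)
    also have "cinner x (c *\<^sub>C x) = cnj c * cinner x x"
      by (metis cinner_commute cinner_scaleC_left complex_cnj_mult)
    also have "c * (cnj c * cinner x x) = complex_of_real ((cmod c * norm x)\<^sup>2)"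
      by (simp only: cinner_norm complex_norm_square power_mult_distrib of_real_mult mult.assoc)
    finally have "(norm (c *\<^sub>C x))\<^sup>2 = (cmod c * norm x)\<^sup>2" by (simp only: of_real_eq_iff)
    then show ?thesis by (simp add: power2_eq_iff_nonneg)
  qed
  have "blinfun_apply L (c *\<^sub>C x) = c *\<^sub>C blinfun_apply L x" for c x
  proof -
    have "bounded_linear (\<lambda>x::'h. c *\<^sub>C x)"
      by (rule bounded_linear_intro[of _ "cmod c"])
        (simp_all add: scaleC_add_right scaleC_scaleR_commute nC mult.commute)
    from bounded_linear.tendsto[OF this apply_lim]
    have "(\<lambda>n. c *\<^sub>C blinfun_apply (g n) x) \<longlonglongrightarrow> c *\<^sub>C blinfun_apply L x" .
    moreover have "c *\<^sub>C blinfun_apply (g n) x = blinfun_apply (g n) (c *\<^sub>C x)" for n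
      using blinfun_of_operator[of "f n"] by (simp add: g_def)
    ultimately show ?thesis using apply_lim[of "c *\<^sub>C x"] LIMSEQ_unique by simp
  qed
  then have L': "blinfun_of_operator (operator_of_blinfun L) = L"
    by (intro operator_of_blinfun_inverse) simp
  have "(\<lambda>n. norm (g n - L)) \<longlonglongrightarrow> 0" 
    using iffD1[OF tendsto_dist_iff L] by (simp only: dist_norm)
  moreover have "norm (g n - L) = dist (f n) (operator_of_blinfun L)" for n
    by (simp add: dist_norm norm_operator.rep_eq minus_operator.rep_eq L' g_def)
  ultimately have lim: "f \<longlonglongrightarrow> operator_of_blinfun L"
    by (subst tendsto_dist_iff) simp
  then have "operator_of_blinfun L \<in> S" using closed_sequentially[OF assms] fS by blast
  with lim show "\<exists>l\<in>S. f \<longlonglongrightarrow> l" by blast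
qed

text \<open>Norms and positivity are visible in the real part alone, so the operator estimates are
  carried out in a real inner product space.\<close>

definition re_inner :: "'h::complex_hilbert \<Rightarrow> 'h \<Rightarrow> real" where
  "re_inner x y = Re (cinner x y)"

lemma re_inner_commute: "re_inner x y = re_inner y x"
  unfolding re_inner_def by (metis cinner_commute complex_cnj(1) complex.sel(1) complex.collapse)

lemma re_inner_add_left: "re_inner (x + y) z = re_inner x z + re_inner y z"
  by (simp add: re_inner_def cinner_add_left)

lemma re_inner_scale_left: "re_inner (r *\<^sub>R x) y = r * re_inner x y"
  using cinner_scaleC_left[of "complex_of_real r" x y] by (simp add: re_inner_def scaleC_of_real)

lemma re_inner_diff_left: "re_inner (x - y) z = re_inner x z - re_inner y z"
  using re_inner_add_left[of "x - y" y z] by simp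

lemmas re_inner_simps = re_inner_add_left re_inner_diff_left re_inner_scale_left
  re_inner_add_left[THEN trans[OF re_inner_commute]]
  re_inner_diff_left[THEN trans[OF re_inner_commute]]
  re_inner_scale_left[THEN trans[OF re_inner_commute]]

lemma re_inner_same: "re_inner x x = (norm x)\<^sup>2"
  by (simp add: re_inner_def cinner_norm)

text \<open>The triangle inequality of the given norm is the starting point, so Cauchy-Schwarz
  follows from it by expanding a square.\<close>

lemma re_inner_le: "re_inner x y \<le> norm x * norm y"
proof -
  have "(norm (x + y))\<^sup>2 = (norm x)\<^sup>2 + 2 * re_inner x y + (norm y)\<^sup>2"
    by (simp add: re_inner_simps re_inner_commute[of y x] flip: re_inner_same)
  moreover have "(norm (x + y))\<^sup>2 \<le> (norm x + norm y)\<^sup>2"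
    by (intro power_mono norm_triangle_ineq norm_ge_zero)
  ultimately show ?thesis by (simp add: power2_sum)
qed

lemma selfadjoint_re_inner:
  "selfadjoint_operator T \<Longrightarrow> re_inner (operator_apply T x) y = re_inner x (operator_apply T y)"
  by (simp add: selfadjoint_operator_def re_inner_def)

lemma positive_re_inner: "positive_operator T \<Longrightarrow> re_inner (operator_apply T x) x \<ge> 0"
  by (simp add: positive_operator_def re_inner_def)

lemma norm_square_selfadjoint_operator:
  assumes T: "selfadjoint_operator T" shows "norm (T * T) = (norm T)\<^sup>2"
proof (rule antisym)
  show "norm (T * T) \<le> (norm T)\<^sup>2" by (simp add: power2_eq_square norm_mult_ineq)
  have "norm (operator_apply T x) \<le> sqrt (norm (T * T)) * norm x" for x
  proof (rule power2_le_imp_le)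
    have "(norm (operator_apply T x))\<^sup>2 = re_inner (operator_apply (T * T) x) x"
      by (simp add: selfadjoint_re_inner[OF T] flip: re_inner_same)
    also have "\<dots> \<le> norm (operator_apply (T * T) x) * norm x" by (rule re_inner_le)
    also have "\<dots> \<le> (norm (T * T) * norm x) * norm x"
      by (intro mult_right_mono norm_operator_apply_le norm_ge_zero)
    finally show "(norm (operator_apply T x))\<^sup>2 \<le> (sqrt (norm (T * T)) * norm x)\<^sup>2"
      by (simp add: power_mult_distrib power2_eq_square[of "norm x"] mult.assoc)
  qed simp
  then have "norm T \<le> sqrt (norm (T * T))" by (rule norm_operator_leI) simp
  then have "(norm T)\<^sup>2 \<le> (sqrt (norm (T * T)))\<^sup>2" by (intro power_mono) auto
  then show "(norm T)\<^sup>2 \<le> norm (T * T)" by simp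
qed

text \<open>The Cauchy--Schwarz inequality for the form of \<open>S\<close>, applied to \<open>x\<close> and \<open>S x\<close>.\<close>

lemma positive_operator_norm_apply_le:
  assumes S: "positive_operator S"
  shows "(norm (operator_apply S x))\<^sup>2 \<le> norm S * re_inner (operator_apply S x) x"
proof (cases "norm S = 0")
  case True
  then show ?thesis using norm_operator_apply_le[of S x] by simp
next
  case False
  then have M: "norm S > 0" using norm_ge_zero[of S] by linarith
  have sa: "selfadjoint_operator S" using S by (simp add: positive_operator_def)
  define y where "y = operator_apply S x"
  \<comment> \<open>For this \<open>r\<close> the bound \<open>r^2 * norm S\<close> of the quadratic
    term equals \<open>r\<close>, which leaves exactly \<open>r * (norm y)^2\<close> of the linear
    term.\<close>
  define r where "r = 1 / norm S"
  have "0 \<le> re_inner (operator_apply S (x - r *\<^sub>R y)) (x - r *\<^sub>R y)" by (rule positive_re_inner[OF S])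
  also have "\<dots> = re_inner y x - 2 * r * re_inner y y + r\<^sup>2 * re_inner (operator_apply S y) y"
    using selfadjoint_re_inner[OF sa, of y x]
    by (simp add: operator_apply_linear re_inner_simps y_def[symmetric] power2_eq_square algebra_simps)
  also have "\<dots> \<le> re_inner y x - 2 * r * (norm y)\<^sup>2 + r\<^sup>2 * (norm S * (norm y)\<^sup>2)"
  proof -
    have "re_inner (operator_apply S y) y \<le> norm (operator_apply S y) * norm y" by (rule re_inner_le)
    also have "\<dots> \<le> norm S * norm y * norm y" by (intro mult_right_mono norm_operator_apply_le norm_ge_zero)
    finally show ?thesis
      by (simp add: re_inner_same power2_eq_square[of "norm y"] mult.assoc mult_left_mono)
  qed
  also have "r\<^sup>2 * (norm S * (norm y)\<^sup>2) = r * (norm y)\<^sup>2" using M by (simp add: r_def power2_eq_square)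
  finally have "r * (norm y)\<^sup>2 \<le> re_inner y x" by simp
  then show ?thesis using M by (simp add: r_def y_def divide_simps mult.commute)
qed

text \<open>The unit is idempotent. Multiplying \<open>e * T + T * e = T + T\<close> by
  \<open>e\<close> from the left and from the right gives \<open>e * T * e = e * T\<close> and
  \<open>e * T * e = T * e\<close>, so \<open>e\<close> commutes with \<open>T\<close>.\<close>

lemma jc_unit_mult:
  assumes "jc_algebra \<A>" "jc_unit \<A> e" "T \<in> \<A>"
  shows "e * T = T" "T * e = T"
proof -
  have J: "e * S + S * e = 2 *\<^sub>R S" if "S \<in> \<A>" for S
    using assms(2) that by (auto simp: jc_unit_def jordan_product_def scaleR_2 dest!: bspec
        intro: scaleR_left_imp_eq[of "1/2"])
  have "e \<in> \<A>" using assms by (simp add: jc_unit_def)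
  have ee: "e * e = e" using J[OF \<open>e \<in> \<A>\<close>] by (simp flip: scaleR_2)
  have "e * (e * T + T * e) = e * T + e * T" "(e * T + T * e) * e = T * e + T * e"
    unfolding J[OF assms(3)] by (simp_all add: scaleR_2 distrib_left distrib_right)
  then have "e * T + e * T * e = e * T + e * T" "e * T * e + T * e = T * e + T * e"
    by (simp_all add: ring_distribs mult.assoc ee) (simp_all add: ee flip: mult.assoc)
  then have "e * T = T * e" by (metis add_left_cancel add_right_cancel)
  then show "e * T = T" "T * e = T" using J[OF assms(3)] by (simp_all flip: scaleR_2)
qed

lemma jordan_part_jc:
  assumes A: "jc_algebra \<A>" and e: "jc_unit \<A> e"
  shows "jordan_part \<A> e \<A>"
proof
  show "subspace \<A>" using A by (simp add: jc_algebra_def)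
  show "complete \<A>" using A by (simp add: jc_algebra_def complete_operator_set)
  show "norm (x * x) = (norm x)\<^sup>2" if "x \<in> \<A>" for x
    using A that by (simp add: jc_algebra_def norm_square_selfadjoint_operator)
  show "x * y * x \<in> \<A>" if xy: "x \<in> \<A>" "y \<in> \<A>" for x y
  proof -
    have J: "jordan_product S T \<in> \<A>" if "S \<in> \<A>" "T \<in> \<A>" for S T
      using A that by (simp add: jc_algebra_def)
    have xx: "jordan_product x x = x * x" by (simp add: jordan_product_def flip: scaleR_2)
    have "2 *\<^sub>R jordan_product (jordan_product x y) x - jordan_product (jordan_product x x) y \<in> \<A>"
      using A by (intro subspace_diff subspace_scale J xy) (auto simp: jc_algebra_def)
    also have "2 *\<^sub>R jordan_product (jordan_product x y) x - jordan_product (jordan_product x x) y = x * y * x"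
      unfolding xx by (simp add: jordan_product_def ring_distribs scaleR_add_right mult.assoc)
        (simp flip: scaleR_left_distrib)
    finally show ?thesis .
  qed
qed (use jc_unit_mult[OF assms] e in \<open>auto simp: jc_unit_def\<close>)

text \<open>For positive \<open>z\<close> the quadratic form gives
  \<open>norm (M e - z) \<le> M\<close> with \<open>M = norm z\<close>, and the Neumann series then
  inverts \<open>z + t e\<close> inside \<open>\<A>\<close>, not merely in B(H). The invertibility
  of \<open>e + x * x\<close> is the case \<open>z = x * x\<close>, \<open>t = 1\<close>.\<close>

lemma positive_cone_jc:
  assumes A: "jc_algebra \<A>" and e: "jc_unit \<A> e"
  shows "positive_cone \<A> e (\<lambda>T. T \<in> \<A> \<and> positive_operator T) \<A>"
proof -
  interpret jordan_part \<A> e "\<lambda>T. T \<in> \<A> \<and> positive_operator T" \<A> by (rule jordan_part_jc[OF assms])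
  have sa: "selfadjoint_operator T" if "T \<in> \<A>" for T using A that by (simp add: jc_algebra_def)
  have square: "positive_operator (x * x)" if x: "x \<in> \<A>" for x
    unfolding positive_operator_def
  proof (intro conjI allI)
    show "selfadjoint_operator (x * x)" by (rule sa[OF square_H[OF x]])
    fix v
    have "re_inner (operator_apply (x * x) v) v = (norm (operator_apply x v))\<^sup>2"
      by (simp add: selfadjoint_re_inner[OF sa[OF x]] re_inner_same)
    then show "0 \<le> Re (cinner (operator_apply (x * x) v) v)" by (simp add: re_inner_def)
  qed
  have shift: "invertible_element (z + t *\<^sub>R e)" if z: "z \<in> \<A>" "positive_operator z" and t: "t > 0" for z t
  proof -
    define M where "M = norm z"
    have "norm (M *\<^sub>R e - z) \<le> M"
    proof (rule norm_operator_leI)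
      fix v
      define u where "u = operator_apply z v"
      \<comment> \<open>\<open>e\<close> may be a proper projection, but \<open>e * z = z\<close>
        allows it to be dropped against \<open>u = z v\<close>.\<close>
      have ze: "re_inner (operator_apply e v) u = re_inner v u"
        using selfadjoint_re_inner[OF sa[OF e_H], of v u] unit_H(1)[OF z(1)]
        unfolding u_def by (metis operator_apply_simps(1))
      have "norm (operator_apply e v) \<le> norm e * norm v" by (rule norm_operator_apply_le)
      also have "\<dots> \<le> 1 * norm v" using norm_e_le by (intro mult_right_mono) auto
      finally have ev: "(norm (operator_apply e v))\<^sup>2 \<le> (norm v)\<^sup>2" by (simp add: power_mono)
      have "(norm (operator_apply (M *\<^sub>R e - z) v))\<^sup>2
          = M\<^sup>2 * (norm (operator_apply e v))\<^sup>2 - 2 * M * re_inner v u + (norm u)\<^sup>2"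
        using ze re_inner_commute[of u "operator_apply e v"]
        by (simp add: re_inner_simps u_def[symmetric] power2_eq_square[of M] algebra_simps flip: re_inner_same)
      also have "\<dots> \<le> M\<^sup>2 * (norm v)\<^sup>2 - 2 * M * re_inner v u + M * re_inner v u"
        using positive_operator_norm_apply_le[OF z(2), of v] ev re_inner_commute[of v u]
        unfolding u_def M_def by (intro add_mono diff_mono mult_left_mono) auto
      also have "\<dots> \<le> (M * norm v)\<^sup>2"
        using positive_re_inner[OF z(2), of v] re_inner_commute[of v u]
        by (simp add: M_def u_def power_mult_distrib)
      finally show "norm (operator_apply (M *\<^sub>R e - z) v) \<le> M * norm v"
        by (rule power2_le_imp_le) (simp add: M_def)
    qed (simp add: M_def)
    moreover have "M \<ge> 0" by (simp add: M_def)
    ultimately have "norm (M *\<^sub>R e - z) < \<bar>M + t\<bar>" using t by linarith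
    then obtain b where "inverse_pair ((M + t) *\<^sub>R e - (M *\<^sub>R e - z)) b"
      using neumann_scale[of "M *\<^sub>R e - z" "M + t"] z by (auto simp: H_intros)
    also have "(M + t) *\<^sub>R e - (M *\<^sub>R e - z) = z + t *\<^sub>R e" by (simp add: algebra_simps)
    finally show ?thesis using invertible_iff[of "z + t *\<^sub>R e"] z by (auto simp: H_intros)
  qed
  show ?thesis
  proof
    show "invertible_element (e + x * x)" if "x \<in> \<A>" for x
      using shift[OF square_H[OF that] square[OF that], of 1] by (simp add: add.commute)
    show "y * z * y \<in> \<A> \<and> positive_operator (y * z * y)"
      if z: "z \<in> \<A> \<and> positive_operator z" and y: "y \<in> \<A>" for y z
    proof
      show yzy: "y * z * y \<in> \<A>" using quadratic_H z y by blast
      have "re_inner (operator_apply (y * z * y) v) v \<ge> 0" for v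
        using positive_re_inner[of z "operator_apply y v"] z
        by (simp add: selfadjoint_re_inner[OF sa[OF y]])
      then show "positive_operator (y * z * y)"
        by (simp add: positive_operator_def sa[OF yzy] re_inner_def del: operator_apply_simps)
    qed
  qed (use shift square square_H in auto)
qed

theorem corollary3p4:
  fixes \<delta> :: real
    and e\<^sub>1 A\<^sub>1 B\<^sub>1 :: "'a::cstar_algebra"
    and e\<^sub>2 A\<^sub>2 B\<^sub>2 :: "'b::real_cstar_algebra"
    and \<A> :: "'h::complex_hilbert operator set" and e\<^sub>3 A\<^sub>3 B\<^sub>3 :: "'h operator"
  shows
   "(unit_element e\<^sub>1 \<and>
     positive_element A\<^sub>1 \<and> unital_operator_algebra.invertible_element UNIV e\<^sub>1 A\<^sub>1 \<and>
     positive_element B\<^sub>1 \<and> unital_operator_algebra.invertible_element UNIV e\<^sub>1 B\<^sub>1 \<longrightarrow>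
       (1 \<le> \<delta> \<and> unital_operator_algebra.le positive_element (\<delta> *\<^sub>R A\<^sub>1) B\<^sub>1 \<longrightarrow>
          unital_operator_algebra.entropy_bounds_ge_1 UNIV e\<^sub>1 positive_element \<delta> A\<^sub>1 B\<^sub>1) \<and>
       (0 < \<delta> \<and> \<delta> \<le> 1 \<and> unital_operator_algebra.le positive_element B\<^sub>1 (\<delta> *\<^sub>R A\<^sub>1) \<longrightarrow>
          unital_operator_algebra.entropy_bounds_le_1 UNIV e\<^sub>1 positive_element \<delta> A\<^sub>1 B\<^sub>1)) \<and>
    (unit_element e\<^sub>2 \<and>
     positive_element A\<^sub>2 \<and> unital_operator_algebra.invertible_element UNIV e\<^sub>2 A\<^sub>2 \<and>
     positive_element B\<^sub>2 \<and> unital_operator_algebra.invertible_element UNIV e\<^sub>2 B\<^sub>2 \<longrightarrow>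
       (1 \<le> \<delta> \<and> unital_operator_algebra.le positive_element (\<delta> *\<^sub>R A\<^sub>2) B\<^sub>2 \<longrightarrow>
          unital_operator_algebra.entropy_bounds_ge_1 UNIV e\<^sub>2 positive_element \<delta> A\<^sub>2 B\<^sub>2) \<and>
       (0 < \<delta> \<and> \<delta> \<le> 1 \<and> unital_operator_algebra.le positive_element B\<^sub>2 (\<delta> *\<^sub>R A\<^sub>2) \<longrightarrow>
          unital_operator_algebra.entropy_bounds_le_1 UNIV e\<^sub>2 positive_element \<delta> A\<^sub>2 B\<^sub>2)) \<and>
    (jc_algebra \<A> \<and> jc_unit \<A> e\<^sub>3 \<and> A\<^sub>3 \<in> \<A> \<and> B\<^sub>3 \<in> \<A> \<and>
     positive_operator A\<^sub>3 \<and> unital_operator_algebra.invertible_element \<A> e\<^sub>3 A\<^sub>3 \<and>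
     positive_operator B\<^sub>3 \<and> unital_operator_algebra.invertible_element \<A> e\<^sub>3 B\<^sub>3 \<longrightarrow>
       (1 \<le> \<delta> \<and> unital_operator_algebra.le (\<lambda>T. T \<in> \<A> \<and> positive_operator T) (\<delta> *\<^sub>R A\<^sub>3) B\<^sub>3 \<longrightarrow>
          unital_operator_algebra.entropy_bounds_ge_1 \<A> e\<^sub>3 (\<lambda>T. T \<in> \<A> \<and> positive_operator T) \<delta> A\<^sub>3 B\<^sub>3) \<and>
       (0 < \<delta> \<and> \<delta> \<le> 1 \<and> unital_operator_algebra.le (\<lambda>T. T \<in> \<A> \<and> positive_operator T) B\<^sub>3 (\<delta> *\<^sub>R A\<^sub>3) \<longrightarrow>
          unital_operator_algebra.entropy_bounds_le_1 \<A> e\<^sub>3 (\<lambda>T. T \<in> \<A> \<and> positive_operator T) \<delta> A\<^sub>3 B\<^sub>3))"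
proof (intro conjI impI; elim conjE)
  assume "unit_element e\<^sub>1" "positive_element A\<^sub>1" "unital_operator_algebra.invertible_element UNIV e\<^sub>1 A\<^sub>1"
    "positive_element B\<^sub>1" "unital_operator_algebra.invertible_element UNIV e\<^sub>1 B\<^sub>1"
  then interpret positive_pair UNIV e\<^sub>1 positive_element "{x. star x = x}" A\<^sub>1 B\<^sub>1
    by (simp add: positive_pair_def positive_pair_axioms_def positive_cone_cstar)
  show "entropy_bounds_ge_1 \<delta> A\<^sub>1 B\<^sub>1" if "1 \<le> \<delta>" "le (\<delta> *\<^sub>R A\<^sub>1) B\<^sub>1"
    using that by (rule entropy_bounds_ge)
  show "entropy_bounds_le_1 \<delta> A\<^sub>1 B\<^sub>1" if "0 < \<delta>" "\<delta> \<le> 1" "le B\<^sub>1 (\<delta> *\<^sub>R A\<^sub>1)"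
    using that by (rule entropy_bounds_le)
next
  assume "unit_element e\<^sub>2" "positive_element A\<^sub>2" "unital_operator_algebra.invertible_element UNIV e\<^sub>2 A\<^sub>2"
    "positive_element B\<^sub>2" "unital_operator_algebra.invertible_element UNIV e\<^sub>2 B\<^sub>2"
  then interpret positive_pair UNIV e\<^sub>2 positive_element "{x. star x = x}" A\<^sub>2 B\<^sub>2
    by (simp add: positive_pair_def positive_pair_axioms_def positive_cone_real_cstar)
  show "entropy_bounds_ge_1 \<delta> A\<^sub>2 B\<^sub>2" if "1 \<le> \<delta>" "le (\<delta> *\<^sub>R A\<^sub>2) B\<^sub>2"
    using that by (rule entropy_bounds_ge)
  show "entropy_bounds_le_1 \<delta> A\<^sub>2 B\<^sub>2" if "0 < \<delta>" "\<delta> \<le> 1" "le B\<^sub>2 (\<delta> *\<^sub>R A\<^sub>2)"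
    using that by (rule entropy_bounds_le)
next
  assume "jc_algebra \<A>" "jc_unit \<A> e\<^sub>3" "A\<^sub>3 \<in> \<A>" "B\<^sub>3 \<in> \<A>"
    "positive_operator A\<^sub>3" "unital_operator_algebra.invertible_element \<A> e\<^sub>3 A\<^sub>3"
    "positive_operator B\<^sub>3" "unital_operator_algebra.invertible_element \<A> e\<^sub>3 B\<^sub>3"
  then interpret positive_pair \<A> e\<^sub>3 "\<lambda>T. T \<in> \<A> \<and> positive_operator T" \<A> A\<^sub>3 B\<^sub>3
    by (simp add: positive_pair_def positive_pair_axioms_def positive_cone_jc)
  show "entropy_bounds_ge_1 \<delta> A\<^sub>3 B\<^sub>3" if "1 \<le> \<delta>" "le (\<delta> *\<^sub>R A\<^sub>3) B\<^sub>3"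
    using that by (rule entropy_bounds_ge)
  show "entropy_bounds_le_1 \<delta> A\<^sub>3 B\<^sub>3" if "0 < \<delta>" "\<delta> \<le> 1" "le B\<^sub>3 (\<delta> *\<^sub>R A\<^sub>3)"
    using that by (rule entropy_bounds_le)
qed

end
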